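(* Let $f_1,f_2$ and $g$ be three admissible free holomorphic functions and let ${\bf W}^{(f_1)},{\bf W}^{(f_2)}$ and ${\bf W}^{(g)}$ be the associated universal models, respectively. Assume that $\mathcal D_{g^{-1}}$ is a regular domain and $\mathcal D^{pure}_{f_1^{-1}}\cup\mathcal D^{pure}_{f_2^{-1}}\subset\mathcal D^{pure}_{g^{-1}}$. Let $\mathcal F,\mathcal F_1,\mathcal F_2$ be Hilbert spaces and let $A:F^2(H_n)\otimes\mathcal F\to F^2(H_n)\otimes\mathcal F_1$ and $B:F^2(H_n)\otimes\mathcal F_2\to F^2(H_n)\otimes\mathcal F_1$ be multi-analytic operators, i.e. bounded operators with $$A(W_i^{(g)}\otimes I_{\mathcal F})=(W_i^{(f_1)}\otimes I_{\mathcal F_1})A\quad\text{and}\quad B(W_i^{(f_2)}\otimes I_{\mathcal F_2})=(W_i^{(f_1)}\otimes I_{\mathcal F_1})B$$ for every $i\in\{1,\ldots,n\}$. Then there is a contractive operator $C:F^2(H_n)\otimes\mathcal F\to F^2(H_n)\otimes\mathcal F_2$ such that $$C(W_i^{(g)}\otimes I_{\mathcal F})=(W_i^{(f_2)}\otimes I_{\mathcal F_2})C,\qquad i\in\{1,\ldots,n\},$$ and $A=BC$ if and only if $AA^*\le BB^*$.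
   Context: Fix an integer $n\ge 1$ and an $n$-dimensional complex Hilbert space $H_n$ with orthonormal basis $e_1,\ldots,e_n$. The full Fock space is $F^2(H_n)=\bigoplus_{k\ge0}H_n^{\otimes k}$, $H_n^{\otimes 0}=\mathbb C1$; left creation operators: $S_i\varphi=e_i\otimes\varphi$. $\mathbb F_n^+$ is the unital free semigroup on generators $g_1,\ldots,g_n$ with identity $g_0$; $|\alpha|$ is the length of $\alpha$. For $\alpha=g_{i_1}\cdots g_{i_k}$ put $e_\alpha=e_{i_1}\otimes\cdots\otimes e_{i_k}$, $e_{g_0}=1$, and for operators or indeterminates $X_\alpha=X_{i_1}\cdots X_{i_k}$, $X_{g_0}=I$. A formal power series $g=1+\sum_{|\alpha|\ge1}b_\alpha Z_\alpha$ in noncommuting indeterminates is an admissible free holomorphic function if: (a) $b_\alpha>0$, $b_{g_0}=1$, $\sup_{\alpha}\frac{b_\alpha}{b_{g_i\alpha}}<\infty$ for each $i$; (b) $\limsup_{k}(\sum_{|\alpha|=k}b_\alpha^2)^{1/2k}<\infty$; (c) $\sup_{k}\|\sum_{p=0}^k\sum_{|\alpha|=p}a_\alpha W_\alpha W_\alpha^*\|<\infty$, where $g^{-1}=1+\sum_{|\alpha|\ge1}a_\alpha Z_\alpha$ is the formal power series inverse and ${\bf W}^{(g)}=(W_1^{(g)},\ldots,W_n^{(g)})=(W_1,\ldots,W_n)$, the universal model of $g$, is given by $W_i=S_iD_i$, $D_ie_\alpha=\sqrt{b_\alpha/b_{g_i\alpha}}\,e_\alpha$. For a Hilbert space $\mathcal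 H$, $\mathcal D_{g^{-1}}(\mathcal H)$ is the set of $X=(X_1,\ldots,X_n)\in B(\mathcal H)^n$ such that (i) $\Delta_{g^{-1}}(X,X^* ):=\sum_{p=0}^\infty\sum_{|\alpha|=p}a_\alpha X_\alpha X_\alpha^*$ converges in the weak operator topology (WOT) and is $\ge0$; (ii) $\sum_{\alpha}b_\alpha X_\alpha\Delta_{g^{-1}}(X,X^* )X_\alpha^*\le I$ (WOT convergence). $X$ is pure if equality holds in (ii); $\mathcal D^{pure}_{g^{-1}}(\mathcal H)$ is the set of pure elements. Inclusions between the $\mathcal D^{pure}$'s mean that the inclusion holds over every Hilbert space $\mathcal H$. $\mathcal D_{g^{-1}}$ is a regular domain if $a_\alpha\le0$ for all $|\alpha|\ge1$ and $a_{g_i}<0$ for all $i$. *)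

theory Defs
  imports
    "HOL-Analysis.Analysis"
    "HOL-Library.Nonpos_Ints"
    "HOL-Library.Infinite_Typeclass"
begin

section \<open>Complex Hilbert spaces\<close>

text \<open>The inner product is linear in its first argument.  The real inner product inherited from
  \<^class>\<open>real_inner\<close> is its real part, so that norm and topology are the usual ones.\<close>

class chilbert_space = real_inner + complete_space +
  fixes scaleC :: "complex \<Rightarrow> 'a \<Rightarrow> 'a"  (infixr \<open>*\<^sub>C\<close> 75)
    and cinner :: "'a \<Rightarrow> 'a \<Rightarrow> complex"
  assumes scaleR_scaleC: "scaleR r x = complex_of_real r *\<^sub>C x"
    and scaleC_add_right: "c *\<^sub>C (x + y) = c *\<^sub>C x + c *\<^sub>C y"
    and scaleC_add_left: "(c + d) *\<^sub>C x = c *\<^sub>C x + d *\<^sub>C x"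
    and scaleC_scaleC: "c *\<^sub>C d *\<^sub>C x = (c * d) *\<^sub>C x"
    and scaleC_one: "1 *\<^sub>C x = x"
    and cinner_commute: "cinner x y = cnj (cinner y x)"
    and cinner_add_left: "cinner (x + y) z = cinner x z + cinner y z"
    and cinner_scaleC_left: "cinner (c *\<^sub>C x) y = c * cinner x y"
    and inner_Re_cinner: "inner x y = Re (cinner x y)"
begin

subclass banach ..

end

lemma cinner_self: "cinner x x = complex_of_real ((norm (x :: 'a::chilbert_space))\<^sup>2)"
proof -
  have "Im (cinner x x) = 0"
    using arg_cong[OF cinner_commute[of x x], of Im] by simp
  moreover have "Re (cinner x x) = (norm x)\<^sup>2"
    by (simp add: inner_Re_cinner[symmetric] power2_norm_eq_inner)
  ultimately show ?thesis
    by (simp add: complex_eq_iff)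
qed

lemma norm_scaleC: "norm (c *\<^sub>C (x :: 'a::chilbert_space)) = cmod c * norm x"
proof -
  have "cinner (c *\<^sub>C x) (c *\<^sub>C x) = c * (cnj c * cinner x x)"
    by (metis cinner_commute cinner_scaleC_left complex_cnj_cnj complex_cnj_mult)
  also have "\<dots> = complex_of_real ((cmod c * norm x)\<^sup>2)"
    by (simp add: cinner_self power_mult_distrib flip: complex_norm_square)
  finally have "(norm (c *\<^sub>C x))\<^sup>2 = (cmod c * norm x)\<^sup>2"
    unfolding cinner_self of_real_eq_iff .
  then show ?thesis
    by simp
qed

lemma scaleC_zero [simp]: "c *\<^sub>C (0 :: 'a::chilbert_space) = 0" "0 *\<^sub>C (x :: 'a) = 0"
  by (simp_all add: norm_scaleC flip: norm_eq_zero)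

lemma cinner_Cauchy_Schwarz: "cmod (cinner x y) \<le> norm (x :: 'a::chilbert_space) * norm y"
proof (cases "cinner x y = 0")
  case False
  define c where "c = cnj (cinner x y) / complex_of_real (cmod (cinner x y))"
  have c: "cmod c = 1"
    using False by (simp add: c_def norm_divide)
  have "c * cinner x y = complex_of_real (cmod (cinner x y))"
    using False by (simp add: c_def mult.commute[of "cnj _"] flip: complex_norm_square)
       (simp add: power2_eq_square)
  then have "cmod (cinner x y) = inner (c *\<^sub>C x) y"
    by (simp add: inner_Re_cinner cinner_scaleC_left)
  also have "\<dots> \<le> norm (c *\<^sub>C x) * norm y"
    by (rule norm_cauchy_schwarz)
  finally show ?thesis
    by (simp add: norm_scaleC c)
qed simp

instantiation complex :: chilbert_space
begin

definition scaleC_complex :: "complex \<Rightarrow> complex \<Rightarrow> complex" where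
  "scaleC_complex c z = c * z"

definition cinner_complex :: "complex \<Rightarrow> complex \<Rightarrow> complex" where
  "cinner_complex z w = z * cnj w"

instance
  by intro_classes
    (auto simp: scaleC_complex_def cinner_complex_def algebra_simps inner_complex_def
      scaleR_conv_of_real)

end


section \<open>Hilbert sums of copies of a Hilbert space\<close>

typedef (overloaded) ('i, 'a::chilbert_space) ell2 =
  "{h :: 'i \<Rightarrow> 'a. (\<lambda>i. (norm (h i))\<^sup>2) summable_on UNIV}"
  morphisms ell2_apply Abs_ell2
  by (rule exI[of _ "\<lambda>_. 0"]) simp

setup_lifting type_definition_ell2

lemma ell2_summable: "(\<lambda>i. (norm (ell2_apply h i))\<^sup>2) summable_on UNIV"
  using ell2_apply[of h] by simp

lemma ell2_add_aux:
  assumes "(\<lambda>i. (norm (h i))\<^sup>2) summable_on UNIV"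
    and "(\<lambda>i. (norm (k i :: 'a::real_normed_vector))\<^sup>2) summable_on UNIV"
  shows "(\<lambda>i. (norm (h i + k i))\<^sup>2) summable_on UNIV"
proof (rule summable_on_comparison_test)
  show "(\<lambda>i. 2 * (norm (h i))\<^sup>2 + 2 * (norm (k i))\<^sup>2) summable_on UNIV"
    by (intro summable_on_add summable_on_cmult_right assms)
  show "(norm (h i + k i))\<^sup>2 \<le> 2 * (norm (h i))\<^sup>2 + 2 * (norm (k i))\<^sup>2" for i
  proof -
    have "(norm (h i + k i))\<^sup>2 \<le> (norm (h i) + norm (k i))\<^sup>2"
      by (intro power_mono norm_triangle_ineq) simp
    also have "\<dots> \<le> 2 * (norm (h i))\<^sup>2 + 2 * (norm (k i))\<^sup>2"
      using sum_squares_bound[of "norm (h i)" "norm (k i)"] by (simp add: power2_sum)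
    finally show ?thesis .
  qed
qed auto

lemma ell2_scale_aux:
  assumes "(\<lambda>i. (norm (h i))\<^sup>2) summable_on UNIV"
    and "\<And>i. norm (k i :: 'a::real_normed_vector) \<le> c * norm (h i)"
  shows "(\<lambda>i. (norm (k i))\<^sup>2) summable_on UNIV"
proof (rule summable_on_comparison_test)
  show "(\<lambda>i. c\<^sup>2 * (norm (h i))\<^sup>2) summable_on UNIV"
    by (intro summable_on_cmult_right assms)
  show "(norm (k i))\<^sup>2 \<le> c\<^sup>2 * (norm (h i))\<^sup>2" for i
    using power_mono[OF assms(2)[of i] norm_ge_zero, of 2] by (simp add: power_mult_distrib)
qed auto

lemma ell2_cinner_summable:
  "(\<lambda>i. cinner (ell2_apply h i) (ell2_apply k i)) summable_on UNIV"
proof (rule summable_on_iff_abs_summable_on_complex[THEN iffD2],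
    rule Infinite_Sum.abs_summable_on_comparison_test')
  show "(\<lambda>i. (norm (ell2_apply h i))\<^sup>2 + (norm (ell2_apply k i))\<^sup>2) summable_on UNIV"
    by (intro summable_on_add ell2_summable)
  show "cmod (cinner (ell2_apply h i) (ell2_apply k i))
      \<le> (norm (ell2_apply h i))\<^sup>2 + (norm (ell2_apply k i))\<^sup>2" for i
    using cinner_Cauchy_Schwarz[of "ell2_apply h i" "ell2_apply k i"]
      sum_squares_bound[of "norm (ell2_apply h i)" "norm (ell2_apply k i)"]
      mult_nonneg_nonneg[OF norm_ge_zero[of "ell2_apply h i"] norm_ge_zero[of "ell2_apply k i"]]
    by linarith
qed

lemma ell2_inner_summable:
  "(\<lambda>i. inner (ell2_apply h i) (ell2_apply k i)) summable_on UNIV"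
  unfolding inner_Re_cinner by (intro summable_on_Re ell2_cinner_summable)

instantiation ell2 :: (type, chilbert_space) real_inner
begin

lift_definition zero_ell2 :: "('a, 'b) ell2" is "\<lambda>_. 0"
  by simp

lift_definition plus_ell2 :: "('a, 'b) ell2 \<Rightarrow> ('a, 'b) ell2 \<Rightarrow> ('a, 'b) ell2"
  is "\<lambda>h k i. h i + k i"
  by (rule ell2_add_aux)

lift_definition uminus_ell2 :: "('a, 'b) ell2 \<Rightarrow> ('a, 'b) ell2" is "\<lambda>h i. - h i"
  by simp

lift_definition minus_ell2 :: "('a, 'b) ell2 \<Rightarrow> ('a, 'b) ell2 \<Rightarrow> ('a, 'b) ell2"
  is "\<lambda>h k i. h i - k i"
  using ell2_add_aux[where k = "\<lambda>i. - k i" for k] by fastforce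

lift_definition scaleR_ell2 :: "real \<Rightarrow> ('a, 'b) ell2 \<Rightarrow> ('a, 'b) ell2"
  is "\<lambda>r h i. r *\<^sub>R h i"
  by (rule ell2_scale_aux) auto

definition inner_ell2 :: "('a, 'b) ell2 \<Rightarrow> ('a, 'b) ell2 \<Rightarrow> real" where
  "inner_ell2 h k = (\<Sum>\<^sub>\<infinity>i. inner (ell2_apply h i) (ell2_apply k i))"

definition norm_ell2 :: "('a, 'b) ell2 \<Rightarrow> real" where
  "norm_ell2 h = sqrt (\<Sum>\<^sub>\<infinity>i. (norm (ell2_apply h i))\<^sup>2)"

definition sgn_ell2 :: "('a, 'b) ell2 \<Rightarrow> ('a, 'b) ell2" where
  "sgn_ell2 h = scaleR (inverse (norm h)) h"

definition dist_ell2 :: "('a, 'b) ell2 \<Rightarrow> ('a, 'b) ell2 \<Rightarrow> real" where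
  "dist_ell2 h k = norm (h - k)"

definition uniformity_ell2 :: "(('a, 'b) ell2 \<times> ('a, 'b) ell2) filter" where
  "uniformity_ell2 = (INF e\<in>{0<..}. principal {(x, y). dist x y < e})"

definition open_ell2 :: "('a, 'b) ell2 set \<Rightarrow> bool" where
  "open_ell2 U \<longleftrightarrow> (\<forall>x\<in>U. \<forall>\<^sub>F (x', y) in uniformity. x' = x \<longrightarrow> y \<in> U)"

lemma ell2_sum_le_norm:
  fixes h :: "('a, 'b) ell2"
  assumes "finite I"
  shows "(\<Sum>i\<in>I. (norm (ell2_apply h i))\<^sup>2) \<le> (norm h)\<^sup>2"
proof -
  have "(\<Sum>i\<in>I. (norm (ell2_apply h i))\<^sup>2) \<le> (\<Sum>\<^sub>\<infinity>i. (norm (ell2_apply h i))\<^sup>2)"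
    by (rule finite_sum_le_infsum[OF ell2_summable]) (auto simp: assms)
  also have "\<dots> = (norm h)\<^sup>2"
    by (simp add: norm_ell2_def infsum_nonneg)
  finally show ?thesis .
qed

lemma ell2_norm_leI:
  fixes h :: "('a, 'b) ell2"
  assumes "\<And>I. finite I \<Longrightarrow> (\<Sum>i\<in>I. (norm (ell2_apply h i))\<^sup>2) \<le> e\<^sup>2" "0 \<le> e"
  shows "norm h \<le> e"
proof -
  have "(\<Sum>\<^sub>\<infinity>i. (norm (ell2_apply h i))\<^sup>2) \<le> e\<^sup>2"
    by (rule infsum_le_finite_sums[OF ell2_summable]) (use assms in auto)
  then show ?thesis
    using assms(2) by (simp add: norm_ell2_def real_le_lsqrt infsum_nonneg)
qed

lemma ell2_norm_apply_le: "norm (ell2_apply h i) \<le> norm h"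
  for h :: "('a, 'b) ell2"
proof -
  have "0 \<le> norm h"
    by (simp add: norm_ell2_def infsum_nonneg)
  then show ?thesis
    using ell2_sum_le_norm[of "{i}" h] by (simp add: power2_le_iff_abs_le)
qed

instance
proof
  fix x y z :: "('a, 'b) ell2" and r s :: real
  show "x + y + z = x + (y + z)" "x + y = y + x" "0 + x = x" "- x + x = 0" "x - y = x + - y"
    by (transfer; simp add: algebra_simps)+
  show "r *\<^sub>R (x + y) = r *\<^sub>R x + r *\<^sub>R y" "(r + s) *\<^sub>R x = r *\<^sub>R x + s *\<^sub>R x"
    "r *\<^sub>R s *\<^sub>R x = (r * s) *\<^sub>R x" "1 *\<^sub>R x = x"
    by (transfer; simp add: algebra_simps)+
  show "sgn x = inverse (norm x) *\<^sub>R x"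
    by (rule sgn_ell2_def)
  show "dist x y = norm (x - y)"
    by (rule dist_ell2_def)
  show "norm x = sqrt (inner x x)"
    by (simp add: norm_ell2_def inner_ell2_def power2_norm_eq_inner)
  then have *: "norm x = 0 \<longleftrightarrow> inner x x = 0"
    by simp
  show "uniformity = (INF e\<in>{0<..}. principal {(x :: ('a, 'b) ell2, y). dist x y < e})"
    by (rule uniformity_ell2_def)
  show "open U = (\<forall>x\<in>U. \<forall>\<^sub>F (x', y) in uniformity. x' = x \<longrightarrow> y \<in> U)"
    for U :: "('a, 'b) ell2 set"
    by (rule open_ell2_def)
  show "inner x y = inner y x"
    by (simp add: inner_ell2_def inner_commute)
  show "inner (x + y) z = inner x z + inner y z"
    by (simp add: inner_ell2_def plus_ell2.rep_eq inner_add_left infsum_add ell2_inner_summable)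
  show "inner (r *\<^sub>R x) y = r * inner x y"
    by (simp add: inner_ell2_def scaleR_ell2.rep_eq infsum_cmult_right ell2_inner_summable)
  show "0 \<le> inner x x"
    by (simp add: inner_ell2_def infsum_nonneg)
  show "(inner x x = 0) = (x = 0)"
  proof
    assume "inner x x = 0"
    then have "norm (ell2_apply x i) \<le> 0" for i
      using ell2_norm_apply_le[of x i] * by simp
    then show "x = 0"
      by (intro ell2_apply_inject[THEN iffD1] ext) (simp add: zero_ell2.rep_eq)
  qed (simp add: inner_ell2_def zero_ell2.rep_eq)
qed

end

instance ell2 :: (type, chilbert_space) complete_space
proof
  fix X :: "nat \<Rightarrow> ('a, 'b) ell2"
  assume "Cauchy X"
  then have cau: "\<exists>N. \<forall>m\<ge>N. \<forall>n\<ge>N. norm (X m - X n) < e" if "0 < e" for e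
    using that unfolding Cauchy_def dist_norm by blast
  have diff: "ell2_apply (x - y) i = ell2_apply x i - ell2_apply y i" for x y :: "('a, 'b) ell2" and i
    by (simp add: minus_ell2.rep_eq)
  have "Cauchy (\<lambda>n. ell2_apply (X n) i)" for i
    unfolding Cauchy_def dist_norm diff[symmetric]
    using cau ell2_norm_apply_le[of _ i] by (meson le_less_trans)
  then obtain L where L: "(\<lambda>n. ell2_apply (X n) i) \<longlonglongrightarrow> L i" for i
    unfolding Cauchy_convergent_iff convergent_def by metis
  have fin: "(\<Sum>i\<in>I. (norm (ell2_apply (X m) i - L i))\<^sup>2) \<le> e\<^sup>2"
    if "finite I" "0 < e" "\<forall>n\<ge>N. norm (X m - X n) < e" for I m N e
  proof (rule tendsto_upperbound)
    show "(\<lambda>n. \<Sum>i\<in>I. (norm (ell2_apply (X m) i - ell2_apply (X n) i))\<^sup>2)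
        \<longlonglongrightarrow> (\<Sum>i\<in>I. (norm (ell2_apply (X m) i - L i))\<^sup>2)"
      by (intro tendsto_intros L)
    show "\<forall>\<^sub>F n in sequentially.
        (\<Sum>i\<in>I. (norm (ell2_apply (X m) i - ell2_apply (X n) i))\<^sup>2) \<le> e\<^sup>2"
      using eventually_ge_at_top[of N]
    proof eventually_elim
      case (elim n)
      have "(norm (X m - X n))\<^sup>2 \<le> e\<^sup>2"
        using that elim by (intro power_mono) (auto intro: less_imp_le)
      then show ?case
        using ell2_sum_le_norm[OF \<open>finite I\<close>, of "X m - X n"] by (simp add: diff)
    qed
  qed simp
  obtain N where N: "\<forall>m\<ge>N. \<forall>n\<ge>N. norm (X m - X n) < 1"
    using cau[of 1] by auto
  have "(\<lambda>i. (norm (ell2_apply (X N) i - L i))\<^sup>2) summable_on UNIV"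
  proof (rule nonneg_bdd_above_summable_on)
    show "bdd_above (sum (\<lambda>i. (norm (ell2_apply (X N) i - L i))\<^sup>2) ` {F. F \<subseteq> UNIV \<and> finite F})"
      using fin[of _ 1 N N] N by (intro bdd_aboveI2[where M = "1\<^sup>2"]) auto
  qed simp
  from ell2_add_aux[OF ell2_summable[of "X N"], of "\<lambda>i. L i - ell2_apply (X N) i"] this
  have "(\<lambda>i. (norm (L i))\<^sup>2) summable_on UNIV"
    by (simp add: norm_minus_commute)
  then have L': "ell2_apply (Abs_ell2 L) = L"
    by (simp add: Abs_ell2_inverse)
  have "X \<longlonglongrightarrow> Abs_ell2 L"
    unfolding LIMSEQ_def
  proof (intro allI impI)
    fix e :: real assume "0 < e"
    then obtain N where N: "\<forall>m\<ge>N. \<forall>n\<ge>N. norm (X m - X n) < e / 2"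
      using cau[of "e / 2"] by auto
    have "norm (X m - Abs_ell2 L) \<le> e / 2" if "m \<ge> N" for m
      using fin[of _ "e / 2" N m] N that \<open>0 < e\<close>
      by (intro ell2_norm_leI) (simp_all add: diff L')
    then show "\<exists>N. \<forall>n\<ge>N. dist (X n) (Abs_ell2 L) < e"
      using \<open>0 < e\<close> unfolding dist_norm by (intro exI[of _ N]) fastforce
  qed
  then show "convergent X"
    by (auto simp: convergent_def)
qed

instantiation ell2 :: (type, chilbert_space) chilbert_space
begin

lift_definition scaleC_ell2 :: "complex \<Rightarrow> ('a, 'b) ell2 \<Rightarrow> ('a, 'b) ell2"
  is "\<lambda>c h i. c *\<^sub>C h i"
  by (rule ell2_scale_aux) (auto simp: norm_scaleC)

definition cinner_ell2 :: "('a, 'b) ell2 \<Rightarrow> ('a, 'b) ell2 \<Rightarrow> complex" where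
  "cinner_ell2 h k = (\<Sum>\<^sub>\<infinity>i. cinner (ell2_apply h i) (ell2_apply k i))"

instance
proof
  fix x y z :: "('a, 'b) ell2" and r :: real and c d :: complex
  show "c *\<^sub>C (x + y) = c *\<^sub>C x + c *\<^sub>C y" "(c + d) *\<^sub>C x = c *\<^sub>C x + d *\<^sub>C x"
    "c *\<^sub>C d *\<^sub>C x = (c * d) *\<^sub>C x" "1 *\<^sub>C x = x" "r *\<^sub>R x = complex_of_real r *\<^sub>C x"
    by (transfer; simp add: scaleC_add_right scaleC_add_left scaleC_scaleC scaleC_one
        scaleR_scaleC)+
  show "cinner x y = cnj (cinner y x)"
    unfolding cinner_ell2_def infsum_cnj[symmetric] by (subst cinner_commute) simp
  show "cinner (x + y) z = cinner x z + cinner y z"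
    unfolding cinner_ell2_def
    by (simp add: plus_ell2.rep_eq cinner_add_left infsum_add ell2_cinner_summable)
  show "cinner (c *\<^sub>C x) y = c * cinner x y" for c
    unfolding cinner_ell2_def
    by (simp add: scaleC_ell2.rep_eq cinner_scaleC_left infsum_cmult_right ell2_cinner_summable)
  show "inner x y = Re (cinner x y)"
    by (simp add: inner_ell2_def cinner_ell2_def inner_Re_cinner infsum_Re[OF ell2_cinner_summable])
qed

end

lemma ell2_eqI: "(\<And>i. ell2_apply h i = ell2_apply k i) \<Longrightarrow> h = k"
  using ell2_apply_inject by blast

lemma ell2_apply_sum: "ell2_apply (\<Sum>j\<in>J. h j) i = (\<Sum>j\<in>J. ell2_apply (h j) i)"
  by (induction J rule: infinite_finite_induct) (simp_all add: zero_ell2.rep_eq plus_ell2.rep_eq)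


section \<open>Bounded operators on Hilbert spaces\<close>

text \<open>Some statements quantify over all Hilbert spaces, which cannot be done by quantifying over
  types inside a formula.  Hilbert spaces are therefore also represented by closed complex linear
  subspaces \<open>H\<close> of a type of class \<^class>\<open>chilbert_space\<close>; every Hilbert space is unitarily
  equivalent to a closed subspace of \<^typ>\<open>('i, complex) ell2\<close> for a large enough type \<open>'i\<close>.
  An operator on \<open>H\<close> is a function on the whole type, whose values outside \<open>H\<close> are
  irrelevant.\<close>

definition closed_csubspace :: "'h::chilbert_space set \<Rightarrow> bool" where
  "closed_csubspace H \<longleftrightarrow> closed H \<and> 0 \<in> H \<and> (\<forall>x\<in>H. \<forall>y\<in>H. x + y \<in> H) \<and> (\<forall>c. \<forall>x\<in>H. c *\<^sub>C x \<in> H)"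

definition bounded_clinear_on ::
    "'h::chilbert_space set \<Rightarrow> 'k::chilbert_space set \<Rightarrow> ('h \<Rightarrow> 'k) \<Rightarrow> bool" where
  "bounded_clinear_on H K T \<longleftrightarrow>
     (\<forall>x\<in>H. T x \<in> K) \<and>
     (\<forall>x\<in>H. \<forall>y\<in>H. T (x + y) = T x + T y) \<and>
     (\<forall>c. \<forall>x\<in>H. T (c *\<^sub>C x) = c *\<^sub>C T x) \<and>
     (\<exists>M. \<forall>x\<in>H. norm (T x) \<le> M * norm x)"

abbreviation bounded_clinear :: "('h::chilbert_space \<Rightarrow> 'k::chilbert_space) \<Rightarrow> bool" where
  "bounded_clinear \<equiv> bounded_clinear_on UNIV UNIV"

text \<open>The adjoint of an operator defined on \<open>H\<close>; it exists by the Riesz representation theorem.\<close>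

definition adj_on ::
    "'h::chilbert_space set \<Rightarrow> ('h \<Rightarrow> 'k::chilbert_space) \<Rightarrow> 'k \<Rightarrow> 'h" where
  "adj_on H T y = (THE z. z \<in> H \<and> (\<forall>x\<in>H. cinner (T x) y = cinner x z))"

abbreviation adj :: "('h::chilbert_space \<Rightarrow> 'k::chilbert_space) \<Rightarrow> 'k \<Rightarrow> 'h" where
  "adj \<equiv> adj_on UNIV"

definition nonneg_on :: "'h::chilbert_space set \<Rightarrow> ('h \<Rightarrow> 'h) \<Rightarrow> bool" where
  "nonneg_on H T \<longleftrightarrow> (\<forall>x\<in>H. cinner (T x) x \<in> \<real>\<^sub>\<ge>\<^sub>0)"

definition op_le_on :: "'h::chilbert_space set \<Rightarrow> ('h \<Rightarrow> 'h) \<Rightarrow> ('h \<Rightarrow> 'h) \<Rightarrow> bool" where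
  "op_le_on H S T \<longleftrightarrow> nonneg_on H (\<lambda>x. T x - S x)"

definition wot_sums :: "'h::chilbert_space set \<Rightarrow> (nat \<Rightarrow> 'h \<Rightarrow> 'h) \<Rightarrow> ('h \<Rightarrow> 'h) \<Rightarrow> bool" where
  "wot_sums H T S \<longleftrightarrow>
     bounded_clinear_on H H S \<and>
     (\<forall>x\<in>H. \<forall>y\<in>H. (\<lambda>p. cinner (T p x) y) sums cinner (S x) y)"


section \<open>Noncommutative formal power series\<close>

text \<open>The generators are the elements of a finite type \<open>'n\<close>, so that \<open>n = CARD('n) \<ge> 1\<close>;
  the free monoid is \<open>'n list\<close>, and a formal power series is the family of its coefficients.\<close>

type_synonym 'n ncfps = "'n list \<Rightarrow> real"

definition ncfps_one :: "'n ncfps" where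
  "ncfps_one \<gamma> = (if \<gamma> = [] then 1 else 0)"

definition ncfps_mult :: "'n ncfps \<Rightarrow> 'n ncfps \<Rightarrow> 'n ncfps" where
  "ncfps_mult f g \<gamma> = (\<Sum>(\<alpha>, \<beta>) | \<alpha> @ \<beta> = \<gamma>. f \<alpha> * g \<beta>)"

definition ncfps_inverse :: "'n ncfps \<Rightarrow> 'n ncfps" where
  "ncfps_inverse f = (THE a. ncfps_mult f a = ncfps_one \<and> ncfps_mult a f = ncfps_one)"


section \<open>The full Fock space and universal models\<close>

text \<open>Since the vectors \<open>e\<^sub>\<alpha>\<close> form an orthonormal basis of the full Fock space, the latter is
  identified with \<open>\<ell>\<^sup>2\<close> of the free monoid, and its Hilbert tensor product with a Hilbert space
  \<open>'f\<close> is identified with the square summable \<open>'f\<close>-valued families.\<close>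

type_synonym ('n, 'f) fock_tensor = "('n list, 'f) ell2"
type_synonym 'n fock = "('n, complex) fock_tensor"

lift_definition ell2_tensor ::
    "('i, complex) ell2 \<Rightarrow> 'f::chilbert_space \<Rightarrow> ('i, 'f) ell2"  (infixr \<open>\<otimes>\<close> 70)
  is "\<lambda>\<phi> x i. \<phi> i *\<^sub>C x"
proof -
  fix \<phi> :: "'i \<Rightarrow> complex" and x :: 'f
  assume "(\<lambda>i. (cmod (\<phi> i))\<^sup>2) summable_on UNIV"
  then show "(\<lambda>i. (norm (\<phi> i *\<^sub>C x))\<^sup>2) summable_on UNIV"
    by (rule ell2_scale_aux[where c = "norm x"]) (simp add: norm_scaleC mult.commute)
qed

lift_definition ell2_basis :: "'i \<Rightarrow> ('i, complex) ell2" is "\<lambda>i j. if j = i then 1 else 0"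
proof -
  fix i :: 'i
  have "(\<lambda>j. (cmod (if j = i then 1 else 0))\<^sup>2) summable_on {i}"
    by simp
  then show "(\<lambda>j. (cmod (if j = i then 1 else 0))\<^sup>2) summable_on UNIV"
    by (subst summable_on_cong_neutral[where T = "{i}"]) auto
qed

lemma summable_on_Cons:
  assumes "(\<lambda>\<alpha>. (norm (h \<alpha>))\<^sup>2) summable_on UNIV"
  shows "(\<lambda>w. (norm (case w of [] \<Rightarrow> 0 | j # \<alpha> \<Rightarrow> if j = i then h \<alpha> else (0 :: 'f::real_normed_vector)))\<^sup>2)
    summable_on UNIV" (is "?k summable_on _")
proof -
  have "(?k \<circ> Cons i) summable_on UNIV"
    using assms by (simp add: o_def)
  then have "?k summable_on range (Cons i)"
    by (subst summable_on_reindex) (auto simp: inj_on_def)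
  then show ?thesis
    by (subst summable_on_cong_neutral[where T = "range (Cons i)" and g = ?k])
      (auto split: list.splits)
qed

lift_definition creation :: "'n \<Rightarrow> 'n fock \<Rightarrow> 'n fock"
  is "\<lambda>i \<phi> w. case w of [] \<Rightarrow> 0 | j # \<alpha> \<Rightarrow> if j = i then \<phi> \<alpha> else 0"
  by (rule summable_on_Cons)

text \<open>Meaningful only if the weights \<open>b\<^sub>\<alpha> / b\<^bsub>g\<^sub>i \<alpha>\<^esub>\<close> are bounded in \<open>\<alpha>\<close>.\<close>

definition diagonal_weight :: "'n ncfps \<Rightarrow> 'n \<Rightarrow> 'n fock \<Rightarrow> 'n fock" where
  "diagonal_weight b i \<phi> =
     Abs_ell2 (\<lambda>\<alpha>. complex_of_real (sqrt (b \<alpha> / b (i # \<alpha>))) * ell2_apply \<phi> \<alpha>)"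

definition universal_model :: "'n ncfps \<Rightarrow> 'n \<Rightarrow> 'n fock \<Rightarrow> 'n fock" where
  "universal_model b i = creation i \<circ> diagonal_weight b i"

text \<open>\<open>T \<otimes> I\<close>, characterised by its values on elementary tensors.\<close>

definition amplify ::
    "(('i, complex) ell2 \<Rightarrow> ('i, complex) ell2) \<Rightarrow> ('i, 'f::chilbert_space) ell2 \<Rightarrow> ('i, 'f) ell2"
  where
  "amplify T = (THE V. bounded_clinear V \<and> (\<forall>\<phi> x. V (\<phi> \<otimes> x) = T \<phi> \<otimes> x))"

text \<open>The identification of the square summable families with the Hilbert tensor product:
  inner products of elementary tensors multiply, and elementary tensors are total.\<close>

lemma cinner_scaleC_right: "cinner x (c *\<^sub>C y) = cnj c * cinner x (y :: 'a::chilbert_space)"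
  by (metis cinner_commute cinner_scaleC_left complex_cnj_mult)

lemma cinner_ell2_tensor: "cinner (\<phi> \<otimes> x) (\<psi> \<otimes> y) = cinner \<phi> \<psi> * cinner x y"
proof -
  have "cinner (\<phi> \<otimes> x) (\<psi> \<otimes> y)
      = (\<Sum>\<^sub>\<infinity>i. cinner (ell2_apply \<phi> i) (ell2_apply \<psi> i) * cinner x y)"
    by (simp add: cinner_ell2_def ell2_tensor.rep_eq cinner_scaleC_left cinner_scaleC_right
        cinner_complex_def mult_ac)
  then show ?thesis
    by (simp add: cinner_ell2_def infsum_cmult_left ell2_cinner_summable)
qed

lemma cinner_ell2_basis: "cinner (ell2_basis i) (ell2_basis j) = (if i = j then 1 else 0)"
proof -
  have "(\<Sum>\<^sub>\<infinity>k. (if k = i then 1 else 0) * cnj (if k = j then 1 else (0::complex)))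
      = (\<Sum>\<^sub>\<infinity>k\<in>{i}. if i = j then 1 else 0)"
    by (rule infsum_cong_neutral) auto
  then show ?thesis
    by (simp add: cinner_ell2_def ell2_basis.rep_eq cinner_complex_def)
qed

lemma has_sum_ell2_basis_tensor:
  fixes h :: "('i, 'f::chilbert_space) ell2"
  shows "((\<lambda>i. ell2_basis i \<otimes> ell2_apply h i) has_sum h) UNIV"
  unfolding has_sum_def
proof (rule tendstoI)
  fix e :: real assume e: "0 < e"
  let ?s = "\<Sum>\<^sub>\<infinity>i. (norm (ell2_apply h i))\<^sup>2"
  have "(sum (\<lambda>i. (norm (ell2_apply h i))\<^sup>2) \<longlongrightarrow> ?s) (finite_subsets_at_top UNIV)"
    using has_sum_infsum[OF ell2_summable[of h]] by (simp add: has_sum_def)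
  then have "\<forall>\<^sub>F F in finite_subsets_at_top UNIV.
      dist (sum (\<lambda>i. (norm (ell2_apply h i))\<^sup>2) F) ?s < (e / 2)\<^sup>2"
    using e by (intro tendstoD) auto
  moreover have "\<forall>\<^sub>F F in finite_subsets_at_top (UNIV :: 'i set). finite F"
    by (rule eventually_finite_subsets_at_top_weakI)
  ultimately show "\<forall>\<^sub>F F in finite_subsets_at_top UNIV.
      dist (\<Sum>i\<in>F. ell2_basis i \<otimes> ell2_apply h i) h < e"
  proof eventually_elim
    case (elim F)
    let ?g = "(\<Sum>i\<in>F. ell2_basis i \<otimes> ell2_apply h i) - h"
    have g: "ell2_apply ?g i = (if i \<in> F then 0 else - ell2_apply h i)" for i
    proof -
      have "ell2_apply ?g i
          = (\<Sum>j\<in>F. (if i = j then 1 else 0) *\<^sub>C ell2_apply h j) - ell2_apply h i"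
        by (simp add: minus_ell2.rep_eq ell2_apply_sum ell2_tensor.rep_eq ell2_basis.rep_eq)
      also have "(\<Sum>j\<in>F. (if i = j then 1 else 0) *\<^sub>C ell2_apply h j)
          = (\<Sum>j\<in>F. if i = j then ell2_apply h j else 0)"
        by (intro sum.cong) (auto simp: scaleC_one)
      finally show ?thesis
        using elim by simp
    qed
    have "norm ?g \<le> e / 2"
    proof (rule ell2_norm_leI)
      fix I :: "'i set" assume I: "finite I"
      have "(\<Sum>i\<in>I. (norm (ell2_apply ?g i))\<^sup>2) = (\<Sum>i\<in>I - F. (norm (ell2_apply h i))\<^sup>2)"
        by (rule sum.mono_neutral_cong_right) (use I in \<open>auto simp: g\<close>)
      moreover have "(\<Sum>i\<in>I - F. (norm (ell2_apply h i))\<^sup>2) + (\<Sum>i\<in>F. (norm (ell2_apply h i))\<^sup>2)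
          = (\<Sum>i\<in>(I - F) \<union> F. (norm (ell2_apply h i))\<^sup>2)"
        by (rule sum.union_disjoint[symmetric]) (use I elim in auto)
      moreover have "\<dots> \<le> ?s"
        by (rule finite_sum_le_infsum[OF ell2_summable]) (use I elim in auto)
      ultimately show "(\<Sum>i\<in>I. (norm (ell2_apply ?g i))\<^sup>2) \<le> (e / 2)\<^sup>2"
        using elim unfolding dist_real_def by linarith
    qed (use e in simp)
    then show ?case
      using e by (simp add: dist_norm)
  qed
qed

lemma bounded_clinear_imp_bounded_linear:
  assumes "bounded_clinear T"
  shows "bounded_linear T"
proof -
  obtain M where "\<forall>x. norm (T x) \<le> M * norm x"
    using assms unfolding bounded_clinear_on_def by blast
  then show ?thesis
    using assms unfolding bounded_clinear_on_def
    by (intro bounded_linear_intro[where K = M]) (auto simp: scaleR_scaleC mult.commute)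
qed

lemma amplify_eqI:
  fixes V :: "('i, 'f::chilbert_space) ell2 \<Rightarrow> ('i, 'f) ell2"
  assumes "bounded_clinear V" "\<And>\<phi> x. V (\<phi> \<otimes> x) = T \<phi> \<otimes> x"
  shows "amplify T = V"
  unfolding amplify_def
proof (rule the_equality)
  fix U :: "('i, 'f) ell2 \<Rightarrow> ('i, 'f) ell2"
  assume U: "bounded_clinear U \<and> (\<forall>\<phi> x. U (\<phi> \<otimes> x) = T \<phi> \<otimes> x)"
  have "U h = V h" for h
  proof -
    have sum: "((\<lambda>i. W (ell2_basis i \<otimes> ell2_apply h i)) has_sum W h) UNIV"
      if "bounded_clinear W" for W :: "('i, 'f) ell2 \<Rightarrow> ('i, 'f) ell2"
      by (rule has_sum_bounded_linear[OF bounded_clinear_imp_bounded_linear[OF that]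
            has_sum_ell2_basis_tensor])
    have eq: "(\<lambda>i. U (ell2_basis i \<otimes> ell2_apply h i)) = (\<lambda>i. V (ell2_basis i \<otimes> ell2_apply h i))"
      using U by (simp add: assms(2))
    show ?thesis
      using sum[of U] U sum[OF assms(1)] unfolding eq by (intro has_sum_unique) auto
  qed
  then show "U = V"
    by (rule ext)
qed (simp add: assms)

lemma creation_basis: "creation i (ell2_basis \<alpha>) = ell2_basis (i # \<alpha>)"
  by (rule ell2_eqI) (auto simp: creation.rep_eq ell2_basis.rep_eq split: list.splits)

lemma diagonal_weight_apply:
  assumes "bdd_above (range (\<lambda>\<alpha>. b \<alpha> / b (i # \<alpha>)))" "\<And>\<alpha>. b \<alpha> > 0"
  shows "ell2_apply (diagonal_weight b i \<phi>) \<alpha>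
    = complex_of_real (sqrt (b \<alpha> / b (i # \<alpha>))) * ell2_apply \<phi> \<alpha>"
proof -
  obtain M where M: "\<And>\<alpha>. b \<alpha> / b (i # \<alpha>) \<le> M"
    using assms(1) by (auto simp: bdd_above_def)
  have "(\<lambda>\<alpha>. (cmod (complex_of_real (sqrt (b \<alpha> / b (i # \<alpha>))) * ell2_apply \<phi> \<alpha>))\<^sup>2) summable_on UNIV"
    by (rule ell2_scale_aux[OF ell2_summable[of \<phi>], where c = "sqrt M"])
      (use M assms(2) in \<open>auto simp: norm_mult less_imp_le intro!: mult_right_mono real_sqrt_le_mono\<close>)
  then show ?thesis
    by (simp add: diagonal_weight_def Abs_ell2_inverse)
qed

lemma universal_model_basis:
  assumes "bdd_above (range (\<lambda>\<alpha>. b \<alpha> / b (i # \<alpha>)))" "\<And>\<alpha>. b \<alpha> > 0"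
  shows "universal_model b i (ell2_basis \<alpha>)
    = complex_of_real (sqrt (b \<alpha> / b (i # \<alpha>))) *\<^sub>C ell2_basis (i # \<alpha>)"
  by (rule ell2_eqI)
    (auto simp: universal_model_def creation.rep_eq diagonal_weight_apply[OF assms]
      ell2_basis.rep_eq scaleC_ell2.rep_eq scaleC_complex_def split: list.splits)

lemma amplify_universal_model:
  fixes h :: "('n, 'f::chilbert_space) fock_tensor"
  assumes "bdd_above (range (\<lambda>\<alpha>. b \<alpha> / b (i # \<alpha>)))" "\<And>\<alpha>. b \<alpha> > 0"
  shows "bounded_clinear
      (amplify (universal_model b i) :: ('n, 'f) fock_tensor \<Rightarrow> ('n, 'f) fock_tensor)"
    and "amplify (universal_model b i) (\<phi> \<otimes> x) = universal_model b i \<phi> \<otimes> (x :: 'f)"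
    and "ell2_apply (amplify (universal_model b i) h) w
      = (case w of [] \<Rightarrow> 0
         | j # \<alpha> \<Rightarrow> if j = i then sqrt (b \<alpha> / b (i # \<alpha>)) *\<^sub>R ell2_apply h \<alpha> else 0)"
proof -
  obtain M where M: "\<And>\<alpha>. b \<alpha> / b (i # \<alpha>) \<le> M"
    using assms(1) by (auto simp: bdd_above_def)
  have M0: "0 \<le> M"
    using M[of "[]"] assms(2) by (meson divide_pos_pos less_imp_le order_trans)
  have le: "norm (sqrt (b \<alpha> / b (i # \<alpha>)) *\<^sub>R x) \<le> sqrt M * norm x" for \<alpha> and x :: 'f
    using M assms(2) by (auto simp: less_imp_le intro!: mult_right_mono real_sqrt_le_mono)
  define v where "v h w = (case w of [] \<Rightarrow> 0
      | j # \<alpha> \<Rightarrow> if j = i then sqrt (b \<alpha> / b (i # \<alpha>)) *\<^sub>R ell2_apply h \<alpha> else 0)"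
    for h :: "('n, 'f) fock_tensor" and w
  define V where "V h = Abs_ell2 (v h)" for h
  have "(\<lambda>w. (norm (v h w))\<^sup>2) summable_on UNIV" for h
    unfolding v_def by (rule summable_on_Cons, rule ell2_scale_aux[OF ell2_summable[of h] le])
  then have V: "ell2_apply (V h) = v h" for h
    by (simp add: V_def Abs_ell2_inverse)
  have "norm (V h) \<le> sqrt M * norm h" for h
  proof (rule ell2_norm_leI)
    fix I :: "'n list set" assume I: "finite I"
    let ?J = "Cons i -` I"
    have J: "finite ?J"
      by (rule finite_vimageI[OF I]) (simp add: inj_on_def)
    have "(\<Sum>w\<in>I. (norm (v h w))\<^sup>2) = (\<Sum>w\<in>Cons i ` ?J. (norm (v h w))\<^sup>2)"
      by (rule sum.mono_neutral_right) (use I in \<open>auto simp: v_def split: list.splits\<close>)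
    also have "\<dots> = (\<Sum>\<alpha>\<in>?J. (norm (sqrt (b \<alpha> / b (i # \<alpha>)) *\<^sub>R ell2_apply h \<alpha>))\<^sup>2)"
      by (subst sum.reindex) (auto simp: inj_on_def v_def)
    also have "\<dots> \<le> (\<Sum>\<alpha>\<in>?J. (sqrt M * norm (ell2_apply h \<alpha>))\<^sup>2)"
      by (intro sum_mono power_mono le) auto
    also have "\<dots> = M * (\<Sum>\<alpha>\<in>?J. (norm (ell2_apply h \<alpha>))\<^sup>2)"
      using M0 by (simp add: power_mult_distrib sum_distrib_left)
    also have "\<dots> \<le> M * (norm h)\<^sup>2"
      by (intro mult_left_mono ell2_sum_le_norm J M0)
    finally show "(\<Sum>w\<in>I. (norm (ell2_apply (V h) w))\<^sup>2) \<le> (sqrt M * norm h)\<^sup>2"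
      using M0 by (simp add: V power_mult_distrib)
  qed (use M0 in simp)
  moreover have "V (h + k) = V h + V k" "V (c *\<^sub>C h) = c *\<^sub>C V h" for h k c
    by (rule ell2_eqI; auto simp: V v_def plus_ell2.rep_eq scaleC_ell2.rep_eq scaleR_add_right
        scaleR_scaleC scaleC_scaleC mult.commute scaleC_add_right split: list.splits)+
  ultimately have bV: "bounded_clinear V"
    by (auto simp: bounded_clinear_on_def)
  have tV: "V (\<phi> \<otimes> x) = universal_model b i \<phi> \<otimes> x" for \<phi> and x :: 'f
    by (rule ell2_eqI; auto simp: V v_def ell2_tensor.rep_eq universal_model_def creation.rep_eq
        diagonal_weight_apply[OF assms] scaleR_scaleC scaleC_scaleC split: list.splits)
  have eq: "amplify (universal_model b i) = V"
    by (rule amplify_eqI[OF bV tV])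
  show "bounded_clinear
      (amplify (universal_model b i) :: ('n, 'f) fock_tensor \<Rightarrow> ('n, 'f) fock_tensor)"
    "amplify (universal_model b i) (\<phi> \<otimes> x) = universal_model b i \<phi> \<otimes> (x :: 'f)"
    "ell2_apply (amplify (universal_model b i) h) w
      = (case w of [] \<Rightarrow> 0
         | j # \<alpha> \<Rightarrow> if j = i then sqrt (b \<alpha> / b (i # \<alpha>)) *\<^sub>R ell2_apply h \<alpha> else 0)"
    unfolding eq using bV tV by (simp_all add: V v_def)
qed


section \<open>Admissible free holomorphic functions and noncommutative domains\<close>

text \<open>For \<open>X = (X\<^sub>i)\<^sub>i\<close> and a word \<open>\<alpha> = [i\<^sub>1, \<dots>, i\<^sub>k]\<close>, the operator \<open>X\<^sub>\<alpha> = X\<^bsub>i\<^sub>1\<^esub> \<cdots> X\<^bsub>i\<^sub>k\<^esub>\<close> is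
  \<^term>\<open>foldr X \<alpha>\<close>.  The following is \<open>\<Sum>\<^bsub>|\<alpha>| = p\<^esub> c\<^sub>\<alpha> X\<^sub>\<alpha> R X\<^sub>\<alpha>\<^sup>*\<close>.\<close>

definition homogeneous_part ::
    "'n ncfps \<Rightarrow> 'h::chilbert_space set \<Rightarrow> ('n \<Rightarrow> 'h \<Rightarrow> 'h) \<Rightarrow> ('h \<Rightarrow> 'h) \<Rightarrow> nat \<Rightarrow> 'h \<Rightarrow> 'h" where
  "homogeneous_part c H X R p x =
     (\<Sum>\<alpha> | length \<alpha> = p. c \<alpha> *\<^sub>R foldr X \<alpha> (R (adj_on H (foldr X \<alpha>) x)))"

definition admissible :: "'n::finite ncfps \<Rightarrow> bool" where
  "admissible g \<longleftrightarrow>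
     (\<forall>\<alpha>. g \<alpha> > 0) \<and> g [] = 1 \<and>
     (\<forall>i. bdd_above (range (\<lambda>\<alpha>. g \<alpha> / g (i # \<alpha>)))) \<and>
     limsup (\<lambda>k. ereal ((\<Sum>\<alpha> | length \<alpha> = k. (g \<alpha>)\<^sup>2) powr (1 / (2 * real k)))) < \<infinity> \<and>
     bdd_above (range (\<lambda>k. onorm (\<lambda>\<phi>.
       \<Sum>p\<le>k. homogeneous_part (ncfps_inverse g) UNIV (universal_model g) id p \<phi>)))"

definition regular_domain :: "'n ncfps \<Rightarrow> bool" where
  "regular_domain g \<longleftrightarrow>
     (\<forall>\<alpha>. \<alpha> \<noteq> [] \<longrightarrow> ncfps_inverse g \<alpha> \<le> 0) \<and> (\<forall>i. ncfps_inverse g [i] < 0)"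

text \<open>The limit \<open>\<Delta>\<close> of the series is unique on \<open>H\<close> only, so it is treated as a relation.\<close>

definition is_defect ::
    "'n ncfps \<Rightarrow> 'h::chilbert_space set \<Rightarrow> ('n \<Rightarrow> 'h \<Rightarrow> 'h) \<Rightarrow> ('h \<Rightarrow> 'h) \<Rightarrow> bool" where
  "is_defect g H X \<Delta> \<longleftrightarrow> wot_sums H (homogeneous_part (ncfps_inverse g) H X id) \<Delta>"

definition nc_domain ::
    "'n ncfps \<Rightarrow> 'h::chilbert_space set \<Rightarrow> ('n \<Rightarrow> 'h \<Rightarrow> 'h) set" where
  "nc_domain g H = {X. (\<forall>i. bounded_clinear_on H H (X i)) \<and>
     (\<exists>\<Delta> S. is_defect g H X \<Delta> \<and> nonneg_on H \<Delta> \<and>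
       wot_sums H (homogeneous_part g H X \<Delta>) S \<and> op_le_on H S id)}"

definition nc_domain_pure ::
    "'n ncfps \<Rightarrow> 'h::chilbert_space set \<Rightarrow> ('n \<Rightarrow> 'h \<Rightarrow> 'h) set" where
  "nc_domain_pure g H = {X \<in> nc_domain g H.
     \<exists>\<Delta>. is_defect g H X \<Delta> \<and> wot_sums H (homogeneous_part g H X \<Delta>) id}"

definition multi_analytic ::
    "'n ncfps \<Rightarrow> 'n ncfps \<Rightarrow>
      (('n, 'f::chilbert_space) fock_tensor \<Rightarrow> ('n, 'k::chilbert_space) fock_tensor) \<Rightarrow> bool" where
  "multi_analytic f g A \<longleftrightarrow> bounded_clinear A \<and>
     (\<forall>i. A \<circ> amplify (universal_model f i) = amplify (universal_model g i) \<circ> A)"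

end

(* With L_a the backward weighted shifts, i.e. the adjoints of the words in a universal model, a
contraction T with T L_i = L_i T (shifts of f2 on the left, of g on the right) is determined by
G x = T x [], since T x b = sqrt (g b) G (L_b x), and such a T exists iff
  sum_b g_b |G (L_b x)|^2 <= |x|^2.
So the factorisation problem for A* = T B* asks to extend G, given on the range M_0 of B*, to the
whole space under this bound.  Let c = - g^{-1} off the empty word; regularity means c >= 0, and
g_w = sum_{w = a b, a <> []} c_a g_b for w <> [].  If G is already known on M and every L_a with
a <> [] maps M' into M, then on M' the terms with b <> [] are defined and bounded:
  sum_{w <> []} g_w |G (L_w x)|^2 = sum_a c_a sum_b g_b |G (L_b L_a x)|^2
    <= sum_a c_a |L_a x|^2 <= |x|^2.
Extending G to M' is then the extension of a contraction on a subspace of a semi-inner product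
space.  Iterate along M_k = M_0 + (vectors of degree < k), whose union is dense.

The last inequality above says that the defect of the model of f2 with respect to g is nonnegative.
In coordinates it is sum_{w = a b, a <> []} c_a f2_b <= f2_w for all w, which is read off from the
inclusion of domains at finite-dimensional truncations of the model. *)

theory Submission
  imports Defs
begin

section \<open>Approximate Riesz representation and adjoints\<close>

text \<open>The bound on \<open>G\<close> involves its values at all shifted points at once. It
  becomes solvable step by step because a nonempty backward shift preserves the range of
  \<open>adj B\<close> and lowers the degree by at least one, hence maps \<open>M (Suc k)\<close>
  into \<open>M k\<close>: the only unknown left is the term of the empty word. The semi-inner
  product of each step is the inner product minus the contribution of the known terms. It may
  degenerate, and its space is not complete, so no orthogonal projection onto the smaller subspace
  is at hand. Minimising sequences replace it: the old \<open>G\<close> sends them to Cauchy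
  sequences in a complete space, and the limit depends only on the point that they approximate. The
  condition AA* \<le> BB* says that \<open>adj A y\<close> is never longer than
  \<open>adj B y\<close>; this makes \<open>G\<close> well defined and bounded on the range of
  \<open>adj B\<close>. The operator sought is C = \<open>adj T\<close>. Truncation makes every
  series finite and every X_a X_a* diagonal. Purity of the truncated model is then the coefficient
  identity f^{-1} f = 1, and positivity of its defect for g is one scalar inequality for each
  word.\<close>

lemma discriminant_bound:
  fixes a e c :: real
  assumes ineq: "\<And>t. 0 \<le> a + 2 * t * e + t\<^sup>2 * c" and c: "0 \<le> c"
  shows "e\<^sup>2 \<le> a * c"
proof (cases "c = 0")
  case True
  have "e = 0"
  proof (rule ccontr)
    assume "e \<noteq> 0"
    \<comment> \<open>The form is only semidefinite, so \<open>c = 0\<close> occurs; for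
      \<open>e \<noteq> 0\<close> this choice of \<open>t\<close> turns the right-hand side into
      -1.\<close>
    then show False
      using ineq[of "- (a + 1) / (2 * e)"] True by (simp add: field_simps)
  qed
  then show ?thesis
    using True by simp
next
  case False
  then have p: "0 < c"
    using c by simp
  have "0 \<le> a - e\<^sup>2 / c"
    using ineq[of "- e / c"] p by (simp add: power2_eq_square field_simps)
  then show ?thesis
    using p by (simp add: field_simps)
qed

text \<open>A minimising sequence of \<open>s m m - 2 \<phi> m\<close>.  No completeness is assumed, so that \<open>\<phi>\<close> is only
  represented in the limit.\<close>

lemma approximate_riesz:
  fixes s :: "'a::real_vector \<Rightarrow> 'a \<Rightarrow> real" and \<phi> :: "'a \<Rightarrow> real"
  assumes M: "subspace M"
    and add: "\<And>x y z. x \<in> M \<Longrightarrow> y \<in> M \<Longrightarrow> z \<in> M \<Longrightarrow> s (x + y) z = s x z + s y z"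
    and scale: "\<And>r x y. x \<in> M \<Longrightarrow> y \<in> M \<Longrightarrow> s (r *\<^sub>R x) y = r * s x y"
    and sym: "\<And>x y. x \<in> M \<Longrightarrow> y \<in> M \<Longrightarrow> s x y = s y x"
    and pos: "\<And>x. x \<in> M \<Longrightarrow> 0 \<le> s x x"
    and \<phi>_add: "\<And>x y. x \<in> M \<Longrightarrow> y \<in> M \<Longrightarrow> \<phi> (x + y) = \<phi> x + \<phi> y"
    and \<phi>_scale: "\<And>r x. x \<in> M \<Longrightarrow> \<phi> (r *\<^sub>R x) = r * \<phi> x"
    and bound: "\<And>x. x \<in> M \<Longrightarrow> (\<phi> x)\<^sup>2 \<le> K * s x x" and K: "0 \<le> K"
  obtains m where "\<And>j::nat. m j \<in> M"
    and "\<And>j k. s (m j - m k) (m j - m k) \<le> 2 * (1 / real (Suc j) + 1 / real (Suc k))"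
    and "\<And>n. n \<in> M \<Longrightarrow> (\<lambda>j. s n (m j)) \<longlonglongrightarrow> \<phi> n"
    and "\<And>j. sqrt (s (m j) (m j)) \<le> sqrt K + sqrt (1 / real (Suc j))"
proof -
  define J where "J x = s x x - 2 * \<phi> x" for x
  have add2: "s z (x + y) = s z x + s z y" if "x \<in> M" "y \<in> M" "z \<in> M" for x y z
    using that add[of x y z] sym[of z "x + y"] sym[of z x] sym[of z y] subspace_add[OF M] by simp
  have scale2: "s y (r *\<^sub>R x) = r * s y x" if "x \<in> M" "y \<in> M" for x y r
    using that scale[of x y r] sym[of y "r *\<^sub>R x"] sym[of y x] subspace_scale[OF M] by simp
  have expand: "J (x + t *\<^sub>R n) = J x + 2 * t * (s n x - \<phi> n) + t\<^sup>2 * s n n"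
    if "x \<in> M" "n \<in> M" for x n t
    using that subspace_add[OF M] subspace_scale[OF M]
    by (simp add: J_def add add2 scale scale2 \<phi>_add \<phi>_scale sym[of x n] power2_eq_square algebra_simps)
  \<comment> \<open>Completing the square: \<open>J x\<close> is at least
    \<open>(sqrt K - sqrt (s x x))\<^sup>2 - K\<close>.\<close>
  have lower: "- K \<le> J x" if x: "x \<in> M" for x
  proof -
    have "\<bar>\<phi> x\<bar> \<le> sqrt K * sqrt (s x x)"
      using bound[OF x] by (metis real_sqrt_abs real_sqrt_le_mono real_sqrt_mult)
    moreover have "0 \<le> (sqrt K - sqrt (s x x))\<^sup>2"
      by simp
    ultimately show ?thesis
      using K pos[OF x] unfolding J_def by (simp add: power2_diff)
  qed
  define I where "I = Inf (J ` M)"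
  have bdd: "bdd_below (J ` M)"
    by (rule bdd_belowI2[where m = "- K"]) (rule lower)
  have I_le: "I \<le> J x" if "x \<in> M" for x
    unfolding I_def using that bdd by (intro cInf_lower) auto
  have "\<exists>x\<in>M. J x < I + 1 / real (Suc j)" for j
  proof -
    have "J ` M \<noteq> {}"
      using subspace_0[OF M] by auto
    then show ?thesis
      using cInf_less_iff[OF _ bdd, of "I + 1 / real (Suc j)"] unfolding I_def by auto
  qed
  then obtain m where mM: "\<And>j. m j \<in> M" and mJ: "\<And>j. J (m j) < I + 1 / real (Suc j)"
    by metis
  \<comment> \<open>Parallelogram law: \<open>expand\<close> at \<open>t = 1/2\<close> and at
    \<open>t = 1\<close> eliminates the linear term. The midpoint lies in \<open>M\<close>, so
    \<open>J\<close> is at least \<open>I\<close> there, and only the excesses of \<open>m j\<close>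
    and \<open>m k\<close> over the infimum remain.\<close>
  have cau: "s (m j - m k) (m j - m k) \<le> 2 * (1 / real (Suc j) + 1 / real (Suc k))" for j k
  proof -
    define d where "d = (- 1) *\<^sub>R m j + m k"
    have d: "d \<in> M"
      unfolding d_def by (intro subspace_add[OF M] subspace_scale[OF M] mM)
    have "m j + (1/2) *\<^sub>R d = (1/2) *\<^sub>R m j + (1/2) *\<^sub>R m k"
      unfolding d_def by (simp add: algebra_simps flip: scaleR_add_left)
    then have "m j + (1/2) *\<^sub>R d \<in> M"
      by (simp add: subspace_add[OF M] subspace_scale[OF M] mM)
    then have "I \<le> J (m j) + (s d (m j) - \<phi> d) + s d d / 4"
      using I_le[of "m j + (1/2) *\<^sub>R d"] expand[OF mM d, of j "1/2"]
      by (simp add: power2_eq_square)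
    moreover have "J (m k) = J (m j) + 2 * (s d (m j) - \<phi> d) + s d d"
      using expand[OF mM d, of j 1] by (simp add: d_def)
    moreover have "m j - m k = (- 1) *\<^sub>R d"
      by (simp add: d_def)
    then have "s (m j - m k) (m j - m k) = s d d"
      using d subspace_scale[OF M d, of "- 1"] by (simp only: scale scale2)
    ultimately show ?thesis
      using mJ[of j] mJ[of k] by argo
  qed
  \<comment> \<open>The Euler equation \<open>s n m = \<phi> n\<close> holds up to the root of the
    excess: near-minimality makes a quadratic polynomial in \<open>t\<close> nonnegative, and its
    discriminant bounds the error.\<close>
  have first_order: "\<bar>s n (m j) - \<phi> n\<bar> \<le> sqrt (1 / real (Suc j)) * sqrt (s n n)" if n: "n \<in> M" for n j
  proof -
    define e where "e = s n (m j) - \<phi> n"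
    have ineq: "0 \<le> 1 / real (Suc j) + 2 * t * e + t\<^sup>2 * s n n" for t
      using I_le[OF subspace_add[OF M mM[of j] subspace_scale[OF M n, of t]]] mJ[of j]
      unfolding expand[OF mM n] e_def by linarith
    have "e\<^sup>2 \<le> 1 / real (Suc j) * s n n"
      by (rule discriminant_bound[OF ineq pos[OF n]])
    then show ?thesis
      unfolding e_def by (metis real_sqrt_abs real_sqrt_le_mono real_sqrt_mult)
  qed
  have lim: "(\<lambda>j. s n (m j)) \<longlonglongrightarrow> \<phi> n" if n: "n \<in> M" for n
  proof -
    have "(\<lambda>j. sqrt (1 / real (Suc j)) * sqrt (s n n)) \<longlonglongrightarrow> sqrt 0 * sqrt (s n n)"
      by (intro tendsto_intros) (rule LIMSEQ_Suc[OF lim_1_over_n])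
    then have "(\<lambda>j. s n (m j) - \<phi> n) \<longlonglongrightarrow> 0"
      using first_order[OF n]
      by (intro Lim_null_comparison[where f = "\<lambda>j. s n (m j) - \<phi> n"
            and g = "\<lambda>j. sqrt (1 / real (Suc j)) * sqrt (s n n)"]) auto
    then show ?thesis
      by (simp add: LIM_zero_iff)
  qed
  \<comment> \<open>The first-order estimate is tested with \<open>n = m j\<close> itself and
    divided by the seminorm of \<open>m j\<close>.\<close>
  have nrm: "sqrt (s (m j) (m j)) \<le> sqrt K + sqrt (1 / real (Suc j))" for j
  proof -
    let ?r = "sqrt (s (m j) (m j))"
    have "\<bar>\<phi> (m j)\<bar> \<le> sqrt K * ?r"
      using bound[OF mM] by (metis real_sqrt_abs real_sqrt_le_mono real_sqrt_mult)
    then have "s (m j) (m j) \<le> (sqrt K + sqrt (1 / real (Suc j))) * ?r"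
      using first_order[OF mM[of j], of j] unfolding distrib_right by linarith
    then have "?r * ?r \<le> (sqrt K + sqrt (1 / real (Suc j))) * ?r"
      using pos[OF mM[of j]] by simp
    then show ?thesis
      using pos[OF mM[of j]] K mult_right_le_imp_le[of ?r ?r] by (cases "?r = 0") auto
  qed
  show thesis
    by (rule that[OF mM cau lim nrm])
qed

text \<open>In a complete space the minimising sequence is Cauchy in norm, and its limit represents
  \<open>\<phi>\<close> exactly.\<close>

lemma riesz_representation:
  fixes \<phi> :: "'a::{real_inner, complete_space} \<Rightarrow> real"
  assumes "bounded_linear \<phi>"
  shows "\<exists>z. \<forall>x. \<phi> x = inner x z"
proof -
  interpret bounded_linear \<phi> by fact
  obtain C where C: "\<And>x. \<bar>\<phi> x\<bar> \<le> norm x * C" "C \<ge> 0"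
    using nonneg_bounded by auto
  have bound: "(\<phi> x)\<^sup>2 \<le> C\<^sup>2 * inner x x" for x
    using power_mono[OF C(1)[of x] abs_ge_zero, of 2]
    by (simp add: power_mult_distrib mult.commute flip: power2_norm_eq_inner)
  obtain m where cau: "\<And>j k. inner (m j - m k) (m j - m k) \<le> 2 * (1 / real (Suc j) + 1 / real (Suc k))"
    and lim: "\<And>n. (\<lambda>j. inner n (m j)) \<longlonglongrightarrow> \<phi> n"
    by (rule approximate_riesz[of UNIV inner \<phi> "C\<^sup>2"])
      (auto simp: inner_add_left bound add scale intro: inner_commute)
  have "Cauchy m"
  proof (rule CauchyI)
    fix e :: real assume e: "0 < e"
    then obtain N where N: "1 / real (Suc N) < e\<^sup>2 / 4"
      using reals_Archimedean[of "e\<^sup>2 / 4"] by (auto simp: inverse_eq_divide)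
    have "norm (m j - m k) < e" if "j \<ge> N" "k \<ge> N" for j k
    proof -
      have "1 / real (Suc j) \<le> 1 / real (Suc N)" "1 / real (Suc k) \<le> 1 / real (Suc N)"
        using that by (auto simp: frac_le)
      then have "2 * (1 / real (Suc j) + 1 / real (Suc k)) < e\<^sup>2"
        using N by argo
      then have "(norm (m j - m k))\<^sup>2 < e\<^sup>2"
        using cau[of j k] unfolding power2_norm_eq_inner by simp
      then show ?thesis
        using e by (simp add: power_less_imp_less_base)
    qed
    then show "\<exists>N. \<forall>j\<ge>N. \<forall>k\<ge>N. norm (m j - m k) < e"
      by blast
  qed
  then obtain z where z: "m \<longlonglongrightarrow> z"
    by (auto simp: Cauchy_convergent_iff convergent_def)
  have "\<phi> x = inner x z" for x
    by (rule LIMSEQ_unique[OF lim]) (intro tendsto_intros z)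
  then show ?thesis
    by blast
qed

section \<open>Complex inner products, bounded operators and adjoints\<close>

lemma cinner_add_right: "cinner x (y + z) = cinner x y + cinner x (z :: 'a::chilbert_space)"
  by (metis cinner_add_left cinner_commute complex_cnj_add)

lemma scaleC_minus_one: "(- 1) *\<^sub>C x = - (x :: 'a::chilbert_space)"
  using scaleR_scaleC[of "- 1" x] by simp

lemma cinner_diff_left: "cinner (x - y) z = cinner x z - cinner y (z :: 'a::chilbert_space)"
  using cinner_add_left[of "x - y" y z] by simp

lemma cinner_diff_right: "cinner x (y - z) = cinner x y - cinner x (z :: 'a::chilbert_space)"
  using cinner_add_right[of x "y - z" z] by simp

lemma cinner_zero_left [simp]: "cinner 0 (x :: 'a::chilbert_space) = 0"
  using cinner_diff_left[of x x x] by simp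

lemma cinner_zero_right [simp]: "cinner (x :: 'a::chilbert_space) 0 = 0"
  using cinner_diff_right[of x x x] by simp

lemma cinner_sum_left: "cinner (sum f S) y = (\<Sum>i\<in>S. cinner (f i) (y :: 'a::chilbert_space))"
  by (induction S rule: infinite_finite_induct) (simp_all add: cinner_add_left)

lemma cinner_sum_right: "cinner y (sum f S) = (\<Sum>i\<in>S. cinner (y :: 'a::chilbert_space) (f i))"
  by (induction S rule: infinite_finite_induct) (simp_all add: cinner_add_right)

lemma cinner_ext_right:
  assumes "\<And>x. cinner x y = cinner x (z :: 'a::chilbert_space)"
  shows "y = z"
  using cinner_self[of "y - z"] by (simp add: cinner_diff_right assms)

lemma cinner_ext_left:
  assumes "\<And>x. cinner y x = cinner (z :: 'a::chilbert_space) x"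
  shows "y = z"
  using cinner_self[of "y - z"] by (simp add: cinner_diff_left assms)

lemma bounded_clinearI:
  assumes "\<And>x y. T (x + y) = T x + T y" "\<And>c x. T (c *\<^sub>C x) = c *\<^sub>C T x"
    "\<And>x. norm (T x) \<le> K * norm x"
  shows "bounded_clinear T"
  using assms unfolding bounded_clinear_on_def by auto

lemma bounded_clinearD:
  assumes "bounded_clinear T"
  shows "T (x + y) = T x + T y" "T (c *\<^sub>C x) = c *\<^sub>C T x" "\<exists>K. \<forall>x. norm (T x) \<le> K * norm x"
  using assms unfolding bounded_clinear_on_def by auto

text \<open>The real Riesz representation only controls the real part of
  \<open>cinner (T x) y\<close>; evaluating at \<open>\<i> *\<^sub>C x\<close> recovers the
  imaginary part.\<close>

lemma adj_exists:
  assumes T: "bounded_clinear (T :: 'h::chilbert_space \<Rightarrow> 'k::chilbert_space)"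
  shows "\<exists>z. \<forall>x. cinner (T x) y = cinner x z"
proof -
  have "bounded_linear (\<lambda>x. inner (T x) y)"
    by (rule bounded_linear_compose[OF bounded_linear_inner_left
          bounded_clinear_imp_bounded_linear[OF T]])
  then obtain z where z: "\<And>x. inner (T x) y = inner x z"
    using riesz_representation by blast
  have "cinner (T x) y = cinner x z" for x
    using z[of x] z[of "\<i> *\<^sub>C x"]
    by (intro complex_eqI) (simp_all add: inner_Re_cinner bounded_clinearD[OF T] cinner_scaleC_left)
  then show ?thesis
    by blast
qed

lemma adj_eqI:
  assumes "\<And>x. cinner (T x) y = cinner x z"
  shows "adj T y = z"
  unfolding adj_on_def using assms by (intro the_equality) (auto intro: cinner_ext_right)

lemma cinner_adj:
  assumes "bounded_clinear T"
  shows "cinner (T x) y = cinner x (adj T y)"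
proof -
  obtain z where z: "\<And>x. cinner (T x) y = cinner x z"
    using adj_exists[OF assms] by blast
  show ?thesis
    using z adj_eqI[of T y z] by simp
qed

lemma cinner_adj_left:
  assumes "bounded_clinear T"
  shows "cinner (adj T y) x = cinner y (T x)"
  using cinner_adj[OF assms, of x y] by (metis cinner_commute)

lemma adj_add: "bounded_clinear T \<Longrightarrow> adj T (x + y) = adj T x + adj T y"
  by (rule adj_eqI) (simp add: cinner_add_right cinner_adj)

lemma adj_scaleC: "bounded_clinear T \<Longrightarrow> adj T (c *\<^sub>C x) = c *\<^sub>C adj T x"
  by (rule adj_eqI) (simp add: cinner_scaleC_right cinner_adj)

lemma norm_adj_le:
  assumes T: "bounded_clinear T" and K: "\<And>x. norm (T x) \<le> K * norm x" and K0: "0 \<le> K"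
  shows "norm (adj T y) \<le> K * norm y"
proof -
  have "(norm (adj T y))\<^sup>2 = cmod (cinner (T (adj T y)) y)"
    by (simp add: cinner_adj[OF T] cinner_self norm_power)
  also have "\<dots> \<le> norm (T (adj T y)) * norm y"
    by (rule cinner_Cauchy_Schwarz)
  also have "\<dots> \<le> K * norm (adj T y) * norm y"
    by (intro mult_right_mono K) simp
  finally have "norm (adj T y) * norm (adj T y) \<le> (K * norm y) * norm (adj T y)"
    by (simp add: power2_eq_square mult_ac)
  then show ?thesis
    using K0 by (cases "adj T y = 0") (auto simp: mult_le_cancel_right)
qed

section \<open>Extension of contractive columns\<close>

text \<open>In contrast to \<open>closed_csubspace\<close>, closedness is not demanded: the range of
  an adjoint, where the extension starts, need not be closed.\<close>

definition csubspace :: "'h::chilbert_space set \<Rightarrow> bool" where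
  "csubspace M \<longleftrightarrow> 0 \<in> M \<and> (\<forall>x\<in>M. \<forall>y\<in>M. x + y \<in> M) \<and> (\<forall>c. \<forall>x\<in>M. c *\<^sub>C x \<in> M)"

definition clinear_on :: "'h::chilbert_space set \<Rightarrow> ('h \<Rightarrow> 'k::chilbert_space) \<Rightarrow> bool" where
  "clinear_on M T \<longleftrightarrow> (\<forall>x\<in>M. \<forall>y\<in>M. T (x + y) = T x + T y) \<and> (\<forall>c. \<forall>x\<in>M. T (c *\<^sub>C x) = c *\<^sub>C T x)"

lemma csubspaceD:
  assumes "csubspace M"
  shows "0 \<in> M" "x \<in> M \<Longrightarrow> y \<in> M \<Longrightarrow> x + y \<in> M" "x \<in> M \<Longrightarrow> c *\<^sub>C x \<in> M"
    "x \<in> M \<Longrightarrow> r *\<^sub>R x \<in> M" "x \<in> M \<Longrightarrow> - x \<in> M" "x \<in> M \<Longrightarrow> y \<in> M \<Longrightarrow> x - y \<in> M"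
    "subspace M"
proof -
  show 0: "0 \<in> M" "x \<in> M \<Longrightarrow> y \<in> M \<Longrightarrow> x + y \<in> M" "x \<in> M \<Longrightarrow> c *\<^sub>C x \<in> M" for x y c
    using assms by (auto simp: csubspace_def)
  show r: "x \<in> M \<Longrightarrow> r *\<^sub>R x \<in> M" for r x
    using 0 by (simp add: scaleR_scaleC)
  show m: "x \<in> M \<Longrightarrow> - x \<in> M" for x
    using r[of x "- 1"] by simp
  show "x \<in> M \<Longrightarrow> y \<in> M \<Longrightarrow> x - y \<in> M"
    using 0(2)[OF _ m, of x y] by simp
  show "subspace M"
    by (rule subspaceI) (use 0 r in auto)
qed

lemma clinear_onD:
  assumes "clinear_on M T"
  shows "x \<in> M \<Longrightarrow> y \<in> M \<Longrightarrow> T (x + y) = T x + T y" "x \<in> M \<Longrightarrow> T (c *\<^sub>C x) = c *\<^sub>C T x"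
    "x \<in> M \<Longrightarrow> T (r *\<^sub>R x) = r *\<^sub>R T x" "x \<in> M \<Longrightarrow> T 0 = 0"
    "csubspace M \<Longrightarrow> x \<in> M \<Longrightarrow> y \<in> M \<Longrightarrow> T (x - y) = T x - T y"
proof -
  show 0: "x \<in> M \<Longrightarrow> y \<in> M \<Longrightarrow> T (x + y) = T x + T y" "x \<in> M \<Longrightarrow> T (c *\<^sub>C x) = c *\<^sub>C T x" for x y c
    using assms by (auto simp: clinear_on_def)
  show "x \<in> M \<Longrightarrow> T (r *\<^sub>R x) = r *\<^sub>R T x"
    using 0 by (simp add: scaleR_scaleC)
  show "x \<in> M \<Longrightarrow> T 0 = 0"
    using 0(2)[of x 0] by simp
  show "T (x - y) = T x - T y" if "csubspace M" "x \<in> M" "y \<in> M"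
    using 0(1)[of "x - y" y] csubspaceD(6)[OF that] that by simp
qed

lemma inner_scaleC_right: "inner x (c *\<^sub>C y) = inner (cnj c *\<^sub>C x) (y :: 'a::chilbert_space)"
  by (simp add: inner_Re_cinner cinner_scaleC_left cinner_scaleC_right)

text \<open>If \<open>J\<close> had a defect operator \<open>D\<close>, one would compose \<open>D x \<mapsto> G0 x\<close> with a projection.  The
  approximate representatives of \<open>n \<mapsto> s n x\<close> replace the projection of \<open>x\<close> to \<open>M0\<close> in the
  (incomplete) seminormed space \<open>M1\<close> with the form \<open>s\<close>.\<close>

lemma column_extension:
  fixes J :: "'h::chilbert_space \<Rightarrow> 'k::chilbert_space" and G0 :: "'h \<Rightarrow> 'f::chilbert_space"
  assumes M0: "csubspace M0" and M1: "csubspace M1" and sub: "M0 \<subseteq> M1"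
    and J: "clinear_on M1 J" and Jle: "\<And>x. x \<in> M1 \<Longrightarrow> norm (J x) \<le> norm x"
    and G0: "clinear_on M0 G0"
    and G0le: "\<And>x. x \<in> M0 \<Longrightarrow> (norm (G0 x))\<^sup>2 + (norm (J x))\<^sup>2 \<le> (norm x)\<^sup>2"
  obtains G where "clinear_on M1 G" "\<And>x. x \<in> M0 \<Longrightarrow> G x = G0 x"
    "\<And>x. x \<in> M1 \<Longrightarrow> (norm (G x))\<^sup>2 + (norm (J x))\<^sup>2 \<le> (norm x)\<^sup>2"
proof -
  \<comment> \<open>In terms of \<open>s\<close> the claim reads: a map that is contractive from
    \<open>M0\<close> with the seminorm of \<open>s\<close> extends contractively to
    \<open>M1\<close>. The assumption on \<open>J\<close> says that \<open>s\<close> is semidefinite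
    on \<open>M1\<close>.\<close>
  define s where "s x y = inner x y - inner (J x) (J y)" for x y
  have s_self: "s x x = (norm x)\<^sup>2 - (norm (J x))\<^sup>2" for x
    by (simp add: s_def power2_norm_eq_inner)
  have s_add: "s (x + y) z = s x z + s y z" if "x \<in> M1" "y \<in> M1" for x y z
    using that by (simp add: s_def clinear_onD[OF J] inner_add_left)
  have s_scale: "s (r *\<^sub>R x) z = r * s x z" if "x \<in> M1" for r x z
    using that by (simp add: s_def clinear_onD[OF J] algebra_simps)
  have s_sym: "s x y = s y x" for x y
    by (simp add: s_def inner_commute)
  have s_add2: "s z (x + y) = s z x + s z y" if "x \<in> M1" "y \<in> M1" for x y z
    using s_add[OF that] by (simp add: s_sym[of z])
  have s_diff: "s (x - y) z = s x z - s y z" if "x \<in> M1" "y \<in> M1" for x y z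
    using that by (simp add: s_def clinear_onD(5)[OF J M1] inner_diff_left)
  have q_add: "s (x + y) (x + y) = s x x + 2 * s x y + s y y" if "x \<in> M1" "y \<in> M1" for x y
    using s_sym[of y x] by (simp add: s_add s_add2 that)
  have q_diff: "s (x - y) (x - y) = s x x - 2 * s x y + s y y" if "x \<in> M1" "y \<in> M1" for x y
  proof -
    have "s z (x - y) = s z x - s z y" for z
      using s_diff[OF that, of z] by (simp only: s_sym[of z])
    then show ?thesis
      using s_sym[of y x] by (simp add: s_diff that)
  qed
  have s_scaleC: "s n (c *\<^sub>C x) = s (cnj c *\<^sub>C n) x" if "x \<in> M1" "n \<in> M1" for n c x
    using that by (simp add: s_def clinear_onD[OF J] inner_scaleC_right)
  have s_pos: "0 \<le> s x x" if "x \<in> M1" for x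
    using power_mono[OF Jle[OF that], of 2] by (simp add: s_self)
  have q_scaleC: "s (c *\<^sub>C x) (c *\<^sub>C x) = (cmod c)\<^sup>2 * s x x" if "x \<in> M1" for c x
    using that by (simp add: s_self clinear_onD[OF J] norm_scaleC power_mult_distrib algebra_simps)
  have CS: "(s n x)\<^sup>2 \<le> s x x * s n n" if x: "x \<in> M1" and n: "n \<in> M1" for n x
  proof (rule discriminant_bound[OF _ s_pos[OF n]])
    fix t
    have "0 \<le> s (x + t *\<^sub>R n) (x + t *\<^sub>R n)"
      by (intro s_pos csubspaceD[OF M1] x n)
    also have "\<dots> = s x x + 2 * s x (t *\<^sub>R n) + s (t *\<^sub>R n) (t *\<^sub>R n)"
      by (intro q_add csubspaceD[OF M1] x n)
    also have "\<dots> = s x x + 2 * (t * s n x) + t * (t * s n n)"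
      using s_scale[OF n, of t x] s_scale[OF n, of t n] s_scale[OF n, of t "t *\<^sub>R n"]
        s_sym[of x "t *\<^sub>R n"] s_sym[of n "t *\<^sub>R n"] by simp
    finally show "0 \<le> s x x + 2 * t * s n x + t\<^sup>2 * s n n"
      by (simp add: power2_eq_square algebra_simps)
  qed
  have in1: "x \<in> M1" if "x \<in> M0" for x
    using that sub by auto
  have G0q: "(norm (G0 x))\<^sup>2 \<le> s x x" if "x \<in> M0" for x
    using G0le[OF that] by (simp add: s_self)
  have G0diff: "G0 (x - y) = G0 x - G0 y" if "x \<in> M0" "y \<in> M0" for x y
    by (rule clinear_onD(5)[OF G0 M0 that])

  \<comment> \<open>Such an \<open>m\<close> plays the role of the projection of \<open>x\<close> to
    \<open>M0\<close>: it is Cauchy for \<open>s\<close>, and in the limit it has the same products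
    with \<open>M0\<close> as \<open>x\<close>.\<close>
  define approx where "approx x m \<longleftrightarrow> (\<forall>j. m j \<in> M0)
    \<and> (\<forall>e>0. \<exists>N. \<forall>j\<ge>N. \<forall>k\<ge>N. s (m j - m k) (m j - m k) < e)
    \<and> (\<forall>n\<in>M0. (\<lambda>j. s n (m j)) \<longlonglongrightarrow> s n x)" for x and m :: "nat \<Rightarrow> 'h"
  \<comment> \<open>The approximating sequence is not unique, so the extension is first a relation.
    It is linear, hence it is single-valued as soon as only 0 is related to 0.\<close>
  define rel where "rel x y \<longleftrightarrow> (\<exists>m. approx x m \<and> (\<lambda>j. G0 (m j)) \<longlonglongrightarrow> y)" for x y

  have approx_add: "approx (x + x') (\<lambda>j. m j + m' j)"
    if a: "approx x m" "approx x' m'" and x: "x \<in> M1" "x' \<in> M1" for x x' m m'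
    unfolding approx_def
  proof (intro conjI allI impI ballI)
    have m: "m j \<in> M0" "m' j \<in> M0" for j
      using a by (auto simp: approx_def)
    show "m j + m' j \<in> M0" for j
      by (intro csubspaceD[OF M0] m)
    fix e :: real assume "0 < e"
    then have "0 < e / 4"
      by simp
    then obtain N N' where N: "\<forall>j\<ge>N. \<forall>k\<ge>N. s (m j - m k) (m j - m k) < e / 4"
      and N': "\<forall>j\<ge>N'. \<forall>k\<ge>N'. s (m' j - m' k) (m' j - m' k) < e / 4"
      using a unfolding approx_def by blast
    have "s (m j + m' j - (m k + m' k)) (m j + m' j - (m k + m' k)) < e"
      if "j \<ge> max N N'" "k \<ge> max N N'" for j k
    proof -
      define u v where "u = m j - m k" and "v = m' j - m' k"
      have uv: "u \<in> M1" "v \<in> M1"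
        unfolding u_def v_def by (intro in1 csubspaceD[OF M0] m)+
      have "0 \<le> s (u - v) (u - v)"
        by (intro s_pos csubspaceD[OF M1] uv)
      then have "s (u + v) (u + v) \<le> 2 * s u u + 2 * s v v"
        by (simp add: q_add[OF uv] q_diff[OF uv])
      also have "\<dots> < e"
      proof -
        have "s u u < e / 4" "s v v < e / 4"
          using N N' that unfolding u_def v_def by auto
        then show ?thesis
          by linarith
      qed
      finally show ?thesis
        by (simp add: u_def v_def algebra_simps)
    qed
    then show "\<exists>N. \<forall>j\<ge>N. \<forall>k\<ge>N. s (m j + m' j - (m k + m' k)) (m j + m' j - (m k + m' k)) < e"
      by blast
  next
    fix n assume n: "n \<in> M0"
    have m: "m j \<in> M1" "m' j \<in> M1" for j
      using a in1 by (auto simp: approx_def)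
    show "(\<lambda>j. s n (m j + m' j)) \<longlonglongrightarrow> s n (x + x')"
      unfolding s_add2[OF m] s_add2[OF x]
      using a n by (intro tendsto_intros) (auto simp: approx_def)
  qed
  have approx_scale: "approx (c *\<^sub>C x) (\<lambda>j. c *\<^sub>C m j)"
    if a: "approx x m" and x: "x \<in> M1" for c x m
    unfolding approx_def
  proof (intro conjI allI impI ballI)
    have m: "m j \<in> M0" for j
      using a by (auto simp: approx_def)
    show "c *\<^sub>C m j \<in> M0" for j
      by (intro csubspaceD[OF M0] m)
    have diff: "c *\<^sub>C m j - c *\<^sub>C m k = c *\<^sub>C (m j - m k)" for j k
      using scaleC_add_right[of c "m j - m k" "m k"] by simp
    have mm: "m j - m k \<in> M1" for j k
      by (intro in1 csubspaceD[OF M0] m)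
    fix e :: real assume e: "0 < e"
    \<comment> \<open>The summand 1 keeps the denominator positive when
      \<open>c = 0\<close>.\<close>
    define d where "d = e / ((cmod c)\<^sup>2 + 1)"
    have d: "0 < d"
      unfolding d_def using e by (intro divide_pos_pos) (auto intro: add_nonneg_pos)
    then obtain N where N: "\<forall>j\<ge>N. \<forall>k\<ge>N. s (m j - m k) (m j - m k) < d"
      using a unfolding approx_def by blast
    have "s (c *\<^sub>C m j - c *\<^sub>C m k) (c *\<^sub>C m j - c *\<^sub>C m k) < e" if "j \<ge> N" "k \<ge> N" for j k
    proof -
      have "(cmod c)\<^sup>2 * s (m j - m k) (m j - m k) \<le> (cmod c)\<^sup>2 * d"
        using N that by (intro mult_left_mono) (auto intro: less_imp_le)
      also have "\<dots> < ((cmod c)\<^sup>2 + 1) * d"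
        using d by (simp add: distrib_right)
      also have "\<dots> = e"
        unfolding d_def by (simp add: add_nonneg_eq_0_iff)
      finally show ?thesis
        by (simp add: diff q_scaleC[OF mm])
    qed
    then show "\<exists>N. \<forall>j\<ge>N. \<forall>k\<ge>N. s (c *\<^sub>C m j - c *\<^sub>C m k) (c *\<^sub>C m j - c *\<^sub>C m k) < e"
      by blast
  next
    fix n assume n: "n \<in> M0"
    have m: "m j \<in> M1" for j
      using a in1 by (auto simp: approx_def)
    show "(\<lambda>j. s n (c *\<^sub>C m j)) \<longlonglongrightarrow> s n (c *\<^sub>C x)"
      unfolding s_scaleC[OF m in1[OF n]] s_scaleC[OF x in1[OF n]]
      using a csubspaceD(3)[OF M0 n] by (auto simp: approx_def)
  qed
  \<comment> \<open>A Cauchy sequence that tends weakly to 0 tends to 0 in seminorm: compare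
    \<open>m j\<close> with a fixed late term \<open>m N\<close> and expand the square of the
    difference.\<close>
  have approx_zero: "(\<lambda>j. s (m j) (m j)) \<longlonglongrightarrow> 0" if a: "approx 0 m" for m
  proof (rule LIMSEQ_I)
    have m: "m j \<in> M0" for j
      using a by (auto simp: approx_def)
    fix e :: real assume e: "0 < e"
    then have "0 < e / 4" by simp
    then obtain N where N: "\<And>j. j \<ge> N \<Longrightarrow> s (m j - m N) (m j - m N) < e / 4"
      using a unfolding approx_def by blast
    have "(\<lambda>j. s (m N) (m j)) \<longlonglongrightarrow> s (m N) 0"
      using a m by (auto simp: approx_def)
    then obtain N' where N': "\<And>j. j \<ge> N' \<Longrightarrow> \<bar>s (m N) (m j)\<bar> < e / 4"
      using LIMSEQ_D[of _ _ "e / 4"] e clinear_onD(4)[OF J csubspaceD(1)[OF M1]]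
      by (fastforce simp: s_def)
    have "norm (s (m j) (m j) - 0) < e" if j: "j \<ge> max N N'" for j
    proof -
      have "s (m j - m N) (m j - m N) = s (m j) (m j) - 2 * s (m N) (m j) + s (m N) (m N)"
        using q_diff[OF in1[OF m] in1[OF m]] s_sym by simp
      then show ?thesis
        using N[of j] N'[of j] s_pos[OF in1[OF m[of N]]] s_pos[OF in1[OF m[of j]]] j e by auto
    qed
    then show "\<exists>N. \<forall>j\<ge>N. norm (s (m j) (m j) - 0) < e"
      by blast
  qed
  have rel_zero: "y = 0" if "rel 0 y" for y
  proof -
    obtain m where a: "approx 0 m" and lim: "(\<lambda>j. G0 (m j)) \<longlonglongrightarrow> y"
      using \<open>rel 0 y\<close> unfolding rel_def by blast
    have "(\<lambda>j. (norm (G0 (m j)))\<^sup>2) \<longlonglongrightarrow> 0"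
      using a G0q
      by (intro Lim_null_comparison[OF _ approx_zero[OF a]]) (auto simp: approx_def)
    moreover have "(\<lambda>j. (norm (G0 (m j)))\<^sup>2) \<longlonglongrightarrow> (norm y)\<^sup>2"
      by (intro tendsto_intros lim)
    ultimately show ?thesis
      using LIMSEQ_unique by fastforce
  qed
  have rel_add: "rel (x + x') (y + y')" if "rel x y" "rel x' y'" "x \<in> M1" "x' \<in> M1" for x x' y y'
  proof -
    obtain m m' where a: "approx x m" "approx x' m'"
      and lim: "(\<lambda>j. G0 (m j)) \<longlonglongrightarrow> y" "(\<lambda>j. G0 (m' j)) \<longlonglongrightarrow> y'"
      using \<open>rel x y\<close> \<open>rel x' y'\<close> unfolding rel_def by blast
    have "G0 (m j + m' j) = G0 (m j) + G0 (m' j)" for j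
      using a by (intro clinear_onD[OF G0]) (auto simp: approx_def)
    then have "(\<lambda>j. G0 (m j + m' j)) \<longlonglongrightarrow> y + y'"
      using tendsto_add[OF lim] by simp
    then show ?thesis
      unfolding rel_def using approx_add[OF a \<open>x \<in> M1\<close> \<open>x' \<in> M1\<close>] by blast
  qed
  have rel_scale: "rel (c *\<^sub>C x) (c *\<^sub>C y)" if "rel x y" "x \<in> M1" for c x y
  proof -
    obtain m where a: "approx x m" and lim: "(\<lambda>j. G0 (m j)) \<longlonglongrightarrow> y"
      using \<open>rel x y\<close> unfolding rel_def by blast
    have "G0 (c *\<^sub>C m j) = c *\<^sub>C G0 (m j)" for j
      using a by (intro clinear_onD[OF G0]) (auto simp: approx_def)
    moreover have "bounded_linear (\<lambda>y :: 'f. c *\<^sub>C y)"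
      by (intro bounded_clinear_imp_bounded_linear bounded_clinearI[where K = "cmod c"])
        (auto simp: scaleC_add_right scaleC_scaleC mult.commute norm_scaleC)
    ultimately have "(\<lambda>j. G0 (c *\<^sub>C m j)) \<longlonglongrightarrow> c *\<^sub>C y"
      using bounded_linear.tendsto[OF _ lim] by auto
    then show ?thesis
      unfolding rel_def using approx_scale[OF a \<open>x \<in> M1\<close>] by blast
  qed
  have rel_unique: "y = y'" if "rel x y" "rel x y'" "x \<in> M1" for x y y'
    using rel_zero[of "y - y'"] rel_add[OF that(1) rel_scale[OF that(2), of "- 1"]] that(3)
      csubspaceD[OF M1] by (simp add: scaleC_minus_one)
  have rel_ext: "rel x (G0 x)" if x: "x \<in> M0" for x
  proof -
    have "approx x (\<lambda>_. x)"
      using x clinear_onD(4)[OF J csubspaceD(1)[OF M1]] by (simp add: approx_def s_def)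
    then show ?thesis
      unfolding rel_def by (intro exI[of _ "\<lambda>_. x"]) simp
  qed
  \<comment> \<open>Cauchy-Schwarz bounds the functional \<open>n \<mapsto> s n x\<close> with the
    constant \<open>s x x\<close>. The norm estimate for the minimising sequence then passes to the
    limit and becomes the contractivity of the extension.\<close>
  have rel_ex: "\<exists>y. rel x y \<and> (norm y)\<^sup>2 \<le> s x x" if x: "x \<in> M1" for x
  proof -
    obtain m where m: "\<And>j::nat. m j \<in> M0"
      and cau: "\<And>j k. s (m j - m k) (m j - m k) \<le> 2 * (1 / real (Suc j) + 1 / real (Suc k))"
      and lim: "\<And>n. n \<in> M0 \<Longrightarrow> (\<lambda>j. s n (m j)) \<longlonglongrightarrow> s n x"
      and nrm: "\<And>j. sqrt (s (m j) (m j)) \<le> sqrt (s x x) + sqrt (1 / real (Suc j))"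
      by (rule approximate_riesz[of M0 s "\<lambda>n. s n x" "s x x"])
        (use csubspaceD(7)[OF M0] in \<open>auto intro: s_add s_scale s_sym s_pos CS x in1\<close>)
    have cau': "\<exists>N. \<forall>j\<ge>N. \<forall>k\<ge>N. s (m j - m k) (m j - m k) < e" if e: "0 < e" for e
    proof -
      obtain N where N: "1 / real (Suc N) < e / 4"
        using reals_Archimedean[of "e / 4"] e by (auto simp: inverse_eq_divide)
      have "s (m j - m k) (m j - m k) < e" if "j \<ge> N" "k \<ge> N" for j k
      proof -
        have "1 / real (Suc j) \<le> 1 / real (Suc N)" "1 / real (Suc k) \<le> 1 / real (Suc N)"
          using that by (auto simp: frac_le)
        then have "2 * (1 / real (Suc j) + 1 / real (Suc k)) < e"
          using N by argo
        then show ?thesis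
          using cau[of j k] by simp
      qed
      then show ?thesis
        by blast
    qed
    have a: "approx x m"
      unfolding approx_def using m cau' lim by blast
    have "Cauchy (\<lambda>j. G0 (m j))"
    proof (rule CauchyI)
      fix e :: real assume e: "0 < e"
      then obtain N where N: "\<forall>j\<ge>N. \<forall>k\<ge>N. s (m j - m k) (m j - m k) < e\<^sup>2"
        using cau'[of "e\<^sup>2"] by auto
      have "norm (G0 (m j) - G0 (m k)) < e" if "j \<ge> N" "k \<ge> N" for j k
      proof -
        have "(norm (G0 (m j) - G0 (m k)))\<^sup>2 < e\<^sup>2"
          using G0q[OF csubspaceD(6)[OF M0 m m], of j k] N that
          unfolding G0diff[OF m m] by force
        then show ?thesis
          using e by (simp add: power_less_imp_less_base)
      qed
      then show "\<exists>N. \<forall>j\<ge>N. \<forall>k\<ge>N. norm (G0 (m j) - G0 (m k)) < e"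
        by blast
    qed
    then obtain y where y: "(\<lambda>j. G0 (m j)) \<longlonglongrightarrow> y"
      by (auto simp: Cauchy_convergent_iff convergent_def)
    have "norm y \<le> sqrt (s x x) + sqrt 0"
    proof (rule LIMSEQ_le)
      show "(\<lambda>j. norm (G0 (m j))) \<longlonglongrightarrow> norm y"
        by (intro tendsto_intros y)
      show "(\<lambda>j. sqrt (s x x) + sqrt (1 / real (Suc j))) \<longlonglongrightarrow> sqrt (s x x) + sqrt 0"
        by (intro tendsto_intros) (rule LIMSEQ_Suc[OF lim_1_over_n])
      have "norm (G0 (m j)) \<le> sqrt (s x x) + sqrt (1 / real (Suc j))" for j
        using real_le_rsqrt[OF G0q[OF m[of j]]] nrm[of j] by linarith
      then show "\<exists>N. \<forall>j\<ge>N. norm (G0 (m j)) \<le> sqrt (s x x) + sqrt (1 / real (Suc j))"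
        by blast
    qed
    then have "(norm y)\<^sup>2 \<le> s x x"
      using power_mono[of "norm y" "sqrt (s x x)" 2] s_pos[OF x] by simp
    then show ?thesis
      using a y unfolding rel_def by blast
  qed
  define G where "G x = (SOME y. rel x y)" for x
  have G: "rel x (G x)" if "x \<in> M1" for x
    unfolding G_def using rel_ex[OF that] by (meson someI)
  have GI: "G x = y" if "rel x y" "x \<in> M1" for x y
    using rel_unique[OF G that(1)] that(2) by blast
  show thesis
  proof (rule that)
    show "clinear_on M1 G"
      unfolding clinear_on_def
      by (auto intro!: GI rel_add rel_scale G csubspaceD[OF M1])
    show "G x = G0 x" if "x \<in> M0" for x
      using GI[OF rel_ext in1] that by blast
    show "(norm (G x))\<^sup>2 + (norm (J x))\<^sup>2 \<le> (norm x)\<^sup>2" if "x \<in> M1" for x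
      using rel_ex[OF that] GI[OF _ that] by (auto simp: s_self)
  qed
qed

section \<open>Inversion of formal power series\<close>

text \<open>A factorisation of a word is determined by its cut position, so that sums over pairs of
  words become sums over an interval of numbers.\<close>

lemma ncfps_mult_take_drop:
  "ncfps_mult f g \<gamma> = (\<Sum>p\<le>length \<gamma>. f (take p \<gamma>) * g (drop p \<gamma>))"
  unfolding ncfps_mult_def
  by (rule sum.reindex_bij_witness[where j = "\<lambda>(\<alpha>, \<beta>). length \<alpha>"
        and i = "\<lambda>p. (take p \<gamma>, drop p \<gamma>)"]) auto

lemma ncfps_mult_assoc: "ncfps_mult (ncfps_mult f g) h = ncfps_mult f (ncfps_mult g h)"
proof
  fix \<gamma> :: "'a list"
  let ?t = "\<lambda>p q. f (take q \<gamma>) * g (drop q (take p \<gamma>)) * h (drop p \<gamma>)"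
  have "ncfps_mult (ncfps_mult f g) h \<gamma> = (\<Sum>p\<le>length \<gamma>. \<Sum>q\<le>p. ?t p q)"
    by (auto simp: ncfps_mult_take_drop sum_distrib_right min_def intro!: sum.cong)
  also have "\<dots> = (\<Sum>(p, q)\<in>(SIGMA p:{..length \<gamma>}. {..p}). ?t p q)"
    by (rule sum.Sigma) auto
  also have "\<dots> = (\<Sum>(q, r)\<in>(SIGMA q:{..length \<gamma>}. {..length \<gamma> - q}).
      f (take q \<gamma>) * (g (take r (drop q \<gamma>)) * h (drop r (drop q \<gamma>))))"
    by (rule sum.reindex_bij_witness[where j = "\<lambda>(p, q). (q, p - q)" and i = "\<lambda>(q, r). (r + q, q)"])
      (auto simp: drop_take mult.assoc)
  also have "\<dots> = (\<Sum>q\<le>length \<gamma>. \<Sum>r\<le>length \<gamma> - q.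
      f (take q \<gamma>) * (g (take r (drop q \<gamma>)) * h (drop r (drop q \<gamma>))))"
    by (rule sum.Sigma[symmetric]) auto
  also have "\<dots> = ncfps_mult f (ncfps_mult g h) \<gamma>"
    by (simp add: ncfps_mult_take_drop sum_distrib_left)
  finally show "ncfps_mult (ncfps_mult f g) h \<gamma> = ncfps_mult f (ncfps_mult g h) \<gamma>" .
qed

lemma ncfps_mult_one_left [simp]: "ncfps_mult ncfps_one f = f"
proof
  fix \<gamma> :: "'a list"
  have "ncfps_mult ncfps_one f \<gamma> = (\<Sum>p\<in>{0}. ncfps_one (take p \<gamma>) * f (drop p \<gamma>))"
    unfolding ncfps_mult_take_drop by (rule sum.mono_neutral_right) (auto simp: ncfps_one_def)
  then show "ncfps_mult ncfps_one f \<gamma> = f \<gamma>"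
    by (simp add: ncfps_one_def)
qed

lemma ncfps_mult_one_right [simp]: "ncfps_mult f ncfps_one = f"
proof
  fix \<gamma> :: "'a list"
  have "ncfps_mult f ncfps_one \<gamma> = (\<Sum>p\<in>{length \<gamma>}. f (take p \<gamma>) * ncfps_one (drop p \<gamma>))"
    unfolding ncfps_mult_take_drop by (rule sum.mono_neutral_right) (auto simp: ncfps_one_def)
  then show "ncfps_mult f ncfps_one \<gamma> = f \<gamma>"
    by (simp add: ncfps_one_def)
qed

text \<open>In the equation \<open>ncfps_mult f r = ncfps_one\<close> only the cut at 0 involves
  \<open>r\<close> at the full word; solving for that term gives a recursion on the length. The left
  inverse below isolates the cut at the end instead.\<close>

function ncfps_right_inverse :: "'n ncfps \<Rightarrow> 'n ncfps" where
  "ncfps_right_inverse f \<gamma> = (ncfps_one \<gamma>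
     - (\<Sum>p\<in>{1..length \<gamma>}. f (take p \<gamma>) * ncfps_right_inverse f (drop p \<gamma>))) / f []"
  by auto
termination
  by (relation "Wellfounded.measure (\<lambda>(f, \<gamma>). length \<gamma>)") auto

function ncfps_left_inverse :: "'n ncfps \<Rightarrow> 'n ncfps" where
  "ncfps_left_inverse f \<gamma> = (ncfps_one \<gamma>
     - (\<Sum>p\<in>{..<length \<gamma>}. ncfps_left_inverse f (take p \<gamma>) * f (drop p \<gamma>))) / f []"
  by auto
termination
  by (relation "Wellfounded.measure (\<lambda>(f, \<gamma>). length \<gamma>)") auto

declare ncfps_right_inverse.simps [simp del] ncfps_left_inverse.simps [simp del]

lemma ncfps_mult_right_inverse:
  fixes f :: "'n ncfps"
  assumes "f [] \<noteq> 0"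
  shows "ncfps_mult f (ncfps_right_inverse f) = ncfps_one"
proof
  fix \<gamma> :: "'n list"
  have "{..length \<gamma>} = insert 0 {1..length \<gamma>}"
    by auto
  then have "ncfps_mult f (ncfps_right_inverse f) \<gamma> = f [] * ncfps_right_inverse f \<gamma>
      + (\<Sum>p\<in>{1..length \<gamma>}. f (take p \<gamma>) * ncfps_right_inverse f (drop p \<gamma>))"
    unfolding ncfps_mult_take_drop by simp
  then show "ncfps_mult f (ncfps_right_inverse f) \<gamma> = ncfps_one \<gamma>"
    using assms by (subst (asm) ncfps_right_inverse.simps) simp
qed

lemma ncfps_mult_left_inverse:
  fixes f :: "'n ncfps"
  assumes "f [] \<noteq> 0"
  shows "ncfps_mult (ncfps_left_inverse f) f = ncfps_one"
proof
  fix \<gamma> :: "'n list"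
  have "{..length \<gamma>} = insert (length \<gamma>) {..<length \<gamma>}"
    by auto
  then have "ncfps_mult (ncfps_left_inverse f) f \<gamma> = ncfps_left_inverse f \<gamma> * f []
      + (\<Sum>p\<in>{..<length \<gamma>}. ncfps_left_inverse f (take p \<gamma>) * f (drop p \<gamma>))"
    unfolding ncfps_mult_take_drop by simp
  then show "ncfps_mult (ncfps_left_inverse f) f \<gamma> = ncfps_one \<gamma>"
    using assms by (subst (asm) ncfps_left_inverse.simps) simp
qed

text \<open>The definite description needs existence and uniqueness of a two-sided inverse. Both
  come from associativity, l = l(fr) = (lf)r = r, applied to the two recursive solutions.\<close>

lemma ncfps_inverse_mult:
  assumes "f [] \<noteq> 0"
  shows "ncfps_mult (ncfps_inverse f) f = ncfps_one"
proof -
  let ?l = "ncfps_left_inverse f" and ?r = "ncfps_right_inverse f"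
  have "?l = ncfps_mult ?l (ncfps_mult f ?r)"
    by (simp add: ncfps_mult_right_inverse[of f, OF assms])
  also have "\<dots> = ?r"
    by (simp add: ncfps_mult_left_inverse[of f, OF assms] flip: ncfps_mult_assoc)
  finally have "?l = ?r" .
  then have "ncfps_mult f ?l = ncfps_one \<and> ncfps_mult ?l f = ncfps_one"
    using ncfps_mult_right_inverse[of f, OF assms] ncfps_mult_left_inverse[of f, OF assms] by simp
  moreover have "a = ?l" if "ncfps_mult f a = ncfps_one \<and> ncfps_mult a f = ncfps_one" for a
    using that calculation by (metis ncfps_mult_assoc ncfps_mult_one_left ncfps_mult_one_right)
  ultimately show ?thesis
    unfolding ncfps_inverse_def by (rule the1I2[OF ex1I]) auto
qed

lemma ncfps_inverse_Nil:
  assumes "f [] = 1"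
  shows "ncfps_inverse f [] = 1"
  using fun_cong[OF ncfps_inverse_mult[of f], of "[]"] assms
  by (simp add: ncfps_mult_take_drop ncfps_one_def)

text \<open>This is the coefficient of \<open>\<gamma>\<close> in f^{-1} f = 1, solved for the cut
  at 0. With the inverse on the left it weighs the prefix of each splitting, which is the part that
  backward shifts strip first.\<close>

lemma ncfps_inverse_recursion:
  assumes "f [] = 1" and "\<gamma> \<noteq> []"
  shows "f \<gamma> = (\<Sum>p\<in>{1..length \<gamma>}. - ncfps_inverse f (take p \<gamma>) * f (drop p \<gamma>))"
proof -
  have "{..length \<gamma>} = insert 0 {1..length \<gamma>}"
    by auto
  then have "ncfps_mult (ncfps_inverse f) f \<gamma> = ncfps_inverse f [] * f \<gamma>
      + (\<Sum>p\<in>{1..length \<gamma>}. ncfps_inverse f (take p \<gamma>) * f (drop p \<gamma>))"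
    unfolding ncfps_mult_take_drop by simp
  then show ?thesis
    using assms ncfps_inverse_mult[of f] ncfps_inverse_Nil[of f]
    by (simp add: ncfps_one_def sum_negf)
qed

section \<open>Stepwise extension along a filtration\<close>

text \<open>A word with a cut is recovered from its prefix and suffix, so the left side is a partial
  sum of the nonnegative double sum. Afterwards prefixes and suffixes can be estimated
  independently.\<close>

lemma sum_splittings_le:
  fixes t :: "'n list \<Rightarrow> 'n list \<Rightarrow> real"
  assumes S: "finite S"
    and S1: "\<And>\<gamma> p. \<gamma> \<in> S \<Longrightarrow> 1 \<le> p \<Longrightarrow> p \<le> length \<gamma> \<Longrightarrow> take p \<gamma> \<in> S1" "finite S1"
    and S2: "\<And>\<gamma> p. \<gamma> \<in> S \<Longrightarrow> 1 \<le> p \<Longrightarrow> p \<le> length \<gamma> \<Longrightarrow> drop p \<gamma> \<in> S2" "finite S2"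
    and t: "\<And>\<alpha> \<beta>. 0 \<le> t \<alpha> \<beta>"
  shows "(\<Sum>\<gamma>\<in>S. \<Sum>p\<in>{1..length \<gamma>}. t (take p \<gamma>) (drop p \<gamma>)) \<le> (\<Sum>\<alpha>\<in>S1. \<Sum>\<beta>\<in>S2. t \<alpha> \<beta>)"
proof -
  define P where "P = (SIGMA \<gamma>:S. {1..length \<gamma>})"
  define split where "split = (\<lambda>(\<gamma> :: 'n list, p). (take p \<gamma>, drop p \<gamma>))"
  have inj: "inj_on split P"
  proof (rule inj_onI, clarsimp simp: P_def split_def)
    fix \<gamma> \<gamma>' :: "'n list" and p p' :: nat
    assume eq: "take p \<gamma> = take p' \<gamma>'" "drop p \<gamma> = drop p' \<gamma>'"
      and le: "p \<le> length \<gamma>" "p' \<le> length \<gamma>'"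
    have "\<gamma> = \<gamma>'"
      using eq by (metis append_take_drop_id)
    moreover have "p = p'"
      using arg_cong[OF eq(1), of length] le by simp
    ultimately show "\<gamma> = \<gamma>' \<and> p = p'"
      by simp
  qed
  have "(\<Sum>\<gamma>\<in>S. \<Sum>p\<in>{1..length \<gamma>}. t (take p \<gamma>) (drop p \<gamma>)) = (\<Sum>x\<in>P. case_prod t (split x))"
    unfolding P_def by (subst sum.Sigma) (auto simp: S split_def intro!: sum.cong)
  also have "\<dots> = (\<Sum>x\<in>split ` P. case_prod t x)"
    by (simp add: sum.reindex[OF inj])
  also have "\<dots> \<le> (\<Sum>x\<in>S1 \<times> S2. case_prod t x)"
    by (rule sum_mono2) (auto simp: S1 S2 t P_def split_def)
  also have "\<dots> = (\<Sum>\<alpha>\<in>S1. \<Sum>\<beta>\<in>S2. t \<alpha> \<beta>)"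
    by (simp add: sum.cartesian_product)
  finally show ?thesis .
qed

text \<open>The column \<open>J x\<close> holds the coordinates of all nonempty words. They use only
  values of \<open>G0\<close> on \<open>M0\<close>, so \<open>J\<close> exists on \<open>M1\<close>
  before \<open>G\<close> does. The coordinate of the empty word is \<open>G x\<close> itself, since
  \<open>b [] = 1\<close> and \<open>L []\<close> is the identity; \<open>column_extension\<close>
  supplies it.\<close>

lemma filtration_extension_step:
  fixes L :: "'n list \<Rightarrow> 'h::chilbert_space \<Rightarrow> 'h" and G0 :: "'h \<Rightarrow> 'f::chilbert_space"
  assumes L: "\<And>\<alpha>. bounded_clinear (L \<alpha>)" and L_Nil: "\<And>x. L [] x = x"
    and L_append: "\<And>\<alpha> \<beta> x. L (\<alpha> @ \<beta>) x = L \<beta> (L \<alpha> x)"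
    and b: "\<And>\<alpha>. 0 \<le> b \<alpha>" "b [] = 1" and c: "\<And>\<alpha>. \<alpha> \<noteq> [] \<Longrightarrow> 0 \<le> c \<alpha>"
    and bc: "\<And>\<gamma>. \<gamma> \<noteq> [] \<Longrightarrow> b \<gamma> = (\<Sum>p\<in>{1..length \<gamma>}. c (take p \<gamma>) * b (drop p \<gamma>))"
    and contr: "\<And>S x. finite S \<Longrightarrow> [] \<notin> S \<Longrightarrow> (\<Sum>\<alpha>\<in>S. c \<alpha> * (norm (L \<alpha> x))\<^sup>2) \<le> (norm x)\<^sup>2"
    and M0: "csubspace M0" and M1: "csubspace M1" and sub: "M0 \<subseteq> M1"
    and L_M1: "\<And>\<alpha> x. x \<in> M1 \<Longrightarrow> \<alpha> \<noteq> [] \<Longrightarrow> L \<alpha> x \<in> M0"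
    and G0: "clinear_on M0 G0"
    and G0le: "\<And>x S. x \<in> M0 \<Longrightarrow> finite S \<Longrightarrow> (\<Sum>\<beta>\<in>S. b \<beta> * (norm (G0 (L \<beta> x)))\<^sup>2) \<le> (norm x)\<^sup>2"
  shows "\<exists>G. clinear_on M1 G \<and> (\<forall>x\<in>M0. G x = G0 x)
    \<and> (\<forall>x\<in>M1. \<forall>S. finite S \<longrightarrow> (\<Sum>\<beta>\<in>S. b \<beta> * (norm (G (L \<beta> x)))\<^sup>2) \<le> (norm x)\<^sup>2)"
proof -
  define v where "v x \<gamma> = (if \<gamma> = [] then 0 else sqrt (b \<gamma>) *\<^sub>R G0 (L \<gamma> x))" for x \<gamma>
  define J :: "'h \<Rightarrow> ('n list, 'f) ell2" where "J x = Abs_ell2 (v x)" for x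
  have v_sq: "(norm (v x \<gamma>))\<^sup>2 = (if \<gamma> = [] then 0 else b \<gamma> * (norm (G0 (L \<gamma> x)))\<^sup>2)" for x \<gamma>
    using b by (simp add: v_def power_mult_distrib)
  have v_le: "(\<Sum>\<gamma>\<in>S. (norm (v x \<gamma>))\<^sup>2) \<le> (norm x)\<^sup>2" if x: "x \<in> M1" and S: "finite S" for x S
  proof -
    define S' where "S' = S - {[]}"
    have S': "finite S'" "[] \<notin> S'"
      using S by (auto simp: S'_def)
    define P where "P = (SIGMA \<gamma>:S'. {1..length \<gamma>})"
    define S1 S2 where "S1 = (\<lambda>(\<gamma>, p). take p \<gamma>) ` P" and "S2 = (\<lambda>(\<gamma>, p). drop p \<gamma>) ` P"
    have P: "finite P"
      unfolding P_def using S' by auto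
    have S1: "[] \<notin> S1"
      using S' by (auto simp: S1_def P_def)
    \<comment> \<open>No sign is known for \<open>c []\<close> (it is -1 when \<open>c\<close> is
      the negative of an inverse series), so \<open>t\<close> is set to 0 there in order to be
      nonnegative throughout.\<close>
    define t where "t \<alpha> \<beta> = (if \<alpha> = [] then 0 else c \<alpha> * (b \<beta> * (norm (G0 (L \<beta> (L \<alpha> x))))\<^sup>2))" for \<alpha> \<beta>
    have "(\<Sum>\<gamma>\<in>S. (norm (v x \<gamma>))\<^sup>2) = (\<Sum>\<gamma>\<in>S'. b \<gamma> * (norm (G0 (L \<gamma> x)))\<^sup>2)"
      unfolding S'_def by (rule sum.mono_neutral_cong_right) (auto simp: v_sq S)
    also have "\<dots> = (\<Sum>\<gamma>\<in>S'. \<Sum>p\<in>{1..length \<gamma>}. t (take p \<gamma>) (drop p \<gamma>))"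
    proof (rule sum.cong[OF refl])
      fix \<gamma> assume "\<gamma> \<in> S'"
      then have ne: "\<gamma> \<noteq> []"
        using S' by auto
      have "t (take p \<gamma>) (drop p \<gamma>) = c (take p \<gamma>) * b (drop p \<gamma>) * (norm (G0 (L \<gamma> x)))\<^sup>2"
        if "p \<in> {1..length \<gamma>}" for p
        using that by (auto simp: t_def simp flip: L_append)
      then show "b \<gamma> * (norm (G0 (L \<gamma> x)))\<^sup>2 = (\<Sum>p\<in>{1..length \<gamma>}. t (take p \<gamma>) (drop p \<gamma>))"
        by (subst bc[OF ne]) (simp add: sum_distrib_right)
    qed
    also have "\<dots> \<le> (\<Sum>\<alpha>\<in>S1. \<Sum>\<beta>\<in>S2. t \<alpha> \<beta>)"
    proof (rule sum_splittings_le[where t = t, OF S'(1)])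
      show "0 \<le> t \<alpha> \<beta>" for \<alpha> \<beta>
        using b c by (auto simp: t_def)
      show "take p \<gamma> \<in> S1" "drop p \<gamma> \<in> S2" if "\<gamma> \<in> S'" "1 \<le> p" "p \<le> length \<gamma>" for \<gamma> p
        using that by (force simp: S1_def S2_def P_def)+
    qed (auto simp: S1_def S2_def P)
    also have "\<dots> \<le> (\<Sum>\<alpha>\<in>S1. c \<alpha> * (norm (L \<alpha> x))\<^sup>2)"
    proof (rule sum_mono)
      fix \<alpha> assume "\<alpha> \<in> S1"
      then have ne: "\<alpha> \<noteq> []"
        using S1 by auto
      have "(\<Sum>\<beta>\<in>S2. t \<alpha> \<beta>) = c \<alpha> * (\<Sum>\<beta>\<in>S2. b \<beta> * (norm (G0 (L \<beta> (L \<alpha> x))))\<^sup>2)"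
        using ne by (simp add: t_def sum_distrib_left)
      also have "\<dots> \<le> c \<alpha> * (norm (L \<alpha> x))\<^sup>2"
        by (intro mult_left_mono G0le L_M1 x ne c) (auto simp: S2_def P)
      finally show "(\<Sum>\<beta>\<in>S2. t \<alpha> \<beta>) \<le> c \<alpha> * (norm (L \<alpha> x))\<^sup>2" .
    qed
    also have "\<dots> \<le> (norm x)\<^sup>2"
      by (rule contr) (use S1 P in \<open>auto simp: S1_def\<close>)
    finally show ?thesis .
  qed
  have J: "ell2_apply (J x) = v x" if "x \<in> M1" for x
  proof -
    have "(\<lambda>i. (norm (v x i))\<^sup>2) summable_on UNIV"
      by (rule nonneg_bdd_above_summable_on)
        (auto intro!: bdd_aboveI2[where M = "(norm x)\<^sup>2"] v_le[OF that])
    then show ?thesis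
      by (simp add: J_def Abs_ell2_inverse)
  qed
  have J_lin: "clinear_on M1 J"
  proof -
    have "v (x + y) \<gamma> = v x \<gamma> + v y \<gamma>" "v (a *\<^sub>C x) \<gamma> = a *\<^sub>C v x \<gamma>"
      if "x \<in> M1" "y \<in> M1" for x y a \<gamma>
      using L_M1[OF that(1), of \<gamma>] L_M1[OF that(2), of \<gamma>]
      by (simp_all add: v_def bounded_clinearD[OF L] clinear_onD[OF G0] scaleC_add_right
          scaleR_scaleC scaleC_scaleC mult.commute)
    then show ?thesis
      unfolding clinear_on_def
      by (auto intro!: ell2_eqI simp: J csubspaceD[OF M1] plus_ell2.rep_eq scaleC_ell2.rep_eq)
  qed
  have J_le: "norm (J x) \<le> norm x" if "x \<in> M1" for x
    by (rule ell2_norm_leI) (simp_all add: J v_le that)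
  have G0J: "(norm (G0 x))\<^sup>2 + (norm (J x))\<^sup>2 \<le> (norm x)\<^sup>2" if x: "x \<in> M0" for x
  proof -
    have x1: "x \<in> M1"
      using x sub by auto
    have le: "(norm (G0 x))\<^sup>2 + (\<Sum>\<gamma>\<in>S. (norm (v x \<gamma>))\<^sup>2) \<le> (norm x)\<^sup>2" if S: "finite S" for S
    proof -
      have "(\<Sum>\<gamma>\<in>S. (norm (v x \<gamma>))\<^sup>2) = (\<Sum>\<gamma>\<in>S - {[]}. b \<gamma> * (norm (G0 (L \<gamma> x)))\<^sup>2)"
        by (rule sum.mono_neutral_cong_right) (auto simp: v_sq S)
      then have "(norm (G0 x))\<^sup>2 + (\<Sum>\<gamma>\<in>S. (norm (v x \<gamma>))\<^sup>2)
          = (\<Sum>\<gamma>\<in>insert [] (S - {[]}). b \<gamma> * (norm (G0 (L \<gamma> x)))\<^sup>2)"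
        using S b by (subst sum.insert) (auto simp: L_Nil)
      also have "\<dots> \<le> (norm x)\<^sup>2"
        by (rule G0le[OF x]) (use S in simp)
      finally show ?thesis .
    qed
    then have "0 \<le> (norm x)\<^sup>2 - (norm (G0 x))\<^sup>2"
      using le[of "{}"] by simp
    moreover from this have "norm (J x) \<le> sqrt ((norm x)\<^sup>2 - (norm (G0 x))\<^sup>2)"
      using le by (intro ell2_norm_leI) (simp_all add: J x1 algebra_simps)
    ultimately have "(norm (J x))\<^sup>2 \<le> (norm x)\<^sup>2 - (norm (G0 x))\<^sup>2"
      using power_mono[of "norm (J x)" _ 2] by fastforce
    then show ?thesis
      by simp
  qed
  obtain G where G: "clinear_on M1 G" and ext: "\<And>x. x \<in> M0 \<Longrightarrow> G x = G0 x"
    and GJ: "\<And>x. x \<in> M1 \<Longrightarrow> (norm (G x))\<^sup>2 + (norm (J x))\<^sup>2 \<le> (norm x)\<^sup>2"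
    using column_extension[OF M0 M1 sub J_lin J_le G0 G0J] by blast
  have "(\<Sum>\<beta>\<in>S. b \<beta> * (norm (G (L \<beta> x)))\<^sup>2) \<le> (norm x)\<^sup>2" if x: "x \<in> M1" and S: "finite S" for x S
  proof -
    have "(\<Sum>\<beta>\<in>S. b \<beta> * (norm (G (L \<beta> x)))\<^sup>2) \<le> (\<Sum>\<beta>\<in>insert [] (S - {[]}). b \<beta> * (norm (G (L \<beta> x)))\<^sup>2)"
      by (rule sum_mono2) (use S b in auto)
    also have "\<dots> = (norm (G x))\<^sup>2 + (\<Sum>\<beta>\<in>S - {[]}. b \<beta> * (norm (G (L \<beta> x)))\<^sup>2)"
      using S b by (subst sum.insert) (auto simp: L_Nil)
    \<comment> \<open>At nonempty words the new \<open>G\<close> is evaluated inside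
      \<open>M0\<close>, where it equals \<open>G0\<close>; these terms are therefore coordinates of
      \<open>J x\<close>.\<close>
    also have "(\<Sum>\<beta>\<in>S - {[]}. b \<beta> * (norm (G (L \<beta> x)))\<^sup>2) = (\<Sum>\<beta>\<in>S - {[]}. (norm (ell2_apply (J x) \<beta>))\<^sup>2)"
      by (intro sum.cong) (auto simp: J x v_sq ext L_M1)
    also have "(norm (G x))\<^sup>2 + \<dots> \<le> (norm x)\<^sup>2"
      using ell2_sum_le_norm[of "S - {[]}" "J x"] GJ[OF x] S by auto
    finally show ?thesis .
  qed
  then show ?thesis
    using G ext by blast
qed

lemma filtration_extension:
  fixes L :: "'n list \<Rightarrow> 'h::chilbert_space \<Rightarrow> 'h" and G0 :: "'h \<Rightarrow> 'f::chilbert_space"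
  assumes L: "\<And>\<alpha>. bounded_clinear (L \<alpha>)" and L_Nil: "\<And>x. L [] x = x"
    and L_append: "\<And>\<alpha> \<beta> x. L (\<alpha> @ \<beta>) x = L \<beta> (L \<alpha> x)"
    and b: "\<And>\<alpha>. 0 \<le> b \<alpha>" "b [] = 1" and c: "\<And>\<alpha>. \<alpha> \<noteq> [] \<Longrightarrow> 0 \<le> c \<alpha>"
    and bc: "\<And>\<gamma>. \<gamma> \<noteq> [] \<Longrightarrow> b \<gamma> = (\<Sum>p\<in>{1..length \<gamma>}. c (take p \<gamma>) * b (drop p \<gamma>))"
    and contr: "\<And>S x. finite S \<Longrightarrow> [] \<notin> S \<Longrightarrow> (\<Sum>\<alpha>\<in>S. c \<alpha> * (norm (L \<alpha> x))\<^sup>2) \<le> (norm x)\<^sup>2"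
    and M: "\<And>k. csubspace (M k)" and M_Suc: "\<And>k. M k \<subseteq> M (Suc k)"
    and L_M: "\<And>\<alpha> k x. x \<in> M (Suc k) \<Longrightarrow> \<alpha> \<noteq> [] \<Longrightarrow> L \<alpha> x \<in> M k"
    and dense: "closure (\<Union>k. M k) = UNIV"
    and G0: "clinear_on (M 0) G0"
    and G0le: "\<And>x S. x \<in> M 0 \<Longrightarrow> finite S \<Longrightarrow> (\<Sum>\<beta>\<in>S. b \<beta> * (norm (G0 (L \<beta> x)))\<^sup>2) \<le> (norm x)\<^sup>2"
  obtains G where "bounded_clinear G" "\<And>x. x \<in> M 0 \<Longrightarrow> G x = G0 x"
    "\<And>x S. finite S \<Longrightarrow> (\<Sum>\<beta>\<in>S. b \<beta> * (norm (G (L \<beta> x)))\<^sup>2) \<le> (norm x)\<^sup>2"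
proof -
  have M_mono: "M j \<subseteq> M k" if "j \<le> k" for j k
    using that M_Suc by (rule lift_Suc_mono_le[rotated])
  define P where "P k G \<longleftrightarrow> clinear_on (M k) G \<and> (\<forall>x\<in>M 0. G x = G0 x)
    \<and> (\<forall>x\<in>M k. \<forall>S. finite S \<longrightarrow> (\<Sum>\<beta>\<in>S. b \<beta> * (norm (G (L \<beta> x)))\<^sup>2) \<le> (norm x)\<^sup>2)" for k G
  have "\<exists>G. \<forall>k. P k (G k) \<and> (\<forall>x\<in>M k. G (Suc k) x = G k x)"
  proof (rule dependent_nat_choice)
    show "\<exists>G. P 0 G"
      unfolding P_def using G0 G0le by (intro exI[of _ G0]) auto
    show "\<exists>G'. P (Suc k) G' \<and> (\<forall>x\<in>M k. G' x = G x)" if "P k G" for G k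
    proof -
      have G: "clinear_on (M k) G"
        using that unfolding P_def by blast
      have G_le: "(\<Sum>\<beta>\<in>S. b \<beta> * (norm (G (L \<beta> x)))\<^sup>2) \<le> (norm x)\<^sup>2" if "x \<in> M k" "finite S" for x S
        using \<open>P k G\<close> that unfolding P_def by blast
      have "\<exists>G'. clinear_on (M (Suc k)) G' \<and> (\<forall>x\<in>M k. G' x = G x)
        \<and> (\<forall>x\<in>M (Suc k). \<forall>S. finite S \<longrightarrow> (\<Sum>\<beta>\<in>S. b \<beta> * (norm (G' (L \<beta> x)))\<^sup>2) \<le> (norm x)\<^sup>2)"
        by (rule filtration_extension_step[where L = L and b = b and c = c and ?M0.0 = "M k"
              and ?M1.0 = "M (Suc k)" and ?G0.0 = G])
          (fact L L_Nil L_append b c bc contr M M_Suc L_M G G_le)+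
      then obtain G' where G': "clinear_on (M (Suc k)) G'" "\<And>x. x \<in> M k \<Longrightarrow> G' x = G x"
        "\<And>x S. x \<in> M (Suc k) \<Longrightarrow> finite S \<Longrightarrow> (\<Sum>\<beta>\<in>S. b \<beta> * (norm (G' (L \<beta> x)))\<^sup>2) \<le> (norm x)\<^sup>2"
        by blast
      have "G' x = G0 x" if "x \<in> M 0" for x
        using \<open>P k G\<close> that M_mono[of 0 k] G'(2)[of x] unfolding P_def by auto
      then show ?thesis
        unfolding P_def using G' by (intro exI[of _ G']) auto
    qed
  qed
  then obtain Gs where P: "\<And>k. P k (Gs k)" and Gs_Suc: "\<And>k x. x \<in> M k \<Longrightarrow> Gs (Suc k) x = Gs k x"
    by blast
  have agree: "Gs k x = Gs j x" if "x \<in> M j" "j \<le> k" for j k x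
    using that(2)
  proof (induction k rule: dec_induct)
    case (step n)
    have "x \<in> M n"
      using \<open>x \<in> M j\<close> M_mono[OF \<open>j \<le> n\<close>] by auto
    then show ?case
      using Gs_Suc step by simp
  qed simp
  define U where "U = (\<Union>k. M k)"
  \<comment> \<open>By \<open>agree\<close>, every \<open>k\<close> with \<open>x \<in> M k\<close>
    gives the same value; the least one is just a choice.\<close>
  define Gu where "Gu x = Gs (LEAST k. x \<in> M k) x" for x
  have Gu: "Gu x = Gs k x" if "x \<in> M k" for x k
    unfolding Gu_def by (rule agree[symmetric]) (auto intro: LeastI Least_le that)
  have U2: "\<exists>k. x \<in> M k \<and> y \<in> M k" if "x \<in> U" "y \<in> U" for x y
  proof -
    obtain i j where "x \<in> M i" "y \<in> M j"
      using \<open>x \<in> U\<close> \<open>y \<in> U\<close> unfolding U_def by blast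
    then show ?thesis
      using M_mono[of i "max i j"] M_mono[of j "max i j"] by (intro exI[of _ "max i j"]) auto
  qed
  have MU: "x \<in> U" if "x \<in> M k" for x k
    using that by (auto simp: U_def)
  have U: "csubspace U"
    unfolding csubspace_def
  proof (intro conjI ballI allI)
    show "0 \<in> U"
      using csubspaceD(1)[OF M] MU by blast
    show "x + y \<in> U" if "x \<in> U" "y \<in> U" for x y
      using U2[OF that] csubspaceD(2)[OF M] MU by blast
    show "a *\<^sub>C x \<in> U" if "x \<in> U" for x a
      using U2[OF that that] csubspaceD(3)[OF M] MU by blast
  qed
  have Gs_lin: "clinear_on (M k) (Gs k)" for k
    using P[of k] unfolding P_def by blast
  have Gu_lin: "clinear_on U Gu"
    unfolding clinear_on_def
  proof (intro conjI ballI allI)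
    fix x y assume "x \<in> U" "y \<in> U"
    then obtain k where k: "x \<in> M k" "y \<in> M k"
      using U2 by blast
    show "Gu (x + y) = Gu x + Gu y"
      using k csubspaceD(2)[OF M k] by (simp add: Gu clinear_onD(1)[OF Gs_lin])
  next
    fix x a assume "x \<in> U"
    then obtain k where k: "x \<in> M k"
      using U2 by blast
    show "Gu (a *\<^sub>C x) = a *\<^sub>C Gu x"
      using Gu[OF csubspaceD(3)[OF M k]] by (simp add: Gu[OF k] clinear_onD(2)[OF Gs_lin k])
  qed
  have L_U: "L \<beta> x \<in> M k" if "x \<in> M k" for \<beta> x k
    using that L_M[of x k \<beta>] M_Suc by (cases "\<beta> = []") (auto simp: L_Nil)
  have Gu_le: "(\<Sum>\<beta>\<in>S. b \<beta> * (norm (Gu (L \<beta> x)))\<^sup>2) \<le> (norm x)\<^sup>2" if "x \<in> U" "finite S" for x S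
  proof -
    obtain k where k: "x \<in> M k"
      using \<open>x \<in> U\<close> U2 by blast
    then have "(\<Sum>\<beta>\<in>S. b \<beta> * (norm (Gu (L \<beta> x)))\<^sup>2) = (\<Sum>\<beta>\<in>S. b \<beta> * (norm (Gs k (L \<beta> x)))\<^sup>2)"
      by (simp add: Gu[OF L_U[OF k]])
    then show ?thesis
      using P[of k] k \<open>finite S\<close> by (simp add: P_def)
  qed
  have UNIV: "csubspace (UNIV :: 'h set)"
    by (simp add: csubspace_def)
  \<comment> \<open>With a zero column, \<open>column_extension\<close> is the plain extension of a
    contraction, applied here to pass from the dense union to the whole space.\<close>
  have zero: "clinear_on UNIV (\<lambda>x :: 'h. 0 :: complex)"
    by (simp add: clinear_on_def)
  obtain G where G: "clinear_on UNIV G" and ext: "\<And>x. x \<in> U \<Longrightarrow> G x = Gu x"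
    and G_le: "\<And>x. (norm (G x))\<^sup>2 + (norm (0 :: complex))\<^sup>2 \<le> (norm x)\<^sup>2"
  proof (rule column_extension[OF U UNIV subset_UNIV zero _ Gu_lin])
    show "norm (0 :: complex) \<le> norm x" for x :: 'h
      by simp
    show "(norm (Gu x))\<^sup>2 + (norm (0 :: complex))\<^sup>2 \<le> (norm x)\<^sup>2" if "x \<in> U" for x
      using Gu_le[OF that, of "{[]}"] by (simp add: L_Nil b(2))
  qed (rule that, assumption, simp_all)
  have bG: "bounded_clinear G"
  proof (rule bounded_clinearI[where K = 1])
    show "norm (G x) \<le> 1 * norm x" for x
      using power2_le_imp_le[OF _ norm_ge_zero, of "norm (G x)" x] G_le[of x] by simp
    show "G (x + y) = G x + G y" for x y
      by (rule clinear_onD(1)[OF G]) simp_all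
    show "G (a *\<^sub>C x) = a *\<^sub>C G x" for a x
      by (rule clinear_onD(2)[OF G]) simp
  qed
  \<comment> \<open>That extension controls only the norm of \<open>G x\<close>. The bound for the
    whole family of shifts defines a closed set, which contains the dense subspace
    \<open>U\<close>.\<close>
  have le: "(\<Sum>\<beta>\<in>S. b \<beta> * (norm (G (L \<beta> x)))\<^sup>2) \<le> (norm x)\<^sup>2" if S: "finite S" for S x
  proof -
    let ?C = "{x. (\<Sum>\<beta>\<in>S. b \<beta> * (norm (G (L \<beta> x)))\<^sup>2) \<le> (norm x)\<^sup>2}"
    have "continuous_on UNIV (\<lambda>x. G (L \<beta> x))" for \<beta>
      using bounded_linear_compose[OF bounded_clinear_imp_bounded_linear[OF bG]
          bounded_clinear_imp_bounded_linear[OF L]]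
      by (rule linear_continuous_on)
    then have "closed ?C"
      by (intro closed_Collect_le continuous_intros)
    moreover have "U \<subseteq> ?C"
    proof
      fix x assume "x \<in> U"
      then obtain k where k: "x \<in> M k"
        using U2 by blast
      have "G (L \<beta> x) = Gu (L \<beta> x)" for \<beta>
        using ext MU L_U[OF k] by blast
      then show "x \<in> ?C"
        using Gu_le[OF \<open>x \<in> U\<close> S] by simp
    qed
    ultimately have "closure U \<subseteq> ?C"
      by (rule closure_minimal[rotated])
    then show ?thesis
      using dense by (auto simp: U_def)
  qed
  show thesis
  proof (rule that[OF bG _ le])
    show "G x = G0 x" if "x \<in> M 0" for x
      using ext[OF MU[OF that]] Gu[OF that] P[of 0] that by (simp add: P_def)
  qed
qed

section \<open>Weighted backward shifts\<close>

locale shift_weight =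
  fixes b :: "'n ncfps"
  assumes pos: "0 < b \<alpha>" and Nil: "b [] = 1"
    and bdd: "bdd_above (range (\<lambda>\<alpha>. b \<alpha> / b (i # \<alpha>)))"
begin

text \<open>The ratio telescopes along \<open>\<alpha>\<close> into one-letter ratios, each bounded
  by \<open>bdd\<close>. The root of the resulting constant bounds the norm of
  \<open>bshift \<alpha>\<close>.\<close>

lemma ratio_bound: "\<exists>K\<ge>0. \<forall>w. b w / b (\<alpha> @ w) \<le> K"
proof (induction \<alpha>)
  case Nil
  have "b w / b ([] @ w) \<le> 1" for w
    using pos[of w] by simp
  then show ?case
    by (meson zero_le_one)
next
  case (Cons i \<alpha>)
  then obtain K where K: "0 \<le> K" "\<And>w. b w / b (\<alpha> @ w) \<le> K"
    by blast
  obtain C where C: "\<And>\<beta>. b \<beta> / b (i # \<beta>) \<le> C"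
    using bdd[of i] by (auto simp: bdd_above_def)
  have C0: "0 \<le> C"
    using C[of "[]"] divide_pos_pos[OF pos[of "[]"] pos[of "[i]"]] by linarith
  have "b w / b ((i # \<alpha>) @ w) \<le> K * C" for w
  proof -
    have "b w / b ((i # \<alpha>) @ w) = (b w / b (\<alpha> @ w)) * (b (\<alpha> @ w) / b (i # \<alpha> @ w))"
      using pos[of "\<alpha> @ w"] by simp
    also have "\<dots> \<le> K * C"
      by (intro mult_mono K C) (auto intro: divide_nonneg_nonneg less_imp_le pos K)
    finally show ?thesis .
  qed
  then show ?case
    using K(1) C0 by (intro exI[of _ "K * C"]) auto
qed

text \<open>The adjoint of the word \<open>\<alpha>\<close> in the amplified universal model.\<close>

definition bshift :: "'n list \<Rightarrow> ('n, 'f::chilbert_space) fock_tensor \<Rightarrow> ('n, 'f) fock_tensor" where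
  "bshift \<alpha> h = Abs_ell2 (\<lambda>w. sqrt (b w / b (\<alpha> @ w)) *\<^sub>R ell2_apply h (\<alpha> @ w))"

lemma bshift_sum_le:
  fixes h :: "('n, 'f::chilbert_space) fock_tensor"
  assumes K: "0 \<le> K" "\<And>w. b w / b (\<alpha> @ w) \<le> K" and I: "finite I"
  shows "(\<Sum>w\<in>I. (norm (sqrt (b w / b (\<alpha> @ w)) *\<^sub>R ell2_apply h (\<alpha> @ w)))\<^sup>2) \<le> K * (norm h)\<^sup>2"
proof -
  have eq: "(norm (sqrt (b w / b (\<alpha> @ w)) *\<^sub>R ell2_apply h (\<alpha> @ w)))\<^sup>2 = b w / b (\<alpha> @ w) * (norm (ell2_apply h (\<alpha> @ w)))\<^sup>2" for w
    using divide_pos_pos[OF pos[of w] pos[of "\<alpha> @ w"]] by (simp add: power_mult_distrib)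
  have "(\<Sum>w\<in>I. (norm (sqrt (b w / b (\<alpha> @ w)) *\<^sub>R ell2_apply h (\<alpha> @ w)))\<^sup>2)
      \<le> (\<Sum>w\<in>I. K * (norm (ell2_apply h (\<alpha> @ w)))\<^sup>2)"
    unfolding eq by (intro sum_mono mult_right_mono K zero_le_power2)
  also have "\<dots> = K * (\<Sum>w\<in>(@) \<alpha> ` I. (norm (ell2_apply h w))\<^sup>2)"
    by (simp add: sum_distrib_left sum.reindex inj_on_def)
  also have "\<dots> \<le> K * (norm h)\<^sup>2"
    by (intro mult_left_mono ell2_sum_le_norm K) (use I in auto)
  finally show ?thesis .
qed

lemma bshift_apply:
  "ell2_apply (bshift \<alpha> h) w = sqrt (b w / b (\<alpha> @ w)) *\<^sub>R ell2_apply h (\<alpha> @ w)"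
proof -
  obtain K where K: "0 \<le> K" "\<And>w. b w / b (\<alpha> @ w) \<le> K"
    using ratio_bound by blast
  have "(\<lambda>w. (norm (sqrt (b w / b (\<alpha> @ w)) *\<^sub>R ell2_apply h (\<alpha> @ w)))\<^sup>2) summable_on UNIV"
  proof (rule nonneg_bdd_above_summable_on)
    show "bdd_above (sum (\<lambda>w. (norm (sqrt (b w / b (\<alpha> @ w)) *\<^sub>R ell2_apply h (\<alpha> @ w)))\<^sup>2)
        ` {F. F \<subseteq> UNIV \<and> finite F})"
      by (rule bdd_aboveI2[where M = "K * (norm h)\<^sup>2"], rule bshift_sum_le[OF K]) blast
  qed (rule zero_le_power2)
  then show ?thesis
    by (simp add: bshift_def Abs_ell2_inverse)
qed

lemma norm_bshift_apply:
  "(norm (ell2_apply (bshift \<alpha> h) w))\<^sup>2 = b w / b (\<alpha> @ w) * (norm (ell2_apply h (\<alpha> @ w)))\<^sup>2"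
  using divide_pos_pos[OF pos[of w] pos[of "\<alpha> @ w"]] by (simp add: bshift_apply power_mult_distrib)

lemma bounded_clinear_bshift:
  "bounded_clinear (bshift \<alpha> :: ('n, 'f::chilbert_space) fock_tensor \<Rightarrow> _)"
proof -
  obtain K where K: "0 \<le> K" "\<And>w. b w / b (\<alpha> @ w) \<le> K"
    using ratio_bound by blast
  show ?thesis
  proof (rule bounded_clinearI)
    show "norm (bshift \<alpha> h) \<le> sqrt K * norm h" for h :: "('n, 'f) fock_tensor"
    proof (rule ell2_norm_leI)
      have "(sqrt K * norm h)\<^sup>2 = K * (norm h)\<^sup>2"
        using K(1) by (simp add: power_mult_distrib)
      then show "(\<Sum>w\<in>I. (norm (ell2_apply (bshift \<alpha> h) w))\<^sup>2) \<le> (sqrt K * norm h)\<^sup>2" if "finite I" for I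
        unfolding bshift_apply using bshift_sum_le[OF K that, of h] by simp
    qed (use K(1) in simp)
    show "bshift \<alpha> (h + k) = bshift \<alpha> h + bshift \<alpha> k" for h k :: "('n, 'f) fock_tensor"
      by (rule ell2_eqI) (simp add: bshift_apply plus_ell2.rep_eq scaleR_add_right)
    show "bshift \<alpha> (c *\<^sub>C h) = c *\<^sub>C bshift \<alpha> h" for c and h :: "('n, 'f) fock_tensor"
      by (rule ell2_eqI)
        (simp add: bshift_apply scaleC_ell2.rep_eq scaleR_scaleC scaleC_scaleC mult.commute)
  qed
qed

lemma bshift_Nil: "bshift [] h = h"
  using pos by (intro ell2_eqI) (simp add: bshift_apply less_imp_neq[symmetric])

text \<open>Adjoints reverse products, so the left factor of the word is stripped first; the weights
  telescope.\<close>

lemma bshift_append: "bshift (\<alpha> @ \<beta>) h = bshift \<beta> (bshift \<alpha> h)"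
proof (rule ell2_eqI)
  fix w
  have "b w / b (\<beta> @ w) * (b (\<beta> @ w) / b (\<alpha> @ \<beta> @ w)) = b w / b (\<alpha> @ \<beta> @ w)"
    using pos[of "\<beta> @ w"] by simp
  then have "sqrt (b w / b (\<beta> @ w)) * sqrt (b (\<beta> @ w) / b (\<alpha> @ \<beta> @ w)) = sqrt (b w / b (\<alpha> @ \<beta> @ w))"
    by (simp only: flip: real_sqrt_mult)
  then show "ell2_apply (bshift (\<alpha> @ \<beta>) h) w = ell2_apply (bshift \<beta> (bshift \<alpha> h)) w"
    by (simp only: bshift_apply scaleR_scaleR append_assoc)
qed

text \<open>Only words that begin with \<open>i\<close> contribute, and dropping this letter
  reindexes the sum. This justifies calling \<open>bshift [i]\<close> the adjoint.\<close>

lemma cinner_amplify_universal_model: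
  fixes h k :: "('n, 'f::chilbert_space) fock_tensor"
  shows "cinner (amplify (universal_model b i) h) k = cinner h (bshift [i] k)"
proof -
  have real: "cinner (r *\<^sub>R x) y = cinner x (r *\<^sub>R y)" for r and x y :: 'f
    by (simp add: scaleR_scaleC cinner_scaleC_left cinner_scaleC_right)
  have "cinner (amplify (universal_model b i) h) k
      = (\<Sum>\<^sub>\<infinity>w\<in>range (Cons i). cinner (ell2_apply (amplify (universal_model b i) h) w) (ell2_apply k w))"
    unfolding cinner_ell2_def
    by (rule infsum_cong_neutral) (auto simp: amplify_universal_model(3)[OF bdd pos] split: list.splits)
  also have "\<dots> = (\<Sum>\<^sub>\<infinity>w. cinner (ell2_apply (amplify (universal_model b i) h) (i # w)) (ell2_apply k (i # w)))"
    by (subst infsum_reindex) (auto simp: inj_on_def o_def)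
  also have "\<dots> = cinner h (bshift [i] k)"
    unfolding cinner_ell2_def
    by (simp add: amplify_universal_model(3)[OF bdd pos] bshift_apply real)
  finally show ?thesis .
qed

text \<open>The sum of the operators c_a W_a W_a* is diagonal in the word basis. Its entry at
  \<open>\<gamma>\<close> collects \<open>c \<alpha> * b w / b \<gamma>\<close> over splittings of
  \<open>\<gamma>\<close> into \<open>\<alpha>\<close> and \<open>w\<close>, which is at most 1 by
  \<open>cb\<close>.\<close>

lemma bshift_contraction:
  fixes x :: "('n, 'f::chilbert_space) fock_tensor"
  assumes c: "\<And>\<alpha>. \<alpha> \<noteq> [] \<Longrightarrow> 0 \<le> c \<alpha>"
    and cb: "\<And>\<gamma>. (\<Sum>p\<in>{1..length \<gamma>}. c (take p \<gamma>) * b (drop p \<gamma>)) \<le> b \<gamma>"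
    and S: "finite S" "[] \<notin> S"
  shows "(\<Sum>\<alpha>\<in>S. c \<alpha> * (norm (bshift \<alpha> x))\<^sup>2) \<le> (norm x)\<^sup>2"
proof -
  \<comment> \<open>Restricting to finitely many coordinates allows regrouping by
    \<open>\<gamma> = \<alpha> @ w\<close> in finite sums; the limit over \<open>T\<close> is taken
    at the end.\<close>
  have fin: "(\<Sum>\<alpha>\<in>S. c \<alpha> * (\<Sum>w\<in>T. (norm (ell2_apply (bshift \<alpha> x) w))\<^sup>2)) \<le> (norm x)\<^sup>2"
    if T: "finite T" for T
  proof -
    define t where "t \<alpha> w = c \<alpha> * b w * ((norm (ell2_apply x (\<alpha> @ w)))\<^sup>2 / b (\<alpha> @ w))" for \<alpha> w
    define I where "I = (\<lambda>(\<alpha>, w). \<alpha> @ w) ` (S \<times> T)"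
    have I: "finite I"
      using S T by (simp add: I_def)
    have "(\<Sum>\<alpha>\<in>S. c \<alpha> * (\<Sum>w\<in>T. (norm (ell2_apply (bshift \<alpha> x) w))\<^sup>2))
        = (\<Sum>\<alpha>\<in>S. \<Sum>w\<in>T. t \<alpha> w)"
      by (simp add: norm_bshift_apply t_def sum_distrib_left mult_ac)
    also have "\<dots> = (\<Sum>(\<alpha>, w)\<in>S \<times> T. t \<alpha> w)"
      by (rule sum.cartesian_product)
    also have "\<dots> = (\<Sum>\<gamma>\<in>I. \<Sum>(\<alpha>, w)\<in>{y \<in> S \<times> T. (\<lambda>(\<alpha>, w). \<alpha> @ w) y = \<gamma>}. t \<alpha> w)"
      unfolding I_def by (rule sum.image_gen) (use S T in simp)
    also have "\<dots> \<le> (\<Sum>\<gamma>\<in>I. (norm (ell2_apply x \<gamma>))\<^sup>2)"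
    proof (rule sum_mono)
      fix \<gamma>
      let ?r = "(norm (ell2_apply x \<gamma>))\<^sup>2 / b \<gamma>"
      let ?split = "\<lambda>p. (take p \<gamma>, drop p \<gamma>)"
      have inj: "inj_on ?split {1..length \<gamma>}"
      proof (rule inj_onI)
        fix p q assume "p \<in> {1..length \<gamma>}" "q \<in> {1..length \<gamma>}" "?split p = ?split q"
        then have "length (take p \<gamma>) = length (take q \<gamma>)" "p \<le> length \<gamma>" "q \<le> length \<gamma>"
          by simp_all
        then show "p = q"
          by simp
      qed
      have "(\<Sum>(\<alpha>, w)\<in>{y \<in> S \<times> T. (\<lambda>(\<alpha>, w). \<alpha> @ w) y = \<gamma>}. t \<alpha> w)
          = (\<Sum>(\<alpha>, w)\<in>{y \<in> S \<times> T. (\<lambda>(\<alpha>, w). \<alpha> @ w) y = \<gamma>}. c \<alpha> * b w * ?r)"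
      proof (rule sum.cong[OF refl])
        fix y assume "y \<in> {y \<in> S \<times> T. (\<lambda>(\<alpha>, w). \<alpha> @ w) y = \<gamma>}"
        then have "fst y @ snd y = \<gamma>"
          by (simp add: case_prod_beta)
        then show "(case y of (\<alpha>, w) \<Rightarrow> t \<alpha> w) = (case y of (\<alpha>, w) \<Rightarrow> c \<alpha> * b w * ?r)"
          by (simp only: t_def case_prod_beta)
      qed
      \<comment> \<open>Completing the splittings found in \<open>S\<close> and \<open>T\<close> to
        all cuts with nonempty prefix adds only nonnegative terms.\<close>
      also have "(\<Sum>(\<alpha>, w)\<in>{y \<in> S \<times> T. (\<lambda>(\<alpha>, w). \<alpha> @ w) y = \<gamma>}. c \<alpha> * b w * ?r)
          \<le> (\<Sum>(\<alpha>, w)\<in>?split ` {1..length \<gamma>}. c \<alpha> * b w * ?r)"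
      proof (rule sum_mono2)
        show "{y \<in> S \<times> T. (\<lambda>(\<alpha>, w). \<alpha> @ w) y = \<gamma>} \<subseteq> ?split ` {1..length \<gamma>}"
        proof
          fix y assume "y \<in> {y \<in> S \<times> T. (\<lambda>(\<alpha>, w). \<alpha> @ w) y = \<gamma>}"
          then obtain \<alpha> w where y: "y = (\<alpha>, w)" "\<alpha> \<in> S" "\<gamma> = \<alpha> @ w"
            by (cases y) auto
          then have "\<alpha> \<noteq> []"
            using S by blast
          then have "length \<alpha> \<in> {1..length \<gamma>}"
            by (simp add: y(3) Suc_le_eq)
          moreover have "y = ?split (length \<alpha>)"
            by (simp add: y)
          ultimately show "y \<in> ?split ` {1..length \<gamma>}"
            by (rule image_eqI[rotated])
        qed
        fix y assume "y \<in> ?split ` {1..length \<gamma>} - {y \<in> S \<times> T. (\<lambda>(\<alpha>, w). \<alpha> @ w) y = \<gamma>}"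
        then have "y \<in> ?split ` {1..length \<gamma>}"
          by simp
        then obtain p where p: "1 \<le> p" "p \<le> length \<gamma>" "y = ?split p"
          unfolding image_iff Bex_def atLeastAtMost_iff by blast
        then have "take p \<gamma> \<noteq> []"
          by auto
        then have "0 \<le> c (take p \<gamma>) * b (drop p \<gamma>) * ?r"
          by (intro mult_nonneg_nonneg divide_nonneg_nonneg c less_imp_le[OF pos] zero_le_power2)
        then show "0 \<le> (case y of (\<alpha>, w) \<Rightarrow> c \<alpha> * b w * ?r)"
          by (simp only: p(3) prod.case)
      qed (rule finite_imageI, rule finite_atLeastAtMost)
      also have "\<dots> = (\<Sum>p\<in>{1..length \<gamma>}. c (take p \<gamma>) * b (drop p \<gamma>) * ?r)"
        unfolding sum.reindex[OF inj] by (rule sum.cong) simp_all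
      also have "\<dots> = (\<Sum>p\<in>{1..length \<gamma>}. c (take p \<gamma>) * b (drop p \<gamma>)) * ?r"
        by (rule sum_distrib_right[symmetric])
      also have "\<dots> \<le> b \<gamma> * ?r"
        by (intro mult_right_mono cb divide_nonneg_nonneg) (auto simp: less_imp_le pos)
      also have "\<dots> = (norm (ell2_apply x \<gamma>))\<^sup>2"
        using pos[of \<gamma>] by simp
      finally show "(\<Sum>(\<alpha>, w)\<in>{y \<in> S \<times> T. (\<lambda>(\<alpha>, w). \<alpha> @ w) y = \<gamma>}. t \<alpha> w) \<le> (norm (ell2_apply x \<gamma>))\<^sup>2" .
    qed
    also have "\<dots> \<le> (norm x)\<^sup>2"
      by (rule ell2_sum_le_norm[OF I])
    finally show ?thesis .
  qed
  have norm_sq: "((\<lambda>T. \<Sum>w\<in>T. (norm (ell2_apply h w))\<^sup>2) \<longlongrightarrow> (norm h)\<^sup>2) (finite_subsets_at_top UNIV)"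
    for h :: "('n, 'f) fock_tensor"
    using has_sum_infsum[OF ell2_summable[of h]] by (simp add: has_sum_def norm_ell2_def infsum_nonneg)
  show ?thesis
  proof (rule tendsto_upperbound)
    show "((\<lambda>T. \<Sum>\<alpha>\<in>S. c \<alpha> * (\<Sum>w\<in>T. (norm (ell2_apply (bshift \<alpha> x) w))\<^sup>2))
        \<longlongrightarrow> (\<Sum>\<alpha>\<in>S. c \<alpha> * (norm (bshift \<alpha> x))\<^sup>2)) (finite_subsets_at_top UNIV)"
      by (intro tendsto_intros norm_sq)
    show "\<forall>\<^sub>F T in finite_subsets_at_top UNIV.
        (\<Sum>\<alpha>\<in>S. c \<alpha> * (\<Sum>w\<in>T. (norm (ell2_apply (bshift \<alpha> x) w))\<^sup>2)) \<le> (norm x)\<^sup>2"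
      by (rule eventually_finite_subsets_at_top_weakI) (rule fin)
  qed simp
qed

end

lemma shift_weight_admissible: "admissible g \<Longrightarrow> shift_weight g"
  unfolding admissible_def shift_weight_def by auto

text \<open>For one letter this is the adjoint of the intertwining relation of \<open>T\<close>;
  longer words follow by stripping letters one at a time.\<close>

lemma bshift_adj_multi_analytic:
  assumes "shift_weight f" and "shift_weight h" and T: "multi_analytic f h T"
  shows "shift_weight.bshift f \<alpha> (adj T y) = adj T (shift_weight.bshift h \<alpha> y)"
proof -
  interpret f: shift_weight f by fact
  interpret h: shift_weight h by fact
  have bT: "bounded_clinear T" and inter: "\<And>i x. T (amplify (universal_model f i) x) = amplify (universal_model h i) (T x)"
    using T unfolding multi_analytic_def fun_eq_iff o_def by blast+
  have single: "f.bshift [i] (adj T y) = adj T (h.bshift [i] y)" for i y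
  proof (rule cinner_ext_right)
    fix x
    have "cinner x (f.bshift [i] (adj T y)) = cinner (amplify (universal_model f i) x) (adj T y)"
      by (simp only: f.cinner_amplify_universal_model)
    also have "\<dots> = cinner (amplify (universal_model h i) (T x)) y"
      by (simp only: inter flip: cinner_adj[OF bT])
    also have "\<dots> = cinner x (adj T (h.bshift [i] y))"
      by (simp only: h.cinner_amplify_universal_model cinner_adj[OF bT])
    finally show "cinner x (f.bshift [i] (adj T y)) = cinner x (adj T (h.bshift [i] y))" .
  qed
  show ?thesis
  proof (induction \<alpha> arbitrary: y)
    case Nil
    then show ?case
      by (simp add: f.bshift_Nil h.bshift_Nil)
  next
    case (Cons i \<alpha>)
    then show ?case
      by (simp add: single f.bshift_append[of "[i]" \<alpha>, simplified] h.bshift_append[of "[i]" \<alpha>, simplified])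
  qed
qed

lemma closure_finite_degree:
  "closure (\<Union>k. {h :: ('n, 'f::chilbert_space) fock_tensor. \<forall>w. k \<le> length w \<longrightarrow> ell2_apply h w = 0}) = UNIV"
  (is "closure (\<Union>k. ?H k) = _")
proof -
  have "h \<in> closure (\<Union>k. ?H k)" for h
  proof (rule Lim_in_closed_set[OF closed_closure])
    show "((\<lambda>F. \<Sum>i\<in>F. ell2_basis i \<otimes> ell2_apply h i) \<longlongrightarrow> h) (finite_subsets_at_top UNIV)"
      using has_sum_ell2_basis_tensor[of h] by (simp add: has_sum_def)
    show "\<forall>\<^sub>F F in finite_subsets_at_top UNIV.
        (\<Sum>i\<in>F. ell2_basis i \<otimes> ell2_apply h i) \<in> closure (\<Union>k. ?H k)"
    proof (rule eventually_finite_subsets_at_top_weakI)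
      fix F :: "'n list set" assume F: "finite F"
      \<comment> \<open>The sum of all lengths is a crude common bound for the degrees in
        \<open>F\<close> that also makes sense when \<open>F\<close> is empty.\<close>
      have "w \<notin> F" if "Suc (\<Sum>i\<in>F. length i) \<le> length w" for w
      proof
        assume "w \<in> F"
        then have "length w \<le> (\<Sum>i\<in>F. length i)"
          by (intro member_le_sum) (use F in auto)
        then show False
          using that by simp
      qed
      then have "(\<Sum>i\<in>F. ell2_basis i \<otimes> ell2_apply h i) \<in> ?H (Suc (\<Sum>i\<in>F. length i))"
        by (auto simp: ell2_apply_sum ell2_tensor.rep_eq ell2_basis.rep_eq intro!: sum.neutral)
      then have "(\<Sum>i\<in>F. ell2_basis i \<otimes> ell2_apply h i) \<in> (\<Union>k. ?H k)"
        by (rule UN_I[OF UNIV_I])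
      then show "(\<Sum>i\<in>F. ell2_basis i \<otimes> ell2_apply h i) \<in> closure (\<Union>k. ?H k)"
        by (rule subsetD[OF closure_subset])
    qed
  qed simp
  then show ?thesis
    by (intro set_eqI iffI UNIV_I)
qed

section \<open>Truncated universal models\<close>

lemma cinner_ell2_basis_left: "cinner (ell2_basis j) k = cnj (ell2_apply k j)"
proof -
  have "cinner (ell2_basis j) k = (\<Sum>\<^sub>\<infinity>i\<in>{j}. cnj (ell2_apply k i))"
    unfolding cinner_ell2_def
    by (rule infsum_cong_neutral) (auto simp: ell2_basis.rep_eq cinner_complex_def)
  then show ?thesis
    by simp
qed

lemma cinner_ell2_basis_right: "cinner h (ell2_basis j) = ell2_apply h j"
  by (metis cinner_commute cinner_ell2_basis_left complex_cnj_cnj)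

lemma cinner_scaleC_basis_left: "cinner (c *\<^sub>C ell2_basis j) k = c * cnj (ell2_apply k j)"
  by (simp add: cinner_scaleC_left cinner_ell2_basis_left)

lemma cinner_scaleC_basis_right: "cinner h (c *\<^sub>C ell2_basis j) = cnj c * ell2_apply h j"
  by (simp add: cinner_scaleC_right cinner_ell2_basis_right)

lemma norm_ell2_basis: "norm (ell2_basis j) = 1"
  using cinner_self[of "ell2_basis j"]
  by (simp add: cinner_ell2_basis complex_eq_iff power2_eq_1_iff)
     (metis norm_ge_zero not_one_le_zero neg_0_le_iff_le)

lemma finite_words: "finite {w :: 'n::finite list. length w \<le> N}"
  using finite_lists_length_le[of "UNIV :: 'n set" N] by simp

text \<open>The compression of the universal model to the span of the \<open>e\<^sub>w\<close> with \<open>|w| \<le> N\<close>, where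
  \<open>e\<^sub>w\<close> is the basis vector with index \<open>\<iota> w\<close>, extended by \<open>0\<close>.  All series are finite sums.\<close>

locale truncated_model = shift_weight b for b :: "'n::finite ncfps" +
  fixes \<iota> :: "'n list \<Rightarrow> 'i" and N :: nat
  assumes inj: "inj \<iota>"
begin

section \<open>Word operators of the truncated model and their adjoints\<close>

definition words_after :: "'n list \<Rightarrow> 'n list set" where
  "words_after \<alpha> = {w. length (\<alpha> @ w) \<le> N}"

lemma finite_words_after [simp]: "finite (words_after \<alpha>)"
  unfolding words_after_def by (rule finite_subset[OF _ finite_words[of N]]) auto

definition weight :: "'n list \<Rightarrow> 'n list \<Rightarrow> complex" where
  "weight \<alpha> w = complex_of_real (sqrt (b w / b (\<alpha> @ w)))"

text \<open>The empty word is separated because its operator is the identity of the whole space; the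
  sum would only give the projection onto the span of the \<open>\<iota> w\<close> with
  \<open>length w \<le> N\<close>.\<close>

definition word_op :: "'n list \<Rightarrow> ('i, complex) ell2 \<Rightarrow> ('i, complex) ell2" where
  "word_op \<alpha> h = (if \<alpha> = [] then h
     else \<Sum>w\<in>words_after \<alpha>. (weight \<alpha> w * ell2_apply h (\<iota> w)) *\<^sub>C ell2_basis (\<iota> (\<alpha> @ w)))"

definition word_adj :: "'n list \<Rightarrow> ('i, complex) ell2 \<Rightarrow> ('i, complex) ell2" where
  "word_adj \<alpha> h = (if \<alpha> = [] then h
     else \<Sum>w\<in>words_after \<alpha>. (weight \<alpha> w * ell2_apply h (\<iota> (\<alpha> @ w))) *\<^sub>C ell2_basis (\<iota> w))"

lemma cnj_weight [simp]: "cnj (weight \<alpha> w) = weight \<alpha> w"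
  by (simp add: weight_def)

lemma weight_mult: "weight [i] (\<alpha> @ w) * weight \<alpha> w = weight (i # \<alpha>) w"
proof -
  have "b (\<alpha> @ w) / b (i # \<alpha> @ w) * (b w / b (\<alpha> @ w)) = b w / b (i # \<alpha> @ w)"
    using pos[of "\<alpha> @ w"] by simp
  then show ?thesis
    unfolding weight_def by (simp only: append_Cons append_Nil flip: of_real_mult real_sqrt_mult)
qed

lemma weight_square:
  "weight \<alpha> w * (weight \<alpha> w * z) = complex_of_real (b w) * z / complex_of_real (b (\<alpha> @ w))"
proof -
  have "0 \<le> b w / b (\<alpha> @ w)"
    by (intro divide_nonneg_nonneg less_imp_le[OF pos])
  then have "weight \<alpha> w * weight \<alpha> w = complex_of_real (b w / b (\<alpha> @ w))"
    unfolding weight_def by (simp only: real_sqrt_mult_self abs_of_nonneg flip: of_real_mult)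
  then show ?thesis
    by (simp flip: mult.assoc)
qed

lemma \<iota>_eq [simp]: "\<iota> v = \<iota> w \<longleftrightarrow> v = w"
  using inj by (auto dest: injD)

lemma cinner_word_op: "cinner (word_op \<alpha> x) y = cinner x (word_adj \<alpha> y)"
  by (simp add: word_op_def word_adj_def cinner_sum_left cinner_sum_right
      cinner_scaleC_basis_left cinner_scaleC_basis_right mult_ac)

lemma adj_word_op: "adj (word_op \<alpha>) y = word_adj \<alpha> y"
  by (rule adj_eqI) (rule cinner_word_op)

lemma word_adj_apply:
  assumes "\<alpha> \<noteq> []"
  shows "ell2_apply (word_adj \<alpha> h) (\<iota> w)
    = (if w \<in> words_after \<alpha> then weight \<alpha> w * ell2_apply h (\<iota> (\<alpha> @ w)) else 0)"
  using assms unfolding word_adj_def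
  by (simp add: ell2_apply_sum scaleC_ell2.rep_eq ell2_basis.rep_eq scaleC_complex_def mult_delta_right)

lemma word_op_apply:
  assumes "\<alpha> \<noteq> []"
  shows "ell2_apply (word_op \<alpha> h) (\<iota> u)
    = (\<Sum>w\<in>words_after \<alpha>. if u = \<alpha> @ w then weight \<alpha> w * ell2_apply h (\<iota> w) else 0)"
  using assms unfolding word_op_def
  by (auto simp: ell2_apply_sum scaleC_ell2.rep_eq ell2_basis.rep_eq scaleC_complex_def intro!: sum.cong)

text \<open>Truncating after each letter is the same as truncating once: a suffix of a word of
  length at most \<open>N\<close> is again that short, so no term is lost on the way.\<close>

lemma word_op_Cons: "word_op (i # \<alpha>) h = word_op [i] (word_op \<alpha> h)"
proof (cases "\<alpha> = []")
  case True
  then show ?thesis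
    by (simp add: word_op_def)
next
  case False
  have "word_op [i] (word_op \<alpha> h)
      = (\<Sum>u\<in>words_after [i]. (weight [i] u * ell2_apply (word_op \<alpha> h) (\<iota> u)) *\<^sub>C ell2_basis (\<iota> (i # u)))"
    unfolding word_op_def[of "[i]"] by simp
  also have "\<dots> = (\<Sum>u\<in>(@) \<alpha> ` words_after (i # \<alpha>).
      (weight [i] u * ell2_apply (word_op \<alpha> h) (\<iota> u)) *\<^sub>C ell2_basis (\<iota> (i # u)))"
  proof (rule sum.mono_neutral_right)
    show "(@) \<alpha> ` words_after (i # \<alpha>) \<subseteq> words_after [i]"
      by (auto simp: words_after_def)
    have "ell2_apply (word_op \<alpha> h) (\<iota> u) = 0"
      if "u \<in> words_after [i] - (@) \<alpha> ` words_after (i # \<alpha>)" for u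
      unfolding word_op_apply[OF False] using that
      by (intro sum.neutral) (auto simp: words_after_def)
    then show "\<forall>u\<in>words_after [i] - (@) \<alpha> ` words_after (i # \<alpha>).
        (weight [i] u * ell2_apply (word_op \<alpha> h) (\<iota> u)) *\<^sub>C ell2_basis (\<iota> (i # u)) = 0"
      by simp
  qed simp
  also have "\<dots> = (\<Sum>w\<in>words_after (i # \<alpha>).
      (weight [i] (\<alpha> @ w) * ell2_apply (word_op \<alpha> h) (\<iota> (\<alpha> @ w))) *\<^sub>C ell2_basis (\<iota> (i # \<alpha> @ w)))"
    by (subst sum.reindex) (auto simp: inj_on_def)
  also have "\<dots> = word_op (i # \<alpha>) h"
  proof -
    have "ell2_apply (word_op \<alpha> h) (\<iota> (\<alpha> @ w)) = weight \<alpha> w * ell2_apply h (\<iota> w)"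
      if "w \<in> words_after (i # \<alpha>)" for w
    proof -
      have "w \<in> words_after \<alpha>"
        using that by (simp add: words_after_def)
      then show ?thesis
        unfolding word_op_apply[OF False] by simp
    qed
    then show ?thesis
      unfolding word_op_def[of "i # \<alpha>"] by (simp add: weight_mult flip: mult.assoc)
  qed
  finally show ?thesis ..
qed

lemma foldr_word_op: "foldr (\<lambda>i. word_op [i]) \<alpha> = word_op \<alpha>"
proof (induction \<alpha>)
  case Nil
  show ?case
    by (rule ext) (simp add: word_op_def)
next
  case (Cons i \<alpha>)
  show ?case
    by (rule ext) (simp add: Cons word_op_Cons[of i \<alpha>])
qed

lemma bounded_clinear_word_op: "bounded_clinear (word_op [i])"
proof (rule bounded_clinearI)
  show "norm (word_op [i] h) \<le> (\<Sum>w\<in>words_after [i]. cmod (weight [i] w)) * norm h" for h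
    unfolding word_op_def sum_distrib_right
    by (auto simp: norm_scaleC norm_ell2_basis norm_mult intro!: sum_norm_le mult_left_mono ell2_norm_apply_le)
  show "word_op [i] (x + y) = word_op [i] x + word_op [i] y" for x y
    by (simp add: word_op_def plus_ell2.rep_eq distrib_left scaleC_add_left sum.distrib)
  have scaleC_sum: "c *\<^sub>C sum f A = (\<Sum>a\<in>A. c *\<^sub>C f a)" for c and f :: "_ \<Rightarrow> ('i, complex) ell2" and A
    by (induction A rule: infinite_finite_induct) (simp_all add: scaleC_add_right)
  show "word_op [i] (c *\<^sub>C x) = c *\<^sub>C word_op [i] x" for c x
    by (simp add: word_op_def scaleC_ell2.rep_eq scaleC_complex_def scaleC_sum scaleC_scaleC mult_ac)
qed

section \<open>Diagonal form of the homogeneous parts, defect and purity\<close>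

lemma cinner_word_op_word_adj:
  assumes "\<alpha> \<noteq> []"
  shows "cinner (word_op \<alpha> (word_adj \<alpha> x)) y
    = (\<Sum>w\<in>words_after \<alpha>. complex_of_real (b w / b (\<alpha> @ w))
        * (ell2_apply x (\<iota> (\<alpha> @ w)) * cnj (ell2_apply y (\<iota> (\<alpha> @ w)))))"
  using assms unfolding word_op_def
  by (simp add: cinner_sum_left cinner_scaleC_basis_left word_adj_apply mult_ac weight_square)

text \<open>These index the basis vectors on which terms of positive degree can act; at the empty
  word, as outside the model, only degree 0 contributes.\<close>

definition levels :: "'n list set" where
  "levels = {v. 1 \<le> length v \<and> length v \<le> N}"

lemma finite_levels [simp]: "finite levels"
  unfolding levels_def by (rule finite_subset[OF _ finite_words[of N]]) auto

abbreviation xy :: "('i, complex) ell2 \<Rightarrow> ('i, complex) ell2 \<Rightarrow> 'n list \<Rightarrow> complex" where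
  "xy x y v \<equiv> ell2_apply x (\<iota> v) * cnj (ell2_apply y (\<iota> v))"

text \<open>A word has exactly one splitting with a prefix of length \<open>p\<close>, provided that
  it is long enough, so each diagonal entry consists of a single term.\<close>

lemma cinner_homogeneous_part:
  assumes "1 \<le> p"
  shows "cinner (homogeneous_part c UNIV (\<lambda>i. word_op [i]) id p x) y
    = (\<Sum>v | v \<in> levels \<and> p \<le> length v.
        complex_of_real (c (take p v) * b (drop p v) / b v) * xy x y v)"
proof -
  have fin: "finite {\<alpha> :: 'n list. length \<alpha> = p}"
    by (rule finite_subset[OF _ finite_words[of p]]) auto
  have "cinner (homogeneous_part c UNIV (\<lambda>i. word_op [i]) id p x) y
      = (\<Sum>\<alpha> | length \<alpha> = p. \<Sum>w\<in>words_after \<alpha>.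
          complex_of_real (c \<alpha> * b w / b (\<alpha> @ w)) * xy x y (\<alpha> @ w))"
    unfolding homogeneous_part_def cinner_sum_left foldr_word_op adj_word_op
  proof (rule sum.cong[OF refl])
    fix \<alpha> :: "'n list" assume "\<alpha> \<in> {\<alpha>. length \<alpha> = p}"
    then have "\<alpha> \<noteq> []"
      using assms by auto
    then show "cinner (c \<alpha> *\<^sub>R word_op \<alpha> (id (word_adj \<alpha> x))) y
        = (\<Sum>w\<in>words_after \<alpha>. complex_of_real (c \<alpha> * b w / b (\<alpha> @ w)) * xy x y (\<alpha> @ w))"
      by (simp add: scaleR_scaleC cinner_scaleC_left cinner_word_op_word_adj sum_distrib_left mult_ac)
  qed
  also have "\<dots> = (\<Sum>(\<alpha>, w)\<in>(SIGMA \<alpha>:{\<alpha>. length \<alpha> = p}. words_after \<alpha>).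
          complex_of_real (c \<alpha> * b w / b (\<alpha> @ w)) * xy x y (\<alpha> @ w))"
    by (rule sum.Sigma) (use fin in auto)
  also have "\<dots> = (\<Sum>v | v \<in> levels \<and> p \<le> length v.
        complex_of_real (c (take p v) * b (drop p v) / b v) * xy x y v)"
    by (rule sum.reindex_bij_witness[where j = "\<lambda>(\<alpha>, w). \<alpha> @ w" and i = "\<lambda>v. (take p v, drop p v)"])
      (use assms in \<open>auto simp: levels_def words_after_def\<close>)
  finally show ?thesis .
qed

lemma homogeneous_part_0:
  "homogeneous_part c UNIV (\<lambda>i. word_op [i]) R 0 x = c [] *\<^sub>R R x"
proof -
  have "{\<alpha> :: 'n list. length \<alpha> = 0} = {[]}"
    by auto
  then show ?thesis
    unfolding homogeneous_part_def foldr_word_op adj_word_op by (simp add: word_op_def word_adj_def)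
qed

lemma levels_sums:
  fixes t :: "nat \<Rightarrow> complex"
  assumes "\<And>p. 1 \<le> p \<Longrightarrow> t p = (\<Sum>v | v \<in> levels \<and> p \<le> length v. s p v)"
  shows "t sums (t 0 + (\<Sum>v\<in>levels. \<Sum>p\<in>{1..length v}. s p v))"
proof -
  have "t sums (\<Sum>p\<in>{..N}. t p)"
    by (rule sums_finite) (auto simp: assms levels_def intro!: sum.neutral)
  also have "{..N} = insert 0 {1..N}"
    by auto
  also have "sum t (insert 0 {1..N}) = t 0 + (\<Sum>p\<in>{1..N}. \<Sum>v | v \<in> levels \<and> p \<le> length v. s p v)"
    by (simp add: assms)
  also have "(\<Sum>p\<in>{1..N}. \<Sum>v | v \<in> levels \<and> p \<le> length v. s p v)
      = (\<Sum>v\<in>levels. \<Sum>p | p \<in> {1..N} \<and> p \<le> length v. s p v)"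
    by (rule sum.swap_restrict) auto
  also have "\<dots> = (\<Sum>v\<in>levels. \<Sum>p\<in>{1..length v}. s p v)"
    by (intro sum.cong) (auto simp: levels_def)
  finally show ?thesis .
qed

text \<open>The diagonal entry at \<open>v \<in> levels\<close> amounts to
  \<open>ncfps_mult c b v / b v\<close>; its cut at 0 sits in the multiple \<open>c []\<close> of
  the identity.\<close>

lemma homogeneous_part_sums:
  "(\<lambda>p. cinner (homogeneous_part c UNIV (\<lambda>i. word_op [i]) id p x) y) sums
     (c [] * cinner x y
       + (\<Sum>v\<in>levels. complex_of_real ((\<Sum>p\<in>{1..length v}. c (take p v) * b (drop p v)) / b v) * xy x y v))"
  using levels_sums[of "\<lambda>p. cinner (homogeneous_part c UNIV (\<lambda>i. word_op [i]) id p x) y", OF cinner_homogeneous_part]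
  by (simp add: homogeneous_part_0 scaleR_scaleC cinner_scaleC_left sum_divide_distrib sum_distrib_right)

text \<open>When the series is the inverse of \<open>b\<close>, the product with \<open>b\<close> is
  1, so the diagonal entries vanish on \<open>levels\<close>. They equal 1 at the empty word and
  outside the model, which leaves the complementary projection.\<close>

definition defect :: "('i, complex) ell2 \<Rightarrow> ('i, complex) ell2" where
  "defect x = x - (\<Sum>v\<in>levels. ell2_apply x (\<iota> v) *\<^sub>C ell2_basis (\<iota> v))"

lemma cinner_defect: "cinner (defect x) y = cinner x y - (\<Sum>v\<in>levels. xy x y v)"
  by (simp add: defect_def cinner_diff_left cinner_sum_left cinner_scaleC_basis_left)

lemma bounded_clinear_defect: "bounded_clinear defect"
proof (rule bounded_clinearI)
  show "defect (x + y) = defect x + defect y" for x y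
    by (rule cinner_ext_left)
      (simp add: cinner_add_left cinner_defect plus_ell2.rep_eq distrib_right sum.distrib)
  show "defect (c *\<^sub>C x) = c *\<^sub>C defect x" for c x
    by (rule cinner_ext_left)
      (simp add: cinner_scaleC_left cinner_defect scaleC_ell2.rep_eq scaleC_complex_def
        right_diff_distrib sum_distrib_left mult_ac)
  show "norm (defect x) \<le> (1 + real (card levels)) * norm x" for x
  proof -
    have "norm (\<Sum>v\<in>levels. ell2_apply x (\<iota> v) *\<^sub>C ell2_basis (\<iota> v)) \<le> (\<Sum>v\<in>levels. norm x)"
      by (rule sum_norm_le) (simp add: norm_scaleC norm_ell2_basis ell2_norm_apply_le)
    then show ?thesis
      using norm_triangle_ineq4[of x "\<Sum>v\<in>levels. ell2_apply x (\<iota> v) *\<^sub>C ell2_basis (\<iota> v)"]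
      by (simp add: defect_def distrib_right)
  qed
qed

lemma is_defect_defect: "is_defect b UNIV (\<lambda>i. word_op [i]) defect"
proof -
  have "complex_of_real ((\<Sum>p\<in>{1..length v}. ncfps_inverse b (take p v) * b (drop p v)) / b v) = - 1"
    if "v \<in> levels" for v
  proof -
    have "v \<noteq> []"
      using that by (auto simp: levels_def)
    then have "(\<Sum>p\<in>{1..length v}. ncfps_inverse b (take p v) * b (drop p v)) = - b v"
      using ncfps_inverse_recursion[of b v] Nil by (simp add: sum_negf)
    then show ?thesis
      using pos[of v] by simp
  qed
  then have "(ncfps_inverse b [] * cinner x y + (\<Sum>v\<in>levels. complex_of_real
      ((\<Sum>p\<in>{1..length v}. ncfps_inverse b (take p v) * b (drop p v)) / b v) * xy x y v)) = cinner (defect x) y"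
    for x y
    by (simp add: ncfps_inverse_Nil[of b, OF Nil] cinner_defect sum_negf)
  then show ?thesis
    unfolding is_defect_def wot_sums_def
    using homogeneous_part_sums[of "ncfps_inverse b"] bounded_clinear_defect by simp
qed

lemma nonneg_defect: "nonneg_on UNIV defect"
  unfolding nonneg_on_def
proof
  fix x
  have "xy x x v = complex_of_real ((cmod (ell2_apply x (\<iota> v)))\<^sup>2)" for v
    by (simp only: complex_norm_square)
  then have "cinner (defect x) x
      = complex_of_real ((norm x)\<^sup>2 - (\<Sum>v\<in>\<iota> ` levels. (cmod (ell2_apply x v))\<^sup>2))"
    using inj by (simp add: cinner_defect cinner_self sum.reindex[OF inj_on_subset[OF inj subset_UNIV]])
  moreover have "(\<Sum>v\<in>\<iota> ` levels. (cmod (ell2_apply x v))\<^sup>2) \<le> (norm x)\<^sup>2"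
    by (rule ell2_sum_le_norm) simp
  ultimately show "cinner (defect x) x \<in> \<real>\<^sub>\<ge>\<^sub>0"
    by (simp only: nonneg_Reals_of_real_iff)
qed

text \<open>Of the vectors in the range of \<open>word_adj \<alpha>\<close> the defect keeps only
  the component at the empty word. The result has rank at most one, with entry
  \<open>b [] / b \<alpha>\<close> at \<open>\<alpha>\<close>.\<close>

lemma cinner_word_op_defect:
  assumes "\<alpha> \<noteq> []"
  shows "cinner (word_op \<alpha> (defect (word_adj \<alpha> x))) y
    = (if length \<alpha> \<le> N then complex_of_real (1 / b \<alpha>) * xy x y \<alpha> else 0)"
proof -
  let ?s = "\<lambda>w. complex_of_real (b w / b (\<alpha> @ w)) * xy x y (\<alpha> @ w)"
  have xy: "xy (word_adj \<alpha> x) (word_adj \<alpha> y) w = (if w \<in> words_after \<alpha> then ?s w else 0)" for w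
    by (simp add: word_adj_apply[OF assms] mult_ac weight_square)
  have "(\<Sum>v\<in>levels. xy (word_adj \<alpha> x) (word_adj \<alpha> y) v) = (\<Sum>w\<in>words_after \<alpha> - {[]}. ?s w)"
    unfolding xy by (rule sum.mono_neutral_cong_right[OF finite_levels])
      (auto simp: words_after_def levels_def Suc_le_eq)
  moreover have "cinner (word_adj \<alpha> x) (word_adj \<alpha> y) = (\<Sum>w\<in>words_after \<alpha>. ?s w)"
    by (rule trans[OF cinner_word_op[symmetric] cinner_word_op_word_adj[OF assms]])
  ultimately have "cinner (word_op \<alpha> (defect (word_adj \<alpha> x))) y
      = (\<Sum>w\<in>words_after \<alpha>. ?s w) - (\<Sum>w\<in>words_after \<alpha> - {[]}. ?s w)"
    by (simp only: cinner_word_op cinner_defect)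
  also have "\<dots> = (if length \<alpha> \<le> N then ?s [] else 0)"
  proof (cases "length \<alpha> \<le> N")
    case True
    then have "[] \<in> words_after \<alpha>"
      by (simp add: words_after_def)
    then show ?thesis
      using True by (subst sum.remove[of "words_after \<alpha>" "[]"]) auto
  next
    case False
    then have "words_after \<alpha> = {}"
      by (auto simp: words_after_def)
    then show ?thesis
      using False by simp
  qed
  finally show ?thesis
    by (simp add: Nil)
qed

text \<open>The coefficient \<open>b \<alpha>\<close> cancels the entry
  \<open>1 / b \<alpha>\<close>: degree \<open>p \<ge> 1\<close> contributes the projection onto the
  words of length \<open>p\<close> in \<open>levels\<close>, degree 0 contributes
  \<open>defect\<close>, and together they give the identity.\<close>

lemma pure_sums: "wot_sums UNIV (homogeneous_part b UNIV (\<lambda>i. word_op [i]) defect) id"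
proof -
  have "(\<lambda>p. cinner (homogeneous_part b UNIV (\<lambda>i. word_op [i]) defect p x) y) sums cinner x y" for x y
  proof -
    \<comment> \<open>The condition \<open>length v = p\<close> is moved into the summand to match
      the shape required by \<open>levels_sums\<close>.\<close>
    have part: "cinner (homogeneous_part b UNIV (\<lambda>i. word_op [i]) defect p x) y
        = (\<Sum>v | v \<in> levels \<and> p \<le> length v. if length v = p then xy x y v else 0)" if p: "1 \<le> p" for p
    proof -
      have fin: "finite {\<alpha> :: 'n list. length \<alpha> = p}"
        by (rule finite_subset[OF _ finite_words[of p]]) auto
      have "cinner (homogeneous_part b UNIV (\<lambda>i. word_op [i]) defect p x) y
          = (\<Sum>\<alpha> | length \<alpha> = p. if length \<alpha> \<le> N then xy x y \<alpha> else 0)"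
        unfolding homogeneous_part_def cinner_sum_left foldr_word_op adj_word_op
      proof (rule sum.cong[OF refl])
        fix \<alpha> :: "'n list" assume "\<alpha> \<in> {\<alpha>. length \<alpha> = p}"
        then have "\<alpha> \<noteq> []"
          using p by auto
        then show "cinner (b \<alpha> *\<^sub>R word_op \<alpha> (defect (word_adj \<alpha> x))) y = (if length \<alpha> \<le> N then xy x y \<alpha> else 0)"
          using pos[of \<alpha>] by (simp add: scaleR_scaleC cinner_scaleC_left cinner_word_op_defect)
      qed
      also have "\<dots> = (\<Sum>v | v \<in> levels \<and> length v = p. xy x y v)"
        by (rule sum.mono_neutral_cong_right) (use p fin in \<open>auto simp: levels_def\<close>)
      also have "\<dots> = (\<Sum>v | v \<in> levels \<and> p \<le> length v. if length v = p then xy x y v else 0)"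
        by (rule sum.mono_neutral_cong_left) auto
      finally show ?thesis .
    qed
    have "(\<Sum>v\<in>levels. \<Sum>p\<in>{1..length v}. if length v = p then xy x y v else 0) = (\<Sum>v\<in>levels. xy x y v)"
      by (rule sum.cong) (auto simp: levels_def)
    then show ?thesis
      using levels_sums[of "\<lambda>p. cinner (homogeneous_part b UNIV (\<lambda>i. word_op [i]) defect p x) y", OF part]
      by (simp add: homogeneous_part_0 Nil cinner_defect)
  qed
  moreover have "bounded_clinear (id :: ('i, complex) ell2 \<Rightarrow> _)"
    by (rule bounded_clinearI[where K = 1]) auto
  ultimately show ?thesis
    by (simp add: wot_sums_def)
qed

lemma truncated_model_pure: "(\<lambda>i. word_op [i]) \<in> nc_domain_pure b UNIV"
proof -
  have "op_le_on UNIV id (id :: ('i, complex) ell2 \<Rightarrow> _)"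
    by (simp add: op_le_on_def nonneg_on_def)
  then show ?thesis
    unfolding nc_domain_pure_def nc_domain_def
    using bounded_clinear_word_op is_defect_defect nonneg_defect pure_sums by blast
qed

text \<open>The defect for \<open>g\<close> is known only as a weak limit, but its entry at the
  basis vector of \<open>\<gamma>\<close> is the sum of a series already computed. Its positivity,
  multiplied by \<open>b \<gamma>\<close>, is the claim.\<close>

lemma defect_nonneg_imp:
  assumes dom: "(\<lambda>i. word_op [i]) \<in> nc_domain g UNIV" and g: "g [] = 1"
    and \<gamma>: "1 \<le> length \<gamma>" "length \<gamma> \<le> N"
  shows "(\<Sum>p\<in>{1..length \<gamma>}. - ncfps_inverse g (take p \<gamma>) * b (drop p \<gamma>)) \<le> b \<gamma>"
proof -
  obtain \<Delta> where \<Delta>: "is_defect g UNIV (\<lambda>i. word_op [i]) \<Delta>" "nonneg_on UNIV \<Delta>"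
    using dom unfolding nc_domain_def by blast
  let ?e = "ell2_basis (\<iota> \<gamma>)"
  let ?r = "\<lambda>v. (\<Sum>p\<in>{1..length v}. ncfps_inverse g (take p v) * b (drop p v)) / b v"
  have "cinner (\<Delta> ?e) ?e = ncfps_inverse g [] * cinner ?e ?e
      + (\<Sum>v\<in>levels. complex_of_real (?r v) * xy ?e ?e v)"
    using \<Delta>(1) unfolding is_defect_def wot_sums_def
    by (intro sums_unique2[OF _ homogeneous_part_sums]) blast
  also have "(\<Sum>v\<in>levels. complex_of_real (?r v) * xy ?e ?e v) = (\<Sum>v\<in>levels. if v = \<gamma> then complex_of_real (?r v) else 0)"
    by (intro sum.cong) (auto simp: ell2_basis.rep_eq)
  also have "\<dots> = complex_of_real (?r \<gamma>)"
  proof -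
    have "\<gamma> \<in> levels"
      using \<gamma> by (simp add: levels_def)
    then show ?thesis
      by (simp only: sum.delta[OF finite_levels] if_True)
  qed
  finally have "cinner (\<Delta> ?e) ?e = complex_of_real (1 + ?r \<gamma>)"
    by (simp add: ncfps_inverse_Nil[of g, OF g] cinner_ell2_basis)
  moreover have "cinner (\<Delta> ?e) ?e \<in> \<real>\<^sub>\<ge>\<^sub>0"
    using \<Delta>(2) by (auto simp: nonneg_on_def)
  ultimately have "0 \<le> 1 + ?r \<gamma>"
    by (simp only: nonneg_Reals_of_real_iff)
  then have "0 \<le> b \<gamma> * (1 + ?r \<gamma>)"
    using pos[of \<gamma>] by simp
  also have "\<dots> = b \<gamma> + (\<Sum>p\<in>{1..length \<gamma>}. ncfps_inverse g (take p \<gamma>) * b (drop p \<gamma>))"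
    using pos[of \<gamma>] by (simp add: distrib_left)
  finally show ?thesis
    by (simp add: sum_negf)
qed

end

lemma ex_inj_words: "\<exists>\<iota> :: 'n::finite list \<Rightarrow> 'i::infinite. inj \<iota>"
proof -
  obtain e :: "nat \<Rightarrow> 'i" where e: "inj e"
    using infinite_countable_subset[OF infinite_UNIV] by auto
  have "countable (UNIV :: 'n list set)"
    using countable_lists[of "UNIV :: 'n set"] by simp
  then obtain t :: "'n list \<Rightarrow> nat" where "inj t"
    by (auto simp: countable_def)
  then show ?thesis
    using inj_compose[OF e] by blast
qed

lemma domain_inclusion_weights:
  fixes f g :: "'n::finite ncfps"
  assumes "shift_weight f" and g: "g [] = 1"
    and incl: "nc_domain_pure f UNIV \<subseteq> nc_domain_pure g (UNIV :: ('i::infinite, complex) ell2 set)"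
  shows "(\<Sum>p\<in>{1..length \<gamma>}. - ncfps_inverse g (take p \<gamma>) * f (drop p \<gamma>)) \<le> f \<gamma>"
proof (cases "\<gamma> = []")
  case True
  then show ?thesis
    using shift_weight.pos[OF assms(1), of "[]"] by simp
next
  case False
  obtain \<iota> :: "'n list \<Rightarrow> 'i" where "inj \<iota>"
    using ex_inj_words by blast
  \<comment> \<open>The depth varies with \<open>\<gamma>\<close>: the truncation only has to
    contain the basis vector on which positivity is tested.\<close>
  then interpret truncated_model f \<iota> "length \<gamma>"
    using assms(1) by (simp add: truncated_model_def truncated_model_axioms_def)
  have "(\<lambda>i. word_op [i]) \<in> nc_domain g UNIV"
    using truncated_model_pure incl by (auto simp: nc_domain_pure_def)
  then show ?thesis
    using defect_nonneg_imp[of g \<gamma>] g False by (simp add: Suc_le_eq)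
qed

section \<open>Factorisation of multi-analytic operators\<close>

lemma op_le_on_adj_iff:
  fixes A :: "'a::chilbert_space \<Rightarrow> 'c::chilbert_space" and B :: "'b::chilbert_space \<Rightarrow> 'c"
  assumes A: "bounded_clinear A" and B: "bounded_clinear B"
  shows "op_le_on UNIV (A \<circ> adj A) (B \<circ> adj B) \<longleftrightarrow> (\<forall>y. norm (adj A y) \<le> norm (adj B y))"
proof -
  have "cinner (B (adj B y) - A (adj A y)) y = complex_of_real ((norm (adj B y))\<^sup>2 - (norm (adj A y))\<^sup>2)" for y
    by (simp add: cinner_diff_left cinner_adj[OF A] cinner_adj[OF B] cinner_self)
  then show ?thesis
    unfolding op_le_on_def nonneg_on_def o_def
    by (simp only: nonneg_Reals_of_real_iff) (simp add: power_mono_iff)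
qed

text \<open>Moving only \<open>B\<close> across the inner product turns the squared norm of
  \<open>adj A y\<close> into the product of \<open>C (adj A y)\<close> with \<open>adj B y\<close>;
  Cauchy-Schwarz and contractivity let one factor cancel.\<close>

lemma norm_adj_le_of_factorization:
  assumes A: "bounded_clinear A" and B: "bounded_clinear B"
    and AB: "A = B \<circ> C" and C: "\<And>h. norm (C h) \<le> norm h"
  shows "norm (adj A y) \<le> norm (adj B y)"
proof -
  have "(norm (adj A y))\<^sup>2 = cmod (cinner (A (adj A y)) y)"
    by (simp add: cinner_adj[OF A] cinner_self norm_power)
  also have "\<dots> = cmod (cinner (C (adj A y)) (adj B y))"
    by (simp add: AB cinner_adj[OF B])
  also have "\<dots> \<le> norm (C (adj A y)) * norm (adj B y)"
    by (rule cinner_Cauchy_Schwarz)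
  also have "\<dots> \<le> norm (adj A y) * norm (adj B y)"
    by (intro mult_right_mono C norm_ge_zero)
  finally have "norm (adj A y) * norm (adj A y) \<le> norm (adj B y) * norm (adj A y)"
    by (simp add: power2_eq_square mult.commute)
  then show ?thesis
    using mult_right_le_imp_le[of "norm (adj A y)" "norm (adj A y)" "norm (adj B y)"]
    by (cases "norm (adj A y) = 0") auto
qed

text \<open>The adjoint \<open>T\<close> of the desired \<open>C\<close> is built:
  \<open>T (adj B y) = adj A y\<close> dualises to \<open>A = B \<circ> C\<close>, and commuting
  with backward shifts dualises to multi-analyticity.\<close>

lemma contractive_factorization:
  fixes f\<^sub>1 f\<^sub>2 g :: "'n ncfps"
    and A :: "('n, 'f::chilbert_space) fock_tensor \<Rightarrow> ('n, 'f1::chilbert_space) fock_tensor"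
    and B :: "('n, 'f2::chilbert_space) fock_tensor \<Rightarrow> ('n, 'f1) fock_tensor"
  assumes f1: "shift_weight f\<^sub>1" and f2: "shift_weight f\<^sub>2" and g: "shift_weight g"
    and reg: "\<And>\<alpha>. \<alpha> \<noteq> [] \<Longrightarrow> ncfps_inverse g \<alpha> \<le> 0"
    and wt: "\<And>\<gamma>. (\<Sum>p\<in>{1..length \<gamma>}. - ncfps_inverse g (take p \<gamma>) * f\<^sub>2 (drop p \<gamma>)) \<le> f\<^sub>2 \<gamma>"
    and A: "multi_analytic g f\<^sub>1 A" and B: "multi_analytic f\<^sub>2 f\<^sub>1 B"
    and le: "\<And>y. norm (adj A y) \<le> norm (adj B y)"
  shows "\<exists>C :: ('n, 'f) fock_tensor \<Rightarrow> ('n, 'f2) fock_tensor.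
    multi_analytic g f\<^sub>2 C \<and> (\<forall>h. norm (C h) \<le> norm h) \<and> A = B \<circ> C"
proof -
  interpret f1: shift_weight f\<^sub>1 by fact
  interpret f2: shift_weight f\<^sub>2 by fact
  interpret g: shift_weight g by fact
  have bA: "bounded_clinear A" and bB: "bounded_clinear B"
    using A B unfolding multi_analytic_def by simp_all
  note adjA = bshift_adj_multi_analytic[OF g f1 A] and adjB = bshift_adj_multi_analytic[OF f2 f1 B]
  have adj_diff: "adj T (x - y) = adj T x - adj T y" if "bounded_clinear T"
    for T :: "'p::chilbert_space \<Rightarrow> 'q::chilbert_space" and x y
    using adj_add[OF that, of "x - y" y] by simp

  \<comment> \<open>The choice of the preimage does not matter: by \<open>le\<close>, the kernel of
    \<open>adj B\<close> lies in that of \<open>adj A\<close>.\<close>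
  define G0 where "G0 x = ell2_apply (adj A (SOME y. adj B y = x)) []" for x
  have G0: "G0 (adj B y) = ell2_apply (adj A y) []" for y
  proof -
    let ?y = "SOME y'. adj B y' = adj B y"
    have "adj B ?y = adj B y"
      by (rule someI[of "\<lambda>y'. adj B y' = adj B y" y]) (rule refl)
    then have "adj B (?y - y) = 0"
      by (simp add: adj_diff[OF bB])
    then have "adj A (?y - y) = 0"
      using le[of "?y - y"] by simp
    then show ?thesis
      by (simp add: G0_def adj_diff[OF bA])
  qed
  \<comment> \<open>Since \<open>H 0\<close> is the zero space, the filtration below starts exactly
    at the range of \<open>adj B\<close>.\<close>
  define H :: "nat \<Rightarrow> ('n, 'f2) fock_tensor set"
    where "H k = {h. \<forall>w. k \<le> length w \<longrightarrow> ell2_apply h w = 0}" for k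
  define M where "M k = {adj B y + h | y h. h \<in> H k}" for k
  have H0: "H 0 = {0}"
    unfolding H_def by (auto intro!: ell2_eqI simp: zero_ell2.rep_eq)
  have M_I: "adj B y + h \<in> M k" if "h \<in> H k" for y h k
    unfolding M_def using that by blast
  have M_E: "\<exists>y h. x = adj B y + h \<and> h \<in> H k" if "x \<in> M k" for x k
    using that unfolding M_def by blast
  have M0: "\<exists>y. x = adj B y" if "x \<in> M 0" for x
    using M_E[OF that] by (simp add: H0)
  have M0_I: "adj B y \<in> M 0" for y
    using M_I[of 0 0 y] by (simp add: H0)
  have adjB_0: "adj B 0 = 0"
    using adj_diff[OF bB, of 0 0] by simp
  have sub: "csubspace (M k)" for k
    unfolding csubspace_def
  proof (intro conjI ballI allI)
    show "0 \<in> M k"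
      using M_I[of 0 k 0] by (simp add: adjB_0 H_def zero_ell2.rep_eq)
  next
    fix x x' assume "x \<in> M k" "x' \<in> M k"
    then obtain y h y' h' where "x = adj B y + h" "h \<in> H k" "x' = adj B y' + h'" "h' \<in> H k"
      using M_E by metis
    then have "x + x' = adj B (y + y') + (h + h')" "h + h' \<in> H k"
      by (simp_all add: adj_add[OF bB] H_def plus_ell2.rep_eq)
    then show "x + x' \<in> M k"
      using M_I by metis
  next
    fix c x assume "x \<in> M k"
    then obtain y h where "x = adj B y + h" "h \<in> H k"
      using M_E by metis
    then have "c *\<^sub>C x = adj B (c *\<^sub>C y) + c *\<^sub>C h" "c *\<^sub>C h \<in> H k"
      by (simp_all add: adj_scaleC[OF bB] scaleC_add_right H_def scaleC_ell2.rep_eq)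
    then show "c *\<^sub>C x \<in> M k"
      using M_I by metis
  qed
  have M_Suc: "M k \<subseteq> M (Suc k)" for k
    unfolding M_def H_def by fastforce
  have shift_M: "f2.bshift \<alpha> x \<in> M k" if x: "x \<in> M (Suc k)" and \<alpha>: "\<alpha> \<noteq> []" for \<alpha> x k
  proof -
    obtain y h where x: "x = adj B y + h" "h \<in> H (Suc k)"
      using M_E[OF x] by blast
    have "f2.bshift \<alpha> h \<in> H k"
      using x(2) \<alpha> by (cases \<alpha>) (auto simp: H_def f2.bshift_apply)
    then show ?thesis
      unfolding x(1) bounded_clinearD(1)[OF f2.bounded_clinear_bshift] adjB by (rule M_I)
  qed
  have dense: "closure (\<Union>k. M k) = UNIV"
  proof -
    have "H k \<subseteq> M k" for k
      using M_I[of _ k 0] by (auto simp: adjB_0)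
    then have "closure (\<Union>k. H k) \<subseteq> closure (\<Union>k. M k)"
      by (intro closure_mono UN_mono subset_refl)
    then show ?thesis
      unfolding H_def closure_finite_degree by (rule equalityI[OF subset_UNIV])
  qed
  have G0_lin: "clinear_on (M 0) G0"
    unfolding clinear_on_def
  proof (intro conjI ballI allI)
    fix x x' assume "x \<in> M 0" "x' \<in> M 0"
    then obtain y y' where "x = adj B y" "x' = adj B y'"
      using M0 by metis
    then show "G0 (x + x') = G0 x + G0 x'"
      using G0[of "y + y'"] by (simp add: adj_add[OF bB] adj_add[OF bA] G0 plus_ell2.rep_eq)
  next
    fix c x assume "x \<in> M 0"
    then obtain y where "x = adj B y"
      using M0 by metis
    then show "G0 (c *\<^sub>C x) = c *\<^sub>C G0 x"
      using G0[of "c *\<^sub>C y"] by (simp add: adj_scaleC[OF bB] adj_scaleC[OF bA] G0 scaleC_ell2.rep_eq)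
  qed
  \<comment> \<open>Shifting \<open>adj A y\<close> back by \<open>\<beta>\<close> brings its
    coordinate at \<open>\<beta>\<close> to the empty word, divided by
    \<open>sqrt (g \<beta>)\<close>. The sum to be bounded for \<open>G0\<close> is thus a partial
    sum of the squared norm of \<open>adj A y\<close>.\<close>
  have G0_shift: "sqrt (g \<beta>) *\<^sub>R G0 (f2.bshift \<beta> (adj B y)) = ell2_apply (adj A y) \<beta>" for \<beta> y
  proof -
    have "sqrt (g \<beta>) * sqrt (1 / g \<beta>) = 1"
      using g.pos[of \<beta>] by (simp flip: real_sqrt_mult)
    then show ?thesis
      by (simp add: adjB G0 g.bshift_apply g.Nil flip: adjA)
  qed
  have G0_le: "(\<Sum>\<beta>\<in>S. g \<beta> * (norm (G0 (f2.bshift \<beta> x)))\<^sup>2) \<le> (norm x)\<^sup>2"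
    if x: "x \<in> M 0" and S: "finite S" for x S
  proof -
    obtain y where y: "x = adj B y"
      using M0[OF x] by blast
    have "g \<beta> * (norm (G0 (f2.bshift \<beta> x)))\<^sup>2 = (norm (sqrt (g \<beta>) *\<^sub>R G0 (f2.bshift \<beta> x)))\<^sup>2" for \<beta>
      using g.pos[of \<beta>] by (simp add: power_mult_distrib)
    then have "(\<Sum>\<beta>\<in>S. g \<beta> * (norm (G0 (f2.bshift \<beta> x)))\<^sup>2) = (\<Sum>\<beta>\<in>S. (norm (ell2_apply (adj A y) \<beta>))\<^sup>2)"
      by (simp only: y G0_shift)
    also have "\<dots> \<le> (norm (adj A y))\<^sup>2"
      by (rule ell2_sum_le_norm[OF S])
    also have "\<dots> \<le> (norm x)\<^sup>2"
      unfolding y by (intro power_mono le norm_ge_zero)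
    finally show ?thesis .
  qed
  obtain G where G: "bounded_clinear G" and G_ext: "\<And>x. x \<in> M 0 \<Longrightarrow> G x = G0 x"
    and G_le: "\<And>x S. finite S \<Longrightarrow> (\<Sum>\<beta>\<in>S. g \<beta> * (norm (G (f2.bshift \<beta> x)))\<^sup>2) \<le> (norm x)\<^sup>2"
  proof (rule filtration_extension[where L = f2.bshift and b = g and c = "\<lambda>\<alpha>. - ncfps_inverse g \<alpha>" and M = M and ?G0.0 = G0])
    show "0 \<le> g \<alpha>" for \<alpha>
      using g.pos[of \<alpha>] by simp
    show "0 \<le> - ncfps_inverse g \<alpha>" if "\<alpha> \<noteq> []" for \<alpha>
      using reg[OF that] by simp
    show "g \<gamma> = (\<Sum>p\<in>{1..length \<gamma>}. - ncfps_inverse g (take p \<gamma>) * g (drop p \<gamma>))" if "\<gamma> \<noteq> []" for \<gamma>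
      by (rule ncfps_inverse_recursion[of g, OF g.Nil that])
    show "(\<Sum>\<alpha>\<in>S. - ncfps_inverse g \<alpha> * (norm (f2.bshift \<alpha> x))\<^sup>2) \<le> (norm x)\<^sup>2"
      if "finite S" "[] \<notin> S" for S and x :: "('n, 'f2) fock_tensor"
      by (rule f2.bshift_contraction[OF _ wt that]) (use reg in simp)
    fix G :: "('n, 'f2) fock_tensor \<Rightarrow> 'f"
    assume "bounded_clinear G" "\<And>x. x \<in> M 0 \<Longrightarrow> G x = G0 x"
      "\<And>x S. finite S \<Longrightarrow> (\<Sum>\<beta>\<in>S. g \<beta> * (norm (G (f2.bshift \<beta> x)))\<^sup>2) \<le> (norm x)\<^sup>2"
    then show thesis
      by (rule that)
  qed (assumption | rule f2.bounded_clinear_bshift f2.bshift_Nil f2.bshift_append g.Nil sub M_Suc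
      shift_M dense G0_lin G0_le)+
  define T :: "('n, 'f2) fock_tensor \<Rightarrow> ('n, 'f) fock_tensor"
    where "T x = Abs_ell2 (\<lambda>\<beta>. sqrt (g \<beta>) *\<^sub>R G (f2.bshift \<beta> x))" for x
  have T_sum: "(\<Sum>\<beta>\<in>S. (norm (sqrt (g \<beta>) *\<^sub>R G (f2.bshift \<beta> x)))\<^sup>2) \<le> (norm x)\<^sup>2" if "finite S" for S x
    using G_le[OF that, of x] g.pos by (simp add: power_mult_distrib less_imp_le)
  have T_apply: "ell2_apply (T x) \<beta> = sqrt (g \<beta>) *\<^sub>R G (f2.bshift \<beta> x)" for x \<beta>
  proof -
    have "(\<lambda>\<beta>. (norm (sqrt (g \<beta>) *\<^sub>R G (f2.bshift \<beta> x)))\<^sup>2) summable_on UNIV"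
    proof (rule nonneg_bdd_above_summable_on)
      show "bdd_above (sum (\<lambda>\<beta>. (norm (sqrt (g \<beta>) *\<^sub>R G (f2.bshift \<beta> x)))\<^sup>2) ` {F. F \<subseteq> UNIV \<and> finite F})"
        by (rule bdd_aboveI2[where M = "(norm x)\<^sup>2"], rule T_sum) simp
    qed (rule zero_le_power2)
    then show ?thesis
      by (simp add: T_def Abs_ell2_inverse)
  qed
  have T_le: "norm (T x) \<le> 1 * norm x" for x
    using T_sum by (intro ell2_norm_leI) (simp_all add: T_apply del: norm_scaleR)
  have T: "bounded_clinear T"
  proof (rule bounded_clinearI[OF _ _ T_le])
    show "T (x + y) = T x + T y" for x y
      by (rule ell2_eqI) (simp add: T_apply plus_ell2.rep_eq scaleR_add_right
          bounded_clinearD(1)[OF G] bounded_clinearD(1)[OF f2.bounded_clinear_bshift])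
    show "T (c *\<^sub>C x) = c *\<^sub>C T x" for c x
      by (rule ell2_eqI) (simp add: T_apply scaleC_ell2.rep_eq scaleR_scaleC scaleC_scaleC mult.commute
          bounded_clinearD(2)[OF G] bounded_clinearD(2)[OF f2.bounded_clinear_bshift])
  qed
  have T_shift: "T (f2.bshift [i] x) = g.bshift [i] (T x)" for i x
  proof (rule ell2_eqI)
    fix \<beta>
    have "sqrt (g \<beta> / g (i # \<beta>)) * sqrt (g (i # \<beta>)) = sqrt (g \<beta>)"
      using g.pos[of "i # \<beta>"] by (simp flip: real_sqrt_mult)
    then show "ell2_apply (T (f2.bshift [i] x)) \<beta> = ell2_apply (g.bshift [i] (T x)) \<beta>"
      using f2.bshift_append[of "[i]" \<beta> x] by (simp add: T_apply g.bshift_apply)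
  qed
  have T_adj: "T (adj B y) = adj A y" for y
  proof (rule ell2_eqI)
    fix \<beta>
    have "f2.bshift \<beta> (adj B y) \<in> M 0"
      unfolding adjB by (rule M0_I)
    then show "ell2_apply (T (adj B y)) \<beta> = ell2_apply (adj A y) \<beta>"
      by (simp add: T_apply G_ext G0_shift)
  qed
  have "bounded_clinear (adj T)"
    by (rule bounded_clinearI[OF adj_add[OF T] adj_scaleC[OF T] norm_adj_le[OF T T_le]]) simp
  moreover have "adj T (amplify (universal_model g i) h) = amplify (universal_model f\<^sub>2 i) (adj T h)" for i h
    by (rule cinner_ext_left)
      (simp only: cinner_adj_left[OF T] g.cinner_amplify_universal_model
        f2.cinner_amplify_universal_model T_shift)
  ultimately have "multi_analytic g f\<^sub>2 (adj T)"
    by (simp add: multi_analytic_def fun_eq_iff)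
  moreover have "norm (adj T h) \<le> norm h" for h
    using norm_adj_le[OF T T_le, of h] by simp
  moreover have "A h = B (adj T h)" for h
    by (rule cinner_ext_left)
      (simp only: cinner_adj[OF A[unfolded multi_analytic_def, THEN conjunct1]] cinner_adj[OF bB]
        cinner_adj_left[OF T] T_adj)
  ultimately show ?thesis
    by (intro exI[of _ "adj T"]) (simp add: fun_eq_iff)
qed

theorem theorem5p4:
  fixes f\<^sub>1 f\<^sub>2 g :: "'n::finite ncfps"
    and A :: "('n, 'f::chilbert_space) fock_tensor \<Rightarrow> ('n, 'f1::chilbert_space) fock_tensor"
    and B :: "('n, 'f2::chilbert_space) fock_tensor \<Rightarrow> ('n, 'f1) fock_tensor"
  assumes "admissible f\<^sub>1" and "admissible f\<^sub>2" and "admissible g"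
    and "regular_domain g"
    and "\<And>H :: ('i::infinite, complex) ell2 set. closed_csubspace H \<Longrightarrow>
           nc_domain_pure f\<^sub>1 H \<union> nc_domain_pure f\<^sub>2 H \<subseteq> nc_domain_pure g H"
    and "multi_analytic g f\<^sub>1 A"
    and "multi_analytic f\<^sub>2 f\<^sub>1 B"
  shows "(\<exists>C :: ('n, 'f) fock_tensor \<Rightarrow> ('n, 'f2) fock_tensor.
            multi_analytic g f\<^sub>2 C \<and> (\<forall>h. norm (C h) \<le> norm h) \<and> A = B \<circ> C)
         \<longleftrightarrow> op_le_on UNIV (A \<circ> adj A) (B \<circ> adj B)"
proof -
  have bA: "bounded_clinear A" and bB: "bounded_clinear B"
    using assms(6,7) by (simp_all add: multi_analytic_def)
  note weights = assms(1-3)[THEN shift_weight_admissible]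
  \<comment> \<open>The inclusion is applied on the whole space, which has room for all truncated
    models because the countable set of words embeds into the infinite index type.\<close>
  have "closed_csubspace (UNIV :: ('i, complex) ell2 set)"
    by (simp add: closed_csubspace_def)
  then have "nc_domain_pure f\<^sub>2 (UNIV :: ('i, complex) ell2 set) \<subseteq> nc_domain_pure g UNIV"
    using assms(5) by blast
  note wt = domain_inclusion_weights[of f\<^sub>2 g, OF weights(2) shift_weight.Nil[OF weights(3)] this]
  have reg: "ncfps_inverse g \<alpha> \<le> 0" if "\<alpha> \<noteq> []" for \<alpha>
    using assms(4) that by (auto simp: regular_domain_def)
  show ?thesis
    unfolding op_le_on_adj_iff[OF bA bB]
  proof
    assume "\<exists>C. multi_analytic g f\<^sub>2 C \<and> (\<forall>h. norm (C h) \<le> norm h) \<and> A = B \<circ> C"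
    then obtain C where "\<And>h. norm (C h) \<le> norm h" "A = B \<circ> C"
      by blast
    then show "\<forall>y. norm (adj A y) \<le> norm (adj B y)"
      using norm_adj_le_of_factorization[OF bA bB] by blast
  next
    assume "\<forall>y. norm (adj A y) \<le> norm (adj B y)"
    then show "\<exists>C. multi_analytic g f\<^sub>2 C \<and> (\<forall>h. norm (C h) \<le> norm h) \<and> A = B \<circ> C"
      using contractive_factorization[OF weights reg wt assms(6,7)] by blast
  qed
qed

end
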